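(* Let $\mathfrak l=\bigoplus_{i=1}^4\mathbb Re_i$ be the filiform nilpotent Lie algebra of step $3$, with brackets $[e_1,e_2]=e_3$, $[e_1,e_3]=e_4$, $[e_1,e_4]=[e_2,e_3]=[e_2,e_4]=[e_3,e_4]=0$; write $A=e_1$, $T=e_2$. Take the bias $\overline X_{\mathfrak l}=T \bmod[\mathfrak l,\mathfrak l]$ and the weight decomposition $\mathfrak m^{(1)}_{\mathfrak l}=\mathbb RA\oplus\mathbb RT$, $\mathfrak m^{(2)}_{\mathfrak l}=0$, $\mathfrak m^{(3)}_{\mathfrak l}=\mathbb Re_3$, $\mathfrak m^{(4)}_{\mathfrak l}=\mathbb Re_4$. Let $\sigma_{\mathfrak l}$ be the diffusion law on $(\mathfrak l,*')$ with generator $\mathscr L_t=\frac12\sum_{i=1}^q(\mathrm{Ad}(t\chi_{\mathfrak l})E_i)^2$, where $E_1,\dots,E_q$ are vectors with linear span $\mathfrak m^{(1)}_{\mathfrak l}$. Then the support of the time-$1$ distribution of $\sigma_{\mathfrak l}$ is $$\Big\{s_1A+s_2T+s_3e_3+s_4e_4\ :\ 2s_4\ge(s_1+s_3)s_3\Big\}.$$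
   Context: Bias extension: $\tilde{\mathfrak l}=\mathfrak l\oplus\mathbb R\chi_{\mathfrak l}$, with $[\chi_{\mathfrak l},y]=[T,y]$ for $y\in\mathfrak l$; graded pieces are $\mathfrak m^{(1)}_{\mathfrak l}$, $\tilde{\mathfrak m}^{(2)}_{\mathfrak l}=\mathbb R\chi_{\mathfrak l}$, $\mathfrak m^{(3)}_{\mathfrak l}$, $\mathfrak m^{(4)}_{\mathfrak l}$. The graded bracket on $\tilde{\mathfrak l}$ is $[x,y]'=$ the projection of $[x,y]$ to the piece of weight $i+j$ when $x,y$ have weights $i,j$; here it coincides with $[.,.]$ except that $T$ becomes central. $*'$ is the Lie group product on $\tilde{\mathfrak l}$ (and on its ideal $\mathfrak l$) associated to $[.,.]'$ by the Campbell–Hausdorff formula, and $\mathrm{Ad}(Y)Z=Y*'Z*'(-Y)$. (In the paper's general family of operators $\frac12\sum(\mathrm{Ad}(t\mathcal Y)E_i)^2+\mathrm{Ad}(t\mathcal Y)B$ with $B\in\mathfrak m^{(2)}$ and $\mathcal Y\in\chi+\mathfrak m^{(2)}$, one has here $B=0$ and $\mathcal Y=\chi_{\mathfrak l}$ since $\mathfrak m^{(2)}_{\mathfrak l}=0$.) Vectors are identified with left-invariant vector fields on $(\mathfrak l,*')$. The diffusion law with generator $\mathscr L$ is the unique law on continuous paths $c:\mathbb R^+\to\mathfrak l$ with $c(0)=0$, independent left increments $c(t_i)^{-1}*'c(t_{i+1})$, and such that $f(c(t))-\int_0^t(\mathscr L_rf)(c(r))dr$ is a martingale for all $f\in C_c^\infty(\mathfrak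 l)$; the time-$1$ distribution is the law of $c(1)$. *)

theory Defs
  imports "HOL-Probability.Probability"
begin

section \<open>The filiform Lie algebra and its bias extension\<close>

type_synonym fil = "real ^ 4"

abbreviation bas :: "4 \<Rightarrow> fil" where "bas i \<equiv> axis i 1"
abbreviation vA :: fil where "vA \<equiv> bas 1"
abbreviation vT :: fil where "vT \<equiv> bas 2"

definition lie_br :: "fil \<Rightarrow> fil \<Rightarrow> fil" where
  "lie_br x y = (x $ 1 * y $ 2 - x $ 2 * y $ 1) *\<^sub>R bas 3
              + (x $ 1 * y $ 3 - x $ 3 * y $ 1) *\<^sub>R bas 4"

text \<open>The pair \<open>(x, a)\<close> stands for \<open>x + a \<chi>\<close>; the algebra itself is the ideal of the pairs
  \<open>(x, 0)\<close>.\<close>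

type_synonym ext = "fil \<times> real"

abbreviation chi :: ext where "chi \<equiv> (0, 1)"

definition ext_br :: "ext \<Rightarrow> ext \<Rightarrow> ext" where
  "ext_br X Y = (lie_br (fst X) (fst Y) + snd X *\<^sub>R lie_br vT (fst Y) - snd Y *\<^sub>R lie_br vT (fst X), 0)"

text \<open>The weight 2 of \<open>\<chi>\<close> enters through the second component of \<open>ext_proj\<close>.\<close>

definition weight :: "4 \<Rightarrow> nat" where
  "weight i = (if i = 3 then 3 else if i = 4 then 4 else 1)"

definition weight_space :: "nat \<Rightarrow> fil set" where
  "weight_space k = span {bas i | i. weight i = k}"

definition ext_proj :: "nat \<Rightarrow> ext \<Rightarrow> ext" where
  "ext_proj k X = ((\<chi> i. if weight i = k then fst X $ i else 0), if k = 2 then snd X else 0)"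

definition gr_br :: "ext \<Rightarrow> ext \<Rightarrow> ext" where
  "gr_br X Y = (\<Sum>i=1..4. \<Sum>j=1..4. ext_proj (i + j) (ext_br (ext_proj i X) (ext_proj j Y)))"

lemma lie_br_bas:
  "lie_br (bas 1) (bas 2) = bas 3" "lie_br (bas 1) (bas 3) = bas 4" "lie_br (bas 1) (bas 4) = 0"
  "lie_br (bas 2) (bas 3) = 0" "lie_br (bas 2) (bas 4) = 0" "lie_br (bas 3) (bas 4) = 0"
  by (simp_all add: lie_br_def axis_def)

lemma weight_space_1: "weight_space 1 = span {vA, vT}"
proof -
  have "{i. weight i = 1} = {1, 2}"
    using exhaust_4 by (fastforce simp: weight_def)
  then have "{bas i | i. weight i = 1} = {vA, vT}"
    by (auto simp: setcompr_eq_image)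
  then show ?thesis by (simp add: weight_space_def)
qed

lemma gr_br_eq:
  "gr_br X Y = ((fst X $ 1 * snd Y - snd X * fst Y $ 1) *\<^sub>R bas 3
              + (fst X $ 1 * fst Y $ 3 - fst X $ 3 * fst Y $ 1) *\<^sub>R bas 4, 0)"
  by (simp add: gr_br_def ext_br_def ext_proj_def lie_br_def weight_def axis_def numeral_eq_Suc
        prod_eq_iff vec_eq_iff forall_4 fst_sum snd_sum)

text \<open>All fourfold brackets vanish, so the Campbell--Hausdorff series stops after its cubic terms.\<close>

lemma gr_br_nilpotent: "gr_br X (gr_br Y (gr_br Z W)) = 0"
  by (simp add: gr_br_eq axis_def zero_prod_def)

definition bch :: "ext \<Rightarrow> ext \<Rightarrow> ext" where
  "bch X Y = X + Y + (1/2) *\<^sub>R gr_br X Y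
     + (1/12) *\<^sub>R (gr_br X (gr_br X Y) + gr_br Y (gr_br Y X))"

definition fil_mult :: "fil \<Rightarrow> fil \<Rightarrow> fil" where
  "fil_mult x y = fst (bch (x, 0) (y, 0))"

lemma bch_ideal: "bch (x, 0) (y, 0) = (fil_mult x y, 0)"
  by (simp add: fil_mult_def bch_def gr_br_eq prod_eq_iff)

definition ext_Ad :: "ext \<Rightarrow> ext \<Rightarrow> ext" where
  "ext_Ad Y Z = bch (bch Y Z) (- Y)"

lemma ext_Ad_ideal: "snd (ext_Ad Y (x, 0)) = 0"
  by (simp add: ext_Ad_def bch_def gr_br_eq)

section \<open>The diffusion law\<close>

definition left_inv_field :: "fil \<Rightarrow> (fil \<Rightarrow> real) \<Rightarrow> fil \<Rightarrow> real" where
  "left_inv_field v f x = deriv (\<lambda>h. f (fil_mult x (h *\<^sub>R v))) 0"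

definition diff_generator :: "nat \<Rightarrow> (nat \<Rightarrow> fil) \<Rightarrow> real \<Rightarrow> (fil \<Rightarrow> real) \<Rightarrow> fil \<Rightarrow> real" where
  "diff_generator q E t f x =
     (1/2) * (\<Sum>i=1..q. let V = left_inv_field (fst (ext_Ad (t *\<^sub>R chi) (E i, 0))) in V (V f) x)"

fun C_k :: "nat \<Rightarrow> ('a::euclidean_space \<Rightarrow> real) \<Rightarrow> bool" where
  "C_k 0 f \<longleftrightarrow> continuous_on UNIV f"
| "C_k (Suc k) f \<longleftrightarrow>
     f differentiable_on UNIV \<and> (\<forall>v. C_k k (\<lambda>x. frechet_derivative f (at x) v))"

definition test_function :: "('a::euclidean_space \<Rightarrow> real) \<Rightarrow> bool" where
  "test_function f \<longleftrightarrow> (\<forall>k. C_k k f) \<and> compact (closure {x. f x \<noteq> 0})"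

text \<open>Paths are functions on \<open>{0..}\<close>, extended by \<open>undefined\<close>; the \<open>\<sigma>\<close>-algebra is generated by
  the evaluation maps.\<close>

definition path_space :: "(real \<Rightarrow> fil) measure" where
  "path_space = restrict_space (\<Pi>\<^sub>M t\<in>{0..}. borel) {c. continuous_on {0..} c}"

definition path_filtration :: "real \<Rightarrow> (real \<Rightarrow> fil) measure" where
  "path_filtration s = sigma (space path_space)
     {(\<lambda>c. c r) -` B \<inter> space path_space | r B. r \<in> {0..s} \<and> B \<in> sets borel}"

definition martingale :: "'a measure \<Rightarrow> (real \<Rightarrow> 'a measure) \<Rightarrow> (real \<Rightarrow> 'a \<Rightarrow> real) \<Rightarrow> bool" where
  "martingale M F X \<longleftrightarrow>
     (\<forall>t\<ge>0. integrable M (X t) \<and> X t \<in> borel_measurable (F t)) \<and>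
     (\<forall>s t. 0 \<le> s \<and> s \<le> t \<longrightarrow> (AE w in M. real_cond_exp M (F s) (X t) w = X s w))"

lemma fil_mult_minus: "fil_mult (- x) x = 0" "fil_mult x (- x) = 0"
  by (simp_all add: fil_mult_def bch_def gr_br_eq)

definition diffusion_law ::
  "(real \<Rightarrow> (fil \<Rightarrow> real) \<Rightarrow> fil \<Rightarrow> real) \<Rightarrow> (real \<Rightarrow> fil) measure \<Rightarrow> bool" where
  "diffusion_law L \<sigma> \<longleftrightarrow>
     prob_space \<sigma> \<and> sets \<sigma> = sets path_space \<and>
     (AE c in \<sigma>. c 0 = 0) \<and>
     (\<forall>(n::nat) t. 0 \<le> t 0 \<and> (\<forall>i<n. t i \<le> t (Suc i)) \<longrightarrow>
        prob_space.indep_vars \<sigma> (\<lambda>_. borel)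
          (\<lambda>i c. fil_mult (- c (t i)) (c (t (Suc i)))) {..<n}) \<and>
     (\<forall>f. test_function f \<longrightarrow>
        martingale \<sigma> path_filtration (\<lambda>t c. f (c t) - (LBINT r:{0..t}. L r f (c r))))"

definition msupport :: "'a::topological_space measure \<Rightarrow> 'a set" where
  "msupport \<mu> = {x. \<forall>U. open U \<and> x \<in> U \<longrightarrow> emeasure \<mu> U > 0}"

end

theory Submission
  imports Defs
begin

text \<open>
In coordinates, the graded group is a Heisenberg group on the first, third and fourth axes times
a central line (the second axis), and \<open>Ad (t \<chi>)\<close> sends \<open>A\<close> to \<open>A - t e\<^sub>3\<close>.  Heuristically the
diffusion \<open>c\<close> therefore has a nondegenerate planar Brownian motion \<open>(c\<^sub>1, c\<^sub>2)\<close> as its first two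
coordinates, while \<open>dc\<^sub>3 = - t dc\<^sub>1\<close> and \<open>dc\<^sub>4 = - (t c\<^sub>1 + c\<^sub>3) / 2 dc\<^sub>1\<close>.  Integration by parts
turns this into
  \<open>c\<^sub>3(t) + t c\<^sub>1(t) = \<integral>\<^sub>0\<^sup>t c\<^sub>1\<close>  and  \<open>2 c\<^sub>4(t) + (t c\<^sub>1(t) + c\<^sub>3(t)) c\<^sub>1(t) = \<integral>\<^sub>0\<^sup>t c\<^sub>1\<^sup>2\<close>.
At time 1 the inequality \<open>2 s\<^sub>4 \<ge> (s\<^sub>1 + s\<^sub>3) s\<^sub>3\<close> says precisely that the second integral is at
least the square of the first: it is the Cauchy--Schwarz inequality on \<open>[0, 1]\<close>.  It is the only
constraint, since a Brownian path stays close to any prescribed continuous curve with the same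
starting point with positive probability.

The law is given only through its martingale problem, and the proof never leaves that setting: no
stochastic integral is constructed.  Freeze the time in the two functionals above at the left end
\<open>s\<close> of a short interval, that is, take \<open>lin s 0 1 = x\<^sub>3 + s x\<^sub>1\<close> and
\<open>energy s = x\<^sub>4 + (s x\<^sub>1 + x\<^sub>3) x\<^sub>1 / 2\<close>.  The generating fields at time \<open>r\<close> multiply the derivatives
of these functions by \<open>s - r\<close>, so over an interval of length \<open>\<delta>\<close> their increments have second
moments of order \<open>\<delta>\<^sup>3\<close> (\<open>lin_frozen_second_moment\<close>, \<open>energy_second_moment\<close>).  These moments come
from the martingale property of \<open>cos (\<theta> G)\<close> and \<open>sin (\<theta> G)\<close>, which are bounded and, after a
homogeneous cutoff, compactly supported (\<open>dynkin\<close>, \<open>trig_increment\<close>).  Both functionals telescope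
along a partition of mesh \<open>1/n\<close>; the \<open>n\<close> errors, each of order \<open>n\<^sup>-\<^sup>3\<^sup>/\<^sup>2\<close>, disappear in the limit, and the
discrete Cauchy--Schwarz inequality gives one inclusion (\<open>AE_lin_square_le_energy\<close>).

For the other inclusion, independence of the left increments shows that the support of \<open>c(1)\<close>
contains every product of support points of the successive increments (\<open>product_in_support\<close>).
From each point of a tube of radius \<open>\<epsilon>\<close> around a Lipschitz curve, the Gaussian increment of
\<open>(c\<^sub>1, c\<^sub>2)\<close> over a time \<open>\<delta>\<close> stays in the tube with a probability bounded below as \<open>\<delta>\<close> tends to 0,
because it moves by \<open>\<surd>\<delta>\<close> whereas the curve moves by \<open>\<delta>\<close>; the errors in the other two coordinates
exceed \<open>\<epsilon> \<delta>\<close> only with a probability of order \<open>\<surd>\<delta>\<close> (\<open>step_positive\<close>).  So support points can be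
chosen one after the other inside the tube (\<open>reach\<close>), and it remains to find a curve with given end
point and, approximately, given integrals of itself and of its square (\<open>target_in_support\<close>).
\<close>

section \<open>Smooth functions and cutoffs\<close>


definition smooth :: "('a::euclidean_space \<Rightarrow> real) \<Rightarrow> bool" where
  "smooth f \<longleftrightarrow> (\<forall>k. C_k k f)"

lemma C_k_Suc_imp: "C_k (Suc k) f \<Longrightarrow> C_k k f"
proof (induction k arbitrary: f)
  case 0
  then show ?case by (simp add: differentiable_imp_continuous_on)
next
  case (Suc k)
  then show ?case by (metis C_k.simps(2))
qed

lemma C_k_const: "C_k k (\<lambda>x. c)"
  by (induction k arbitrary: c) (auto simp: differentiable_on_def)

lemma C_k_bounded_linear:
  assumes "bounded_linear l"
  shows "C_k k l"
proof (cases k)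
  case 0
  then show ?thesis using assms by (simp add: linear_continuous_on)
next
  case (Suc j)
  have "frechet_derivative l (at x) = l" for x
    using assms bounded_linear_imp_has_derivative frechet_derivative_at by metis
  then show ?thesis
    using assms Suc by (simp add: C_k_const bounded_linear_imp_differentiable_on)
qed

lemma C_k_add:
  assumes "C_k k f" "C_k k g"
  shows "C_k k (\<lambda>x. f x + g x)"
  using assms
proof (induction k arbitrary: f g)
  case 0
  then show ?case by (auto intro: continuous_intros)
next
  case (Suc k)
  have df: "f differentiable (at x)" "g differentiable (at x)" for x
    using Suc.prems by (auto simp: differentiable_on_def)
  have "frechet_derivative (\<lambda>x. f x + g x) (at x) =
      (\<lambda>v. frechet_derivative f (at x) v + frechet_derivative g (at x) v)" for x
    by (rule frechet_derivative_at[symmetric])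
      (intro has_derivative_add df[THEN frechet_derivative_works[THEN iffD1]])
  then show ?case using Suc by (auto intro: differentiable_on_add)
qed

lemma C_k_mult:
  assumes "C_k k f" "C_k k g"
  shows "C_k k (\<lambda>x. f x * g x)"
  using assms
proof (induction k arbitrary: f g)
  case 0
  then show ?case by (auto intro: continuous_intros)
next
  case (Suc k)
  have df: "f differentiable (at x)" "g differentiable (at x)" for x
    using Suc.prems by (auto simp: differentiable_on_def)
  have eq: "frechet_derivative (\<lambda>x. f x * g x) (at x) =
      (\<lambda>v. f x * frechet_derivative g (at x) v + frechet_derivative f (at x) v * g x)" for x
    by (rule frechet_derivative_at[symmetric])
      (intro has_derivative_mult df[THEN frechet_derivative_works[THEN iffD1]])
  have "C_k k f" "C_k k g" using Suc.prems C_k_Suc_imp by blast+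
  then show ?case unfolding C_k.simps eq
    using Suc by (auto intro!: differentiable_on_mult C_k_add)
qed

lemma C_k_compose:
  fixes F :: "real \<Rightarrow> real"
  assumes "C_k k F" "C_k k g"
  shows "C_k k (\<lambda>x. F (g x))"
  using assms
proof (induction k arbitrary: F g)
  case 0
  then show ?case
    by (auto intro: continuous_on_compose2[of UNIV F])
next
  case (Suc k)
  have df: "F differentiable (at y)" "g differentiable (at x)" for x y
    using Suc.prems by (auto simp: differentiable_on_def)
  have eq: "frechet_derivative (\<lambda>x. F (g x)) (at x) =
      (\<lambda>v. frechet_derivative F (at (g x)) 1 * frechet_derivative g (at x) v)" for x
  proof -
    have "((\<lambda>x. F (g x)) has_derivative
        (\<lambda>v. frechet_derivative F (at (g x)) (frechet_derivative g (at x) v))) (at x)"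
      by (rule has_derivative_compose) (use df frechet_derivative_works in blast)+
    moreover have "frechet_derivative F (at (g x)) w = frechet_derivative F (at (g x)) 1 * w" for w
      using linear_frechet_derivative[OF df(1)[of "g x"], THEN linear_cmul, of w 1] by simp
    ultimately show ?thesis by (metis (no_types, lifting) frechet_derivative_at has_derivative_eq_rhs ext)
  qed
  have "C_k k g" using Suc.prems C_k_Suc_imp by blast
  moreover have "(\<lambda>x. F (g x)) differentiable_on UNIV"
    using df by (auto simp: differentiable_on_def intro!: differentiable_chain_at[of g _ F, unfolded o_def])
  ultimately show ?case unfolding C_k.simps eq
    using Suc by (auto intro!: C_k_mult)
qed

lemma C_k_compose_linear:
  assumes "C_k k f" "bounded_linear l"
  shows "C_k k (\<lambda>x. f (l x))"
  using assms(1)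
proof (induction k arbitrary: f)
  case 0
  then show ?case
    using assms(2) by (auto intro: continuous_on_compose2[of UNIV f] linear_continuous_on)
next
  case (Suc k)
  have df: "f differentiable (at y)" for y
    using Suc.prems by (auto simp: differentiable_on_def)
  have D: "((\<lambda>x. f (l x)) has_derivative (\<lambda>v. frechet_derivative f (at (l x)) (l v))) (at x)" for x
    by (rule has_derivative_compose[OF bounded_linear_imp_has_derivative[OF assms(2)]])
      (use df frechet_derivative_works in blast)
  then have "frechet_derivative (\<lambda>x. f (l x)) (at x) = (\<lambda>v. frechet_derivative f (at (l x)) (l v))" for x
    by (metis frechet_derivative_at)
  moreover have "(\<lambda>x. f (l x)) differentiable_on UNIV"
    using D by (auto simp: differentiable_on_def differentiable_def)
  ultimately show ?case
    using Suc by auto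
qed

lemma smooth_const [simp]: "smooth (\<lambda>x. c)"
  by (simp add: smooth_def C_k_const)

lemma smooth_add: "smooth f \<Longrightarrow> smooth g \<Longrightarrow> smooth (\<lambda>x. f x + g x)"
  by (simp add: smooth_def C_k_add)

lemma smooth_mult: "smooth f \<Longrightarrow> smooth g \<Longrightarrow> smooth (\<lambda>x. f x * g x)"
  by (simp add: smooth_def C_k_mult)

lemma smooth_compose:
  fixes F :: "real \<Rightarrow> real"
  shows "smooth F \<Longrightarrow> smooth g \<Longrightarrow> smooth (\<lambda>x. F (g x))"
  using C_k_compose[of _ F g] by (simp add: smooth_def)

lemma smooth_bounded_linear: "bounded_linear l \<Longrightarrow> smooth l"
  by (simp add: smooth_def C_k_bounded_linear)

lemma smooth_compose_linear: "smooth f \<Longrightarrow> bounded_linear l \<Longrightarrow> smooth (\<lambda>x. f (l x))"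
  using C_k_compose_linear[of _ f l] by (simp add: smooth_def)

lemma smooth_component: "smooth (\<lambda>x::real^'n. x $ i)"
  by (intro smooth_bounded_linear bounded_linear_vec_nth)

lemma smooth_ident: "smooth (\<lambda>x::real. x)"
  by (rule smooth_bounded_linear) (rule bounded_linear_ident)

lemma smooth_prod:
  "(\<And>i. i \<in> A \<Longrightarrow> smooth (f i)) \<Longrightarrow> smooth (\<lambda>x. \<Prod>i\<in>A. f i x)"
  by (induction A rule: infinite_finite_induct) (auto intro: smooth_mult)

lemmas smooth_intros = smooth_add smooth_mult smooth_component smooth_ident smooth_const

lemma smooth_imp_differentiable: "smooth f \<Longrightarrow> f differentiable (at x)"
  unfolding smooth_def by (metis C_k.simps(2) UNIV_I differentiable_on_def)

lemma smooth_imp_has_derivative: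
  "smooth f \<Longrightarrow> (f has_derivative frechet_derivative f (at x)) (at x)"
  using smooth_imp_differentiable frechet_derivative_works by blast

lemma smooth_imp_continuous_on: "smooth f \<Longrightarrow> continuous_on S f"
  using smooth_def C_k.simps(1) continuous_on_subset by blast

lemma smooth_frechet_derivative: "smooth f \<Longrightarrow> smooth (\<lambda>x. frechet_derivative f (at x) v)"
proof -
  assume "smooth f"
  then have "C_k (Suc k) f" for k by (simp only: smooth_def)
  then show ?thesis by (simp add: smooth_def)
qed

text \<open>
A family of functions whose derivatives are again built from members of the family is smooth; both
the trigonometric functions and the flat functions below are treated this way.
\<close>

lemma smooth_derivative_family:
  fixes f :: "'i \<Rightarrow> real \<Rightarrow> real"
  assumes D: "\<And>i x. (f i has_real_derivative D i x) (at x)"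
    and C: "\<And>k i. (\<And>j. C_k k (f j)) \<Longrightarrow> C_k k (D i)"
  shows "smooth (f i)"
proof -
  have "C_k k (f i)" for k i
  proof (induction k arbitrary: i)
    case 0
    show ?case
      using D by (auto intro: DERIV_continuous_on has_field_derivative_at_within)
  next
    case (Suc k)
    have "frechet_derivative (f i) (at x) = (\<lambda>v. D i x * v)" for x
      using D[of i x] frechet_derivative_at unfolding has_field_derivative_def by metis
    moreover have "f i differentiable_on UNIV"
      using D[of i] by (auto simp: differentiable_on_def has_field_derivative_def differentiable_def)
    ultimately show ?case using Suc by (auto intro!: C_k_mult C_k_const C)
  qed
  then show ?thesis by (simp add: smooth_def)
qed

lemma smooth_cos: "smooth (\<lambda>x::real. cos x)" and smooth_sin: "smooth (\<lambda>x::real. sin x)"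
proof -
  define f :: "nat \<Rightarrow> real \<Rightarrow> real" where "f i = (if i = 0 then cos else if i = 1 then sin
     else if i = 2 then (\<lambda>x. - cos x) else (\<lambda>x. - sin x))" for i
  define g :: "nat \<Rightarrow> nat" where "g i = (if i = 0 then 3 else if i = 1 then 0 else if i = 2 then 1 else 2)" for i
  have "smooth (f i)" for i
  proof (rule smooth_derivative_family[where D = "\<lambda>i. f (g i)"])
    show "(f i has_real_derivative f (g i) x) (at x)" for i x
      by (auto simp: f_def g_def intro!: derivative_eq_intros)
  qed auto
  from this[of 0] this[of 1] show "smooth (\<lambda>x::real. cos x)" "smooth (\<lambda>x::real. sin x)"
    by (simp_all add: f_def)
qed

text \<open>
Division by powers of \<open>x\<close> makes the family closed under differentiation, so that smoothness of the
usual flat function \<open>exp (- 1 / x)\<close> follows from \<open>smooth_derivative_family\<close>.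
\<close>

definition flat_exp :: "nat \<Rightarrow> real \<Rightarrow> real" where
  "flat_exp m x = (if x > 0 then exp (- (1 / x)) / x ^ m else 0)"

lemma flat_exp_at_right_0: "((\<lambda>x. exp (- (1 / x)) / x ^ m) \<longlongrightarrow> 0) (at_right (0::real))"
proof -
  have "((\<lambda>y::real. y ^ m / exp y) \<longlongrightarrow> 0) at_top" by (rule tendsto_power_div_exp_0)
  then have "((\<lambda>x::real. inverse x ^ m / exp (inverse x)) \<longlongrightarrow> 0) (at_right 0)"
    by (rule filterlim_compose) (rule filterlim_inverse_at_top_right)
  then show ?thesis
    by (simp add: exp_minus divide_inverse power_inverse mult.commute)
qed

lemma flat_exp_has_derivative:
  "(flat_exp m has_real_derivative (flat_exp (m + 2) x + (- real m) * flat_exp (m + 1) x)) (at x)"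
proof -
  consider "x > 0" | "x < 0" | "x = 0" by linarith
  then show ?thesis
  proof cases
    case 1
    have "((\<lambda>x. exp (- (1 / x)) / x ^ m) has_real_derivative
       (flat_exp (m + 2) x + (- real m) * flat_exp (m + 1) x)) (at x)"
      using 1 by (auto intro!: derivative_eq_intros simp: flat_exp_def)
         (cases m; simp add: field_simps power2_eq_square)
    then show ?thesis
      by (rule has_field_derivative_transform_within_open[where S = "{0<..}"])
        (use 1 in \<open>auto simp: flat_exp_def\<close>)
  next
    case 2
    have "((\<lambda>x. 0) has_real_derivative (flat_exp (m + 2) x + (- real m) * flat_exp (m + 1) x)) (at x)"
      using 2 by (simp add: flat_exp_def)
    then show ?thesis
      by (rule has_field_derivative_transform_within_open[where S = "{..<0}"])
        (use 2 in \<open>auto simp: flat_exp_def\<close>)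
  next
    case 3
    have "((\<lambda>h. flat_exp m h / h) \<longlongrightarrow> 0) (at_left 0)"
      by (rule tendsto_eventually) (auto simp: eventually_at_filter flat_exp_def)
    moreover have "((\<lambda>h. flat_exp m h / h) \<longlongrightarrow> 0) (at_right 0)"
      by (rule Lim_transform_eventually[OF flat_exp_at_right_0[of "Suc m"]])
        (auto simp: eventually_at_filter flat_exp_def field_simps)
    ultimately have "((\<lambda>h. flat_exp m h / h) \<longlongrightarrow> 0) (at 0)"
      using filterlim_split_at by blast
    then show ?thesis using 3 by (simp add: DERIV_def flat_exp_def)
  qed
qed

lemma smooth_flat_exp: "smooth (flat_exp m)"
proof -
  have C: "C_k k (\<lambda>x. flat_exp (i + 2) x + (- real i) * flat_exp (i + 1) x)"
    if "\<And>j. C_k k (flat_exp j)" for k i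
    by (rule C_k_add[OF that C_k_mult[OF C_k_const that]])
  show ?thesis
    by (rule smooth_derivative_family[where f = flat_exp, OF flat_exp_has_derivative]) (rule C)
qed

lemma test_function_alt: "test_function f \<longleftrightarrow> smooth f \<and> compact (closure {x. f x \<noteq> 0})"
  by (simp add: test_function_def smooth_def)

lemma test_function_mult_left:
  assumes "smooth g" "test_function f"
  shows "test_function (\<lambda>x. g x * f x)"
proof -
  have "closure {x. g x * f x \<noteq> 0} \<subseteq> closure {x. f x \<noteq> 0}"
    by (rule closure_mono) auto
  then have "compact (closure {x. g x * f x \<noteq> 0})"
    using assms(2) compact_Int_closed[of "closure {x. f x \<noteq> 0}" "closure {x. g x * f x \<noteq> 0}"]
    by (simp add: test_function_alt Int_absorb1)
  then show ?thesis using assms by (simp add: test_function_alt smooth_mult)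
qed

lemma exists_cutoff: "\<exists>\<kappa>::real^'n \<Rightarrow> real. test_function \<kappa> \<and> \<kappa> 0 = 1"
proof -
  \<comment> \<open>The factor \<open>exp 2\<close> normalises \<open>b 0 = 1\<close>.\<close>
  define b where "b x = exp 2 * (flat_exp 0 (1 + x) * flat_exp 0 (1 + (-1) * x))" for x
  have b: "smooth b" unfolding b_def
    by (intro smooth_mult smooth_const smooth_compose[OF smooth_flat_exp] smooth_add smooth_ident)
  have b0: "b 0 = 1" by (simp add: b_def flat_exp_def exp_add[symmetric])
  have b1: "\<bar>x\<bar> < 1" if "b x \<noteq> 0" for x
    using that by (auto simp: b_def flat_exp_def split: if_splits)
  define \<kappa> :: "real^'n \<Rightarrow> real" where "\<kappa> x = (\<Prod>i\<in>UNIV. b (x $ i))" for x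
  have "smooth \<kappa>" unfolding \<kappa>_def
    by (intro smooth_prod smooth_compose[OF b] smooth_component)
  moreover have "bounded {x. \<kappa> x \<noteq> 0}"
  proof (rule bounded_subset[OF bounded_cbox])
    show "{x. \<kappa> x \<noteq> 0} \<subseteq> cbox (\<chi> i. -1) (\<chi> i. 1)"
    proof
      fix x assume "x \<in> {x. \<kappa> x \<noteq> 0}"
      then have "\<bar>x $ i\<bar> < 1" for i by (intro b1) (simp add: \<kappa>_def)
      then have "-1 \<le> x $ i \<and> x $ i \<le> 1" for i by (simp add: abs_less_iff) (smt (verit))
      then show "x \<in> cbox (\<chi> i. -1) (\<chi> i. 1)"
        by (simp add: mem_box_cart)
    qed
  qed
  moreover have "\<kappa> 0 = 1" by (simp add: \<kappa>_def b0)
  ultimately show ?thesis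
    unfolding test_function_alt compact_closure by blast
qed

lemma test_function_bounded:
  assumes "test_function f"
  shows "\<exists>K. \<forall>x. \<bar>f x\<bar> \<le> K"
proof -
  have "compact (f ` closure {x. f x \<noteq> 0})"
    using assms by (auto simp: test_function_alt intro!: compact_continuous_image smooth_imp_continuous_on)
  then obtain K where K: "\<And>y. y \<in> f ` closure {x. f x \<noteq> 0} \<Longrightarrow> norm y \<le> K"
    using compact_imp_bounded bounded_iff by metis
  have "\<bar>f x\<bar> \<le> max K 0" for x
  proof (cases "f x = 0")
    case False
    then have "x \<in> closure {x. f x \<noteq> 0}" by (intro subsetD[OF closure_subset]) simp
    then show ?thesis using K[of "f x"] by auto
  qed auto
  then show ?thesis by blast
qed

lemma test_function_frechet_derivative_zero:
  assumes "x \<notin> closure {x. f x \<noteq> 0}"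
  shows "frechet_derivative f (at x) = (\<lambda>v. 0)"
proof -
  have "((\<lambda>x. 0) has_derivative (\<lambda>v. 0)) (at x)" by simp
  then have "(f has_derivative (\<lambda>v. 0)) (at x)"
    by (rule has_derivative_transform_within_open[where s = "- closure {x. f x \<noteq> 0}"])
      (use assms closure_subset[of "{x. f x \<noteq> 0}"] in auto)
  then show ?thesis by (metis frechet_derivative_at)
qed


section \<open>Left-invariant vector fields of the graded group\<close>

lemma fil_mult_eq: "fil_mult x y = x + y + (1/2 * (x $ 1 * y $ 3 - x $ 3 * y $ 1)) *\<^sub>R bas 4"
  by (simp add: fil_mult_def bch_def gr_br_eq axis_def vec_eq_iff)

lemma fil_mult_nth:
  "fil_mult x y $ 1 = x $ 1 + y $ 1" "fil_mult x y $ 2 = x $ 2 + y $ 2"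
  "fil_mult x y $ 3 = x $ 3 + y $ 3"
  "fil_mult x y $ 4 = x $ 4 + y $ 4 + 1/2 * (x $ 1 * y $ 3 - x $ 3 * y $ 1)"
  by (simp_all add: fil_mult_eq axis_def)

lemma ext_Ad_chi: "fst (ext_Ad (0, t) (x, 0)) = x - (t * x $ 1) *\<^sub>R bas 3"
  by (simp add: ext_Ad_def bch_def gr_br_eq axis_def vec_eq_iff forall_4)

text \<open>
The field \<open>left_inv_field v\<close>, with the derivative along a curve replaced by a total derivative.  On
smooth functions the two agree, and this form makes linearity in \<open>v\<close> and the Leibniz rule evident.
\<close>

definition lfield :: "fil \<Rightarrow> (fil \<Rightarrow> real) \<Rightarrow> fil \<Rightarrow> real" where
  "lfield v f x = frechet_derivative f (at x) (v + (1/2 * (x $ 1 * v $ 3 - x $ 3 * v $ 1)) *\<^sub>R bas 4)"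

lemma lfield_eqI:
  "(f has_derivative D) (at x) \<Longrightarrow>
    lfield v f x = D (v + (1/2 * (x $ 1 * v $ 3 - x $ 3 * v $ 1)) *\<^sub>R bas 4)"
  unfolding lfield_def using frechet_derivative_at by metis

lemma left_inv_field_smooth:
  assumes "smooth f"
  shows "left_inv_field v f = lfield v f"
proof
  fix x :: fil
  define w where "w = v + (1/2 * (x $ 1 * v $ 3 - x $ 3 * v $ 1)) *\<^sub>R bas 4"
  have eq: "fil_mult x (h *\<^sub>R v) = x + h *\<^sub>R w" for h
    by (simp add: fil_mult_eq w_def algebra_simps)
  have "((\<lambda>h. f (x + h *\<^sub>R w)) has_derivative
      (\<lambda>h. frechet_derivative f (at (x + 0 *\<^sub>R w)) (h *\<^sub>R w))) (at 0)"
    by (rule has_derivative_compose[of "\<lambda>h. x + h *\<^sub>R w"])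
      (use smooth_imp_has_derivative[OF assms] in \<open>auto intro!: derivative_eq_intros\<close>)
  then have "((\<lambda>h. f (x + h *\<^sub>R w)) has_real_derivative frechet_derivative f (at x) w) (at 0)"
    unfolding has_field_derivative_def
    using linear_frechet_derivative[OF smooth_imp_differentiable[OF assms, of x]]
    by (simp add: linear_cmul mult_commute_abs)
  then show "left_inv_field v f x = lfield v f x"
    by (simp add: left_inv_field_def eq lfield_def w_def DERIV_imp_deriv)
qed

lemma lfield_expand:
  assumes "smooth f"
  shows "lfield v f x = (\<Sum>j\<in>UNIV. v $ j * lfield (bas j) f x)"
proof -
  have *: "v + (1/2 * (x $ 1 * v $ 3 - x $ 3 * v $ 1)) *\<^sub>R bas 4
    = (\<Sum>j\<in>UNIV. v $ j *\<^sub>R (bas j + (1/2 * (x $ 1 * (bas j :: fil) $ 3 - x $ 3 * (bas j :: fil) $ 1)) *\<^sub>R bas 4))"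
    by (simp add: vec_eq_iff forall_4 sum_4 axis_def algebra_simps)
  show ?thesis
    unfolding lfield_def *
    using linear_frechet_derivative[OF smooth_imp_differentiable[OF assms, of x]]
    by (simp add: linear_sum linear_cmul)
qed

lemma smooth_lfield:
  assumes "smooth f"
  shows "smooth (lfield v f)"
proof -
  have "lfield v f x = frechet_derivative f (at x) v
     + (1/2 * (x $ 1 * v $ 3 + (-1) * (x $ 3 * v $ 1))) * frechet_derivative f (at x) (bas 4)" for x
    using linear_frechet_derivative[OF smooth_imp_differentiable[OF assms, of x]]
    by (simp add: lfield_def linear_add linear_cmul)
  then have "lfield v f = (\<lambda>x. frechet_derivative f (at x) v
     + (1/2 * (x $ 1 * v $ 3 + (-1) * (x $ 3 * v $ 1))) * frechet_derivative f (at x) (bas 4))"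
    by blast
  then show ?thesis
    by (simp only:) (intro smooth_intros smooth_frechet_derivative assms)
qed

lemma lfield_add:
  assumes "smooth f" "smooth g"
  shows "lfield v (\<lambda>x. f x + g x) x = lfield v f x + lfield v g x"
  using lfield_eqI[OF has_derivative_add[OF assms[THEN smooth_imp_has_derivative]]]
  by (simp add: lfield_def)

lemma lfield_mult:
  assumes "smooth f" "smooth g"
  shows "lfield v (\<lambda>x. f x * g x) x = f x * lfield v g x + lfield v f x * g x"
  using lfield_eqI[OF has_derivative_mult[OF assms[THEN smooth_imp_has_derivative]]]
  by (simp add: lfield_def)

lemma lfield_const [simp]: "lfield v (\<lambda>x. c) x = 0"
  by (subst lfield_eqI) auto

lemma lfield_cmult:
  assumes "smooth f"
  shows "lfield v (\<lambda>x. c * f x) x = c * lfield v f x"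
  using lfield_mult[OF smooth_const assms] by simp

lemma lfield_compose:
  assumes "(F has_real_derivative D) (at (g x))" "smooth g"
  shows "lfield v (\<lambda>x. F (g x)) x = D * lfield v g x"
  using lfield_eqI[OF has_derivative_compose[OF smooth_imp_has_derivative[OF assms(2)]
        assms(1)[unfolded has_field_derivative_def]]]
  by (simp add: lfield_def)

text \<open>
The fourth coordinate is the only one that the brackets of the graded group produce, so these maps,
which scale it quadratically, are group automorphisms.  Composition with \<open>dil \<rho>\<close> hence multiplies
horizontal derivatives by exactly \<open>\<rho>\<close>: a cutoff dilated in this way has uniformly small
derivatives even though the coefficients of the fields are unbounded.
\<close>

definition dil :: "real \<Rightarrow> fil \<Rightarrow> fil" where
  "dil \<rho> x = (\<chi> i. (if i = 4 then \<rho>\<^sup>2 else \<rho>) * x $ i)"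

lemma bounded_linear_dil: "bounded_linear (dil \<rho>)"
  by (intro linear_conv_bounded_linear[THEN iffD1] linearI)
    (simp_all add: dil_def vec_eq_iff algebra_simps)

lemma lfield_dil:
  assumes "smooth f" "v $ 4 = 0"
  shows "lfield v (\<lambda>x. f (dil \<rho> x)) x = \<rho> * lfield v f (dil \<rho> x)"
proof -
  have D: "((\<lambda>x. f (dil \<rho> x)) has_derivative (\<lambda>w. frechet_derivative f (at (dil \<rho> x)) (dil \<rho> w))) (at x)"
    by (rule has_derivative_compose[OF bounded_linear_imp_has_derivative[OF bounded_linear_dil]])
      (rule smooth_imp_has_derivative[OF assms(1)])
  have *: "dil \<rho> (v + (1/2 * (x $ 1 * v $ 3 - x $ 3 * v $ 1)) *\<^sub>R bas 4)
    = \<rho> *\<^sub>R (v + (1/2 * (dil \<rho> x $ 1 * v $ 3 - dil \<rho> x $ 3 * v $ 1)) *\<^sub>R bas 4)"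
    using assms(2) by (simp add: dil_def vec_eq_iff forall_4 axis_def algebra_simps power2_eq_square)
  show ?thesis
    unfolding lfield_eqI[OF D, of v] unfolding * lfield_def
    using linear_frechet_derivative[OF smooth_imp_differentiable[OF assms(1), of "dil \<rho> x"]]
    by (simp add: linear_cmul)
qed

lemma test_function_lfield:
  assumes "test_function f"
  shows "test_function (lfield v f)"
proof -
  have "{x. lfield v f x \<noteq> 0} \<subseteq> closure {x. f x \<noteq> 0}"
  proof
    fix x assume "x \<in> {x. lfield v f x \<noteq> 0}"
    then show "x \<in> closure {x. f x \<noteq> 0}"
      using test_function_frechet_derivative_zero[of x f] unfolding lfield_def by fastforce
  qed
  then have "closure {x. lfield v f x \<noteq> 0} \<subseteq> closure {x. f x \<noteq> 0}"
    by (simp add: closure_minimal)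
  then have "compact (closure {x. lfield v f x \<noteq> 0})"
    using assms compact_Int_closed[of "closure {x. f x \<noteq> 0}" "closure {x. lfield v f x \<noteq> 0}"]
    by (simp add: test_function_alt Int_absorb1)
  then show ?thesis using assms by (simp add: test_function_alt smooth_lfield)
qed

section \<open>The time-dependent generator\<close>

locale horizontal_frame =
  fixes q :: nat and E :: "nat \<Rightarrow> fil"
  assumes span_E: "span (E ` {1..q}) = weight_space 1"
begin

lemma E_nth: assumes "i \<in> {1..q}" shows "E i $ 3 = 0" "E i $ 4 = 0"
proof -
  let ?S = "{x :: fil. x $ 3 = 0 \<and> x $ 4 = 0}"
  have "E i \<in> span (E ` {1..q})" using assms by (intro span_base imageI)
  then have E: "E i \<in> span {vA, vT}" by (simp only: span_E weight_space_1)
  have "subspace ?S" by (simp add: subspace_def)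
  moreover have "{vA, vT} \<subseteq> ?S" by (simp add: axis_def)
  ultimately have "span {vA, vT} \<subseteq> ?S" by (intro span_minimal)
  then have "E i \<in> ?S" using E by (rule subsetD)
  then show "E i $ 3 = 0" "E i $ 4 = 0" by auto
qed

text \<open>
A vector of the plane orthogonal to all \<open>E i\<close> would be orthogonal to their span, which is the whole
plane; compactness of the unit circle makes this quantitative.
\<close>

lemma nondegenerate:
  "\<exists>\<nu>>0. \<forall>f1 f2. \<nu> * (f1\<^sup>2 + f2\<^sup>2) \<le> (\<Sum>i=1..q. (f1 * E i $ 1 + f2 * E i $ 2)\<^sup>2)"
proof -
  define Q where "Q f = (\<Sum>i=1..q. (fst f * E i $ 1 + snd f * E i $ 2)\<^sup>2)" for f :: "real \<times> real"
  have "continuous_on (sphere 0 1) Q" unfolding Q_def by (intro continuous_intros)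
  moreover have "sphere (0 :: real \<times> real) 1 \<noteq> {}" by simp
  ultimately obtain f0 where f0: "f0 \<in> sphere 0 1" "\<And>f. f \<in> sphere 0 1 \<Longrightarrow> Q f0 \<le> Q f"
    using continuous_attains_inf[of "sphere 0 1" Q] by auto
  have "Q f0 > 0"
  proof (rule ccontr)
    assume "\<not> Q f0 > 0"
    moreover have "Q f0 \<ge> 0" unfolding Q_def by (intro sum_nonneg) simp
    ultimately have "Q f0 = 0" by simp
    then have *: "fst f0 * E i $ 1 + snd f0 * E i $ 2 = 0" if "i \<in> {1..q}" for i
      using that unfolding Q_def by (subst (asm) sum_nonneg_eq_0_iff) auto
    let ?S = "{x :: fil. fst f0 * x $ 1 + snd f0 * x $ 2 = 0}"
    have "subspace ?S"
    proof (intro subspaceI; clarsimp)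
      fix x y :: fil
      assume "fst f0 * x $ 1 + snd f0 * x $ 2 = 0" "fst f0 * y $ 1 + snd f0 * y $ 2 = 0"
      then show "fst f0 * (x $ 1 + y $ 1) + snd f0 * (x $ 2 + y $ 2) = 0"
        by (simp add: algebra_simps)
    next
      fix c and x :: fil
      assume "fst f0 * x $ 1 + snd f0 * x $ 2 = 0"
      then have "c * (fst f0 * x $ 1 + snd f0 * x $ 2) = 0" by simp
      then show "fst f0 * (c * x $ 1) + snd f0 * (c * x $ 2) = 0" by (simp add: algebra_simps)
    qed
    moreover have "E ` {1..q} \<subseteq> ?S" using * by auto
    ultimately have "span (E ` {1..q}) \<subseteq> ?S" by (rule span_minimal[rotated])
    then have "span {vA, vT} \<subseteq> ?S" by (simp only: span_E weight_space_1)
    then have "{vA, vT} \<subseteq> ?S" by (rule order_trans[OF span_superset])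
    then have "f0 = 0" by (simp add: axis_def prod_eq_iff)
    then show False using f0(1) by simp
  qed
  moreover have "Q f0 * (f1\<^sup>2 + f2\<^sup>2) \<le> Q (f1, f2)" for f1 f2
  proof (cases "(f1, f2) = 0")
    case False
    define n where "n = norm (f1, f2)"
    have n: "n > 0" unfolding n_def by (rule zero_less_norm_iff[THEN iffD2, OF False])
    have n2: "n\<^sup>2 = f1\<^sup>2 + f2\<^sup>2" by (simp add: n_def norm_Pair)
    have "(f1 / n, f2 / n) = (1/n) *\<^sub>R (f1, f2)" by simp
    then have "norm (f1 / n, f2 / n) = 1" using n by (simp only: norm_scaleR n_def[symmetric]) simp
    then have "Q f0 \<le> Q (f1 / n, f2 / n)" by (intro f0(2)) (simp only: mem_sphere_0)
    also have "\<dots> = Q (f1, f2) / n\<^sup>2"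
      using n by (simp add: Q_def sum_divide_distrib power_divide flip: add_divide_distrib)
    finally have "Q f0 * n\<^sup>2 \<le> Q (f1, f2)" using n by (simp add: pos_le_divide_eq)
    then show ?thesis by (simp only: n2)
  qed (auto simp: Q_def zero_prod_def)
  ultimately show ?thesis unfolding Q_def by auto
qed

text \<open>
The vector \<open>Ad (r \<chi>) (E i)\<close>.
\<close>

definition V :: "nat \<Rightarrow> real \<Rightarrow> fil" where
  "V i r = E i - (r * E i $ 1) *\<^sub>R bas 3"

lemma V_nth:
  "V i r $ 1 = E i $ 1" "V i r $ 2 = E i $ 2"
  "i \<in> {1..q} \<Longrightarrow> V i r $ 3 = - r * E i $ 1" "i \<in> {1..q} \<Longrightarrow> V i r $ 4 = 0"
  by (simp_all add: V_def axis_def E_nth)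

definition gen :: "real \<Rightarrow> (fil \<Rightarrow> real) \<Rightarrow> fil \<Rightarrow> real" where
  "gen r f x = 1/2 * (\<Sum>i=1..q. lfield (V i r) (lfield (V i r) f) x)"

lemma diff_generator_smooth: "smooth f \<Longrightarrow> diff_generator q E r f x = gen r f x"
  by (simp add: diff_generator_def gen_def left_inv_field_smooth smooth_lfield ext_Ad_chi V_def)

lemma gen_mult:
  assumes "smooth f" "smooth g"
  shows "gen r (\<lambda>x. f x * g x) x = f x * gen r g x + gen r f x * g x
    + (\<Sum>i=1..q. lfield (V i r) f x * lfield (V i r) g x)"
proof -
  have "lfield v (lfield v (\<lambda>x. f x * g x)) x
    = f x * lfield v (lfield v g) x + lfield v (lfield v f) x * g x + 2 * (lfield v f x * lfield v g x)" for v
  proof -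
    have "lfield v (\<lambda>x. f x * g x) = (\<lambda>x. f x * lfield v g x + lfield v f x * g x)"
      using lfield_mult[OF assms] by blast
    then show ?thesis
      by (simp add: lfield_add lfield_mult smooth_mult smooth_lfield assms)
  qed
  then show ?thesis
    unfolding gen_def
    by (simp add: sum.distrib sum_distrib_left sum_distrib_right algebra_simps)
qed

lemma gen_compose:
  assumes "\<And>y. (F has_real_derivative F' y) (at y)" "\<And>y. (F' has_real_derivative F'' y) (at y)"
    and "smooth F'" "smooth G"
  shows "gen r (\<lambda>x. F (G x)) x = F' (G x) * gen r G x
    + F'' (G x) * (1/2 * (\<Sum>i=1..q. (lfield (V i r) G x)\<^sup>2))"
proof -
  have "lfield v (lfield v (\<lambda>x. F (G x))) x
    = F' (G x) * lfield v (lfield v G) x + F'' (G x) * (lfield v G x)\<^sup>2" for v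
  proof -
    have "lfield v (\<lambda>x. F (G x)) = (\<lambda>x. F' (G x) * lfield v G x)"
      using lfield_compose[OF assms(1,4)] by blast
    then show ?thesis
      by (simp add: lfield_mult smooth_compose smooth_lfield assms lfield_compose[OF assms(2)] power2_eq_square)
  qed
  then show ?thesis
    unfolding gen_def
    by (simp add: sum.distrib sum_distrib_left algebra_simps)
qed

text \<open>
Expanding the fields along the axes separates the time variable, which enters only through
continuous coefficients, from the space variable.  Joint continuity and bounds that are uniform in
time follow.
\<close>

lemma gen_expand:
  assumes "smooth f"
  shows "gen r f x = 1/2 * (\<Sum>i=1..q. \<Sum>j\<in>UNIV. \<Sum>k\<in>UNIV.
     V i r $ j * (V i r $ k * lfield (bas j) (lfield (bas k) f) x))"
proof -
  have "lfield v (lfield v f) x = (\<Sum>j\<in>UNIV. \<Sum>k\<in>UNIV.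
     v $ j * (v $ k * lfield (bas j) (lfield (bas k) f) x))" for v
  proof -
    have "lfield v f = (\<lambda>x. \<Sum>k\<in>UNIV. v $ k * lfield (bas k) f x)"
      using lfield_expand[OF assms] by blast
    moreover have "lfield w (\<lambda>x. \<Sum>k\<in>UNIV. v $ k * lfield (bas k) f x) x
      = (\<Sum>k\<in>UNIV. v $ k * lfield w (lfield (bas k) f) x)" for w
      by (simp add: sum_4 lfield_add lfield_cmult smooth_add smooth_mult smooth_lfield assms)
    ultimately show ?thesis
      by (subst lfield_expand[OF smooth_lfield[OF assms]]) (simp add: sum_distrib_left)
  qed
  then show ?thesis by (simp add: gen_def)
qed

lemma continuous_V: "continuous_on S (\<lambda>r. V i r $ j)"
  unfolding V_def by (simp only: vector_minus_component vector_scaleR_component) (intro continuous_intros)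

lemma continuous_gen:
  assumes "smooth f"
  shows "continuous_on UNIV (\<lambda>p. gen (fst p) f (snd p))"
  unfolding gen_expand[OF assms]
  by (intro continuous_intros continuous_on_compose2[OF continuous_V[of UNIV]]
      continuous_on_compose2[OF smooth_imp_continuous_on[OF smooth_lfield[OF smooth_lfield[OF assms]], of UNIV]])
    auto

lemma test_function_bounds:
  assumes "test_function f"
  shows "\<exists>K\<ge>0. \<forall>r\<in>{0..1}. \<forall>x. (\<forall>i\<in>{1..q}. \<bar>lfield (V i r) f x\<bar> \<le> K) \<and> \<bar>gen r f x\<bar> \<le> K"
proof -
  have "\<exists>B. \<forall>j x. \<bar>lfield (bas j) f x\<bar> \<le> B"
  proof -
    obtain B where B: "\<And>j. \<forall>x. \<bar>lfield (bas j) f x\<bar> \<le> B j"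
      using choice[of "\<lambda>j B. \<forall>x. \<bar>lfield (bas j) f x\<bar> \<le> B"]
        test_function_bounded[OF test_function_lfield[OF assms]] by auto
    have "\<bar>lfield (bas j) f x\<bar> \<le> Max (range B)" for j x
      by (rule order_trans[OF spec[OF B]]) simp
    then show ?thesis by blast
  qed
  then obtain B where B: "\<And>j x. \<bar>lfield (bas j) f x\<bar> \<le> B" by blast
  have "\<exists>B. \<forall>j k x. \<bar>lfield (bas j) (lfield (bas k) f) x\<bar> \<le> B"
  proof -
    obtain B where B: "\<And>p. \<forall>x. \<bar>lfield (bas (fst p)) (lfield (bas (snd p)) f) x\<bar> \<le> B p"
      using choice[of "\<lambda>p B. \<forall>x. \<bar>lfield (bas (fst p)) (lfield (bas (snd p)) f) x\<bar> \<le> B"]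
        test_function_bounded[OF test_function_lfield[OF test_function_lfield[OF assms]]] by blast
    have "\<bar>lfield (bas j) (lfield (bas k) f) x\<bar> \<le> Max (range B)" for j k x
      using order_trans[OF spec[OF B[of "(j, k)"]], of "Max (range B)"] by simp
    then show ?thesis by blast
  qed
  then obtain B' where B': "\<And>j k x. \<bar>lfield (bas j) (lfield (bas k) f) x\<bar> \<le> B'" by blast
  have [simp]: "B \<ge> 0" "B' \<ge> 0" using B[of 0 0] B'[of 0 0 0] by linarith+
  define M where "M = (\<Sum>i=1..q. \<Sum>j\<in>UNIV. \<bar>E i $ j\<bar>)"
  have M: "\<bar>V i r $ j\<bar> \<le> M" if "r \<in> {0..1}" "i \<in> {1..q}" for i r j
  proof -
    have 1: "\<bar>V i r $ j\<bar> \<le> (\<Sum>j\<in>UNIV. \<bar>E i $ j\<bar>)"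
    proof -
      have "\<bar>r * E i $ 1\<bar> \<le> \<bar>E i $ 1\<bar>" using that by (simp add: abs_mult mult_left_le_one_le)
      then show ?thesis
        using exhaust_4[of j] that V_nth[of i r] by (auto simp: sum_4 E_nth abs_mult)
    qed
    also have "\<dots> \<le> M" unfolding M_def
      by (rule member_le_sum[of i "{1..q}" "\<lambda>i. \<Sum>j\<in>UNIV. \<bar>E i $ j\<bar>"]) (use that in \<open>auto intro: sum_nonneg\<close>)
    finally show ?thesis .
  qed
  have M0: "M \<ge> 0" unfolding M_def by (intro sum_nonneg) auto
  define K where "K = (\<Sum>j\<in>(UNIV::4 set). M * B) + 1/2 * (\<Sum>i=1..q. \<Sum>j\<in>(UNIV::4 set). \<Sum>k\<in>(UNIV::4 set). M * (M * B'))"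
  have K0: "(\<Sum>j\<in>(UNIV::4 set). M * B) \<ge> 0" "(\<Sum>i=1..q. \<Sum>j\<in>(UNIV::4 set). \<Sum>k\<in>(UNIV::4 set). M * (M * B')) \<ge> 0"
    using M0 by (auto intro!: sum_nonneg)
  have s: "smooth f" using assms by (simp add: test_function_alt)
  show ?thesis
  proof (intro exI[of _ K] conjI ballI allI)
    show "0 \<le> K" unfolding K_def by (intro add_nonneg_nonneg mult_nonneg_nonneg K0) simp
    fix r x i assume ri: "r \<in> {0..1::real}" "i \<in> {1..q}"
    have "\<bar>lfield (V i r) f x\<bar> \<le> (\<Sum>j\<in>(UNIV::4 set). M * B)"
      unfolding lfield_expand[OF s, of "V i r"]
      by (rule order_trans[OF sum_abs], rule sum_mono, unfold abs_mult, rule mult_mono)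
        (use M[OF ri] B M0 in auto)
    then show "\<bar>lfield (V i r) f x\<bar> \<le> K" unfolding K_def using K0 by linarith
  next
    fix r x assume ri: "r \<in> {0..1::real}"
    have "\<bar>\<Sum>i=1..q. \<Sum>j\<in>UNIV. \<Sum>k\<in>UNIV. V i r $ j * (V i r $ k * lfield (bas j) (lfield (bas k) f) x)\<bar>
      \<le> (\<Sum>i=1..q. \<Sum>j\<in>(UNIV::4 set). \<Sum>k\<in>(UNIV::4 set). M * (M * B'))"
      by (rule order_trans[OF sum_abs], rule sum_mono, rule order_trans[OF sum_abs], rule sum_mono,
          rule order_trans[OF sum_abs], rule sum_mono, unfold abs_mult, intro mult_mono)
        (use M ri B' M0 in auto)
    then show "\<bar>gen r f x\<bar> \<le> K"
      unfolding gen_expand[OF s] K_def abs_mult using K0 by linarith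
  qed
qed

end


section \<open>Paths and the martingale property\<close>

definition unit_time :: "real measure" where
  "unit_time = density lborel (\<lambda>r. ennreal (indicator {0..1} r))"

lemma sets_unit_time [measurable_cong, simp]: "sets unit_time = sets borel"
  and space_unit_time [simp]: "space unit_time = UNIV"
  by (simp_all add: unit_time_def)

lemma prob_space_unit_time: "prob_space unit_time"
  by (intro prob_spaceI) (simp add: unit_time_def emeasure_density ennreal_indicator)

lemma integral_unit_time:
  fixes g :: "real \<Rightarrow> real"
  assumes "g \<in> borel_measurable borel" "0 \<le> s" "t \<le> 1"
  shows "(\<integral>r. indicator {s..t} r * g r \<partial>unit_time) = (LBINT r:{s..t}. g r)"
proof -
  have "(\<integral>r. indicator {s..t} r * g r \<partial>unit_time) = (\<integral>r. indicator {0..1} r *\<^sub>R (indicator {s..t} r * g r) \<partial>lborel)"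
    unfolding unit_time_def using assms(1) by (intro integral_density) auto
  also have "\<dots> = (\<integral>r. indicator {s..t} r *\<^sub>R g r \<partial>lborel)"
    using assms by (intro Bochner_Integration.integral_cong) (auto split: split_indicator)
  finally show ?thesis by (simp add: set_lebesgue_integral_def)
qed

lemma integrable_bounded_mult:
  fixes X Y :: "'a \<Rightarrow> real"
  assumes X: "integrable M X" and Y: "Y \<in> borel_measurable M" "\<And>c. \<bar>Y c\<bar> \<le> 1"
  shows "integrable M (\<lambda>c. Y c * X c)"
proof (rule Bochner_Integration.integrable_bound[OF X])
  show "(\<lambda>c. Y c * X c) \<in> borel_measurable M"
    using borel_measurable_integrable[OF X] Y(1) by measurable
  show "AE c in M. norm (Y c * X c) \<le> norm (X c)"
    using Y(2) by (intro AE_I2) (simp add: abs_mult mult_left_le_one_le)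
qed

locale diffusion = horizontal_frame +
  fixes \<sigma> :: "(real \<Rightarrow> fil) measure"
  assumes law: "diffusion_law (diff_generator q E) \<sigma>"
begin

sublocale prob_space \<sigma> using law by (simp add: diffusion_law_def)
sublocale U: prob_space unit_time by (rule prob_space_unit_time)
sublocale P: pair_prob_space \<sigma> unit_time ..

abbreviation path_time :: "((real \<Rightarrow> fil) \<times> real) measure" where
  "path_time \<equiv> \<sigma> \<Otimes>\<^sub>M unit_time"

lemma sets_law: "sets \<sigma> = sets path_space" using law by (simp add: diffusion_law_def)
lemma space_law: "space \<sigma> = space path_space" by (rule sets_eq_imp_space_eq[OF sets_law])

lemma path_continuous: "c \<in> space \<sigma> \<Longrightarrow> continuous_on {0..} c"
  by (simp add: space_law path_space_def space_restrict_space)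

lemma eval_measurable: "0 \<le> t \<Longrightarrow> (\<lambda>c. c t) \<in> borel_measurable \<sigma>"
proof -
  assume "0 \<le> t"
  then have "(\<lambda>c. c t) \<in> path_space \<rightarrow>\<^sub>M borel"
    unfolding path_space_def by (intro measurable_restrict_space1 measurable_component_singleton) auto
  then show ?thesis by (simp add: measurable_cong_sets[OF sets_law refl])
qed

lemma start: "AE c in \<sigma>. c 0 = 0" using law by (simp add: diffusion_law_def)

lemma space_filtration: "space (path_filtration s) = space \<sigma>"
  unfolding path_filtration_def space_law by (rule space_measure_of) auto

lemma eval_filtration_measurable:
  assumes "0 \<le> r" "r \<le> s"
  shows "(\<lambda>c. c r) \<in> borel_measurable (path_filtration s)"
proof (rule measurableI)
  fix B :: "fil set" assume "B \<in> sets borel"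
  then have "(\<lambda>c. c r) -` B \<inter> space path_space \<in> {(\<lambda>c. c r) -` B \<inter> space path_space | r B. r \<in> {0..s} \<and> B \<in> sets borel}"
    using assms by auto
  then show "(\<lambda>c. c r) -` B \<inter> space (path_filtration s) \<in> sets (path_filtration s)"
    unfolding path_filtration_def
    by (subst space_measure_of) (auto simp: sets_measure_of_conv intro!: sigma_sets.Basic)
qed simp

lemma subalgebra_filtration: "subalgebra \<sigma> (path_filtration s)"
proof -
  have "sets (path_filtration s) \<subseteq> sets \<sigma>"
    unfolding path_filtration_def
  proof (subst sets_measure_of)
    show "{(\<lambda>c. c r) -` B \<inter> space path_space | r B. r \<in> {0..s} \<and> B \<in> sets borel} \<subseteq> Pow (space path_space)"
      by auto
    show "sigma_sets (space path_space) {(\<lambda>c. c r) -` B \<inter> space path_space | r B. r \<in> {0..s} \<and> B \<in> sets borel} \<subseteq> sets \<sigma>"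
      unfolding space_law[symmetric]
      by (rule sets.sigma_sets_subset) (use eval_measurable in \<open>auto intro: measurable_sets\<close>)
  qed
  then show ?thesis by (simp add: subalgebra_def space_filtration)
qed

lemma filtration_measurable: "f \<in> borel_measurable (path_filtration s) \<Longrightarrow> f \<in> borel_measurable \<sigma>"
  by (rule measurable_from_subalg[OF subalgebra_filtration])

text \<open>
Evaluation is measurable jointly in path and time because a continuous path is the limit of its
samples on finer and finer grids.  Paths live on \<open>{0..}\<close>, whence the \<open>max 0\<close>.
\<close>

lemma joint_measurable_path: "(\<lambda>p. fst p (max 0 (snd p))) \<in> borel_measurable path_time"
proof (rule borel_measurable_LIMSEQ_metric)
  fix n :: nat
  let ?k = "\<lambda>p::(real \<Rightarrow> fil) \<times> real. \<lceil>real (Suc n) * snd p\<rceil>"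
  show "(\<lambda>p. fst p (max 0 (of_int (?k p) / real (Suc n)))) \<in> borel_measurable path_time"
  proof (rule measurable_compose_countable[of "\<lambda>k p. fst p (max 0 (of_int k / real (Suc n)))"])
    fix k :: int
    have "(\<lambda>c. c (max 0 (of_int k / real (Suc n)))) \<in> borel_measurable \<sigma>" by (rule eval_measurable) simp
    then show "(\<lambda>p. fst p (max 0 (of_int k / real (Suc n)))) \<in> borel_measurable path_time"
      by (rule measurable_compose[OF measurable_fst])
  qed measurable
next
  fix p assume "p \<in> space path_time"
  then have c: "continuous_on {0..} (fst p)" by (auto simp: space_pair_measure intro: path_continuous)
  have "(\<lambda>n. of_int \<lceil>real (Suc n) * snd p\<rceil> / real (Suc n)) \<longlonglongrightarrow> snd p"
  proof (rule tendsto_sandwich[OF _ _ tendsto_const])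
    show "\<forall>\<^sub>F n in sequentially. snd p \<le> of_int \<lceil>real (Suc n) * snd p\<rceil> / real (Suc n)"
      by (intro always_eventually allI) (simp add: pos_le_divide_eq mult.commute)
    show "\<forall>\<^sub>F n in sequentially. of_int \<lceil>real (Suc n) * snd p\<rceil> / real (Suc n) \<le> snd p + 1 / real (Suc n)"
    proof (intro always_eventually allI)
      fix n
      have "of_int \<lceil>real (Suc n) * snd p\<rceil> \<le> real (Suc n) * snd p + 1" by (rule of_int_ceiling_le_add_one)
      then have "of_int \<lceil>real (Suc n) * snd p\<rceil> / real (Suc n) \<le> (real (Suc n) * snd p + 1) / real (Suc n)"
        by (rule divide_right_mono) simp
      then show "of_int \<lceil>real (Suc n) * snd p\<rceil> / real (Suc n) \<le> snd p + 1 / real (Suc n)"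
        by (simp add: add_divide_distrib)
    qed
    have "(\<lambda>n. snd p + 1 / real (Suc n)) \<longlonglongrightarrow> snd p + 0"
      by (intro tendsto_add tendsto_const LIMSEQ_Suc[OF lim_1_over_n])
    then show "(\<lambda>n. snd p + 1 / real (Suc n)) \<longlonglongrightarrow> snd p" by simp
  qed
  then have "(\<lambda>n. max 0 (of_int \<lceil>real (Suc n) * snd p\<rceil> / real (Suc n))) \<longlonglongrightarrow> max 0 (snd p)"
    by (intro tendsto_intros)
  then show "(\<lambda>n. fst p (max 0 (of_int \<lceil>real (Suc n) * snd p\<rceil> / real (Suc n)))) \<longlonglongrightarrow> fst p (max 0 (snd p))"
    by (rule continuous_on_tendsto_compose[OF c]) auto
qed

lemma joint_measurable:
  assumes "continuous_on UNIV (\<lambda>p. g (fst p) (snd p))"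
  shows "(\<lambda>p. g (snd p) (fst p (max 0 (snd p))) :: real) \<in> borel_measurable path_time"
proof -
  have "(\<lambda>p. (snd p, fst p (max 0 (snd p)))) \<in> path_time \<rightarrow>\<^sub>M (borel \<Otimes>\<^sub>M borel)"
    by (intro measurable_Pair joint_measurable_path) measurable
  moreover have "(\<lambda>p. g (fst p) (snd p)) \<in> borel_measurable (borel \<Otimes>\<^sub>M borel)"
    unfolding borel_prod using borel_measurable_continuous_onI[OF assms] by simp
  ultimately show ?thesis
    using measurable_compose[of "\<lambda>p. (snd p, fst p (max 0 (snd p)))" _ "borel \<Otimes>\<^sub>M borel" "\<lambda>p. g (fst p) (snd p)"]
    by simp
qed

text \<open>
The martingale property, tested against a bounded variable \<open>Y\<close> from the past, with the time integral
rewritten over the product of path space and time.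
\<close>

lemma martingale_increment:
  assumes f: "test_function f" and st: "0 \<le> s" "s \<le> t" "t \<le> 1"
    and Y: "Y \<in> borel_measurable (path_filtration s)" "\<And>c. \<bar>Y c\<bar> \<le> 1"
  shows "(\<integral>c. Y c * (f (c t) - f (c s)) \<partial>\<sigma>) =
    (\<integral>p. Y (fst p) * (indicator {s..t} (snd p) * gen (snd p) f (fst p (max 0 (snd p)))) \<partial>path_time)"
proof -
  note Ym[measurable] = filtration_measurable[OF Y(1)]
  have sm: "smooth f" using f by (simp add: test_function_alt)
  let ?I = "\<lambda>t c. LBINT r:{0..t}. gen r f (c r)"
  let ?X = "\<lambda>t c. f (c t) - ?I t c"
  have eqL: "(LBINT r:{0..t}. diff_generator q E r f (c r)) = ?I t c" for t c
    by (simp add: diff_generator_smooth[OF sm])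
  have M: "martingale \<sigma> path_filtration ?X"
    using law f unfolding diffusion_law_def by (auto simp: eqL)
  have MX: "integrable \<sigma> (?X u)" if "0 \<le> u" for u
    using M that unfolding martingale_def by blast
  have X: "integrable \<sigma> (?X t)" "integrable \<sigma> (?X s)"
    using MX[of t] MX[of s] st by simp_all
  have YX: "integrable \<sigma> (\<lambda>c. Y c * ?X t c)" "integrable \<sigma> (\<lambda>c. Y c * ?X s c)"
    using integrable_bounded_mult[OF X(1) Ym Y(2)] integrable_bounded_mult[OF X(2) Ym Y(2)] by simp_all
  interpret S: finite_measure_subalgebra \<sigma> "path_filtration s"
    by unfold_locales (rule subalgebra_filtration)
  have "(\<integral>c. Y c * ?X t c \<partial>\<sigma>) = (\<integral>c. Y c * real_cond_exp \<sigma> (path_filtration s) (?X t) c \<partial>\<sigma>)"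
    by (rule S.real_cond_exp_intg(2)[symmetric, OF YX(1) Y(1)]) (rule borel_measurable_integrable[OF X(1)])
  also have "\<dots> = (\<integral>c. Y c * ?X s c \<partial>\<sigma>)"
  proof (rule integral_cong_AE)
    have "AE c in \<sigma>. real_cond_exp \<sigma> (path_filtration s) (?X t) c = ?X s c"
      using M st unfolding martingale_def by blast
    then show "AE c in \<sigma>. Y c * real_cond_exp \<sigma> (path_filtration s) (?X t) c = Y c * ?X s c"
      by eventually_elim simp
  qed (use borel_measurable_integrable[OF X(2)] in measurable)
  finally have eq: "(\<integral>c. Y c * ?X t c - Y c * ?X s c \<partial>\<sigma>) = 0"
    using YX by (simp add: Bochner_Integration.integral_diff)
  obtain K where K: "K \<ge> 0" and K': "\<And>r x. r \<in> {0..1} \<Longrightarrow> \<bar>gen r f x\<bar> \<le> K"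
    using test_function_bounds[OF f] by blast
  obtain B where B: "\<And>x. \<bar>f x\<bar> \<le> B" using test_function_bounded[OF f] by blast
  have gm: "continuous_on A (\<lambda>r. gen r f (c r))" if "c \<in> space \<sigma>" "A \<subseteq> {0..}" for c A
    by (rule continuous_on_compose2[OF continuous_gen[OF sm], of A "\<lambda>r. (r, c r)", simplified])
      (use path_continuous[OF that(1)] that(2) in \<open>auto intro!: continuous_intros intro: continuous_on_subset\<close>)
  have inner: "?I t c - ?I s c = (\<integral>r. indicator {s..t} r * gen r f (c (max 0 r)) \<partial>unit_time)"
    if c: "c \<in> space \<sigma>" for c
  proof -
    have cm: "continuous_on UNIV (\<lambda>r. gen r f (c (max 0 r)))"
      by (rule continuous_on_compose2[OF continuous_gen[OF sm], of UNIV "\<lambda>r. (r, c (max 0 r))", simplified])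
       (auto intro!: continuous_intros continuous_on_compose2[OF path_continuous[OF c]])
    have si: "set_integrable lborel {a..b} (\<lambda>r. gen r f (c r))" if "0 \<le> a" for a b
      by (rule borel_integrable_atLeastAtMost') (use gm[OF c] that in auto)
    have si': "set_integrable lborel {s<..t} (\<lambda>r. gen r f (c r))"
      by (rule set_integrable_subset[OF si[of s t]]) (use st in auto)
    have "?I t c = (LBINT r:{0..s} \<union> {s<..t}. gen r f (c r))"
      using st by (simp add: ivl_disj_un)
    also have "\<dots> = ?I s c + (LBINT r:{s<..t}. gen r f (c r))"
      by (rule set_integral_Un) (use si[of 0 s] si' in auto)
    also have "(LBINT r:{s<..t}. gen r f (c r)) = (LBINT r:{s..t}. gen r f (c r))"
      unfolding set_lebesgue_integral_def
    proof (rule integral_cong_AE)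
      show "AE r in lborel. indicator {s<..t} r *\<^sub>R gen r f (c r) = indicator {s..t} r *\<^sub>R gen r f (c r)"
        using AE_lborel_singleton[of s] by eventually_elim (auto split: split_indicator)
    qed (use si[of s t] si' st in
          \<open>auto simp: set_integrable_def\<close>)
    also have "(LBINT r:{s..t}. gen r f (c r)) = (LBINT r:{s..t}. gen r f (c (max 0 r)))"
      using st by (intro set_lebesgue_integral_cong) auto
    also have "\<dots> = (\<integral>r. indicator {s..t} r * gen r f (c (max 0 r)) \<partial>unit_time)"
      using st cm by (intro integral_unit_time[symmetric] borel_measurable_continuous_onI) auto
    finally show ?thesis by simp
  qed
  have jm: "(\<lambda>p. gen (snd p) f (fst p (max 0 (snd p)))) \<in> borel_measurable path_time"
    by (rule joint_measurable[OF continuous_gen[OF sm]])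
  have J: "integrable path_time (\<lambda>p. Y (fst p) * (indicator {s..t} (snd p) * gen (snd p) f (fst p (max 0 (snd p)))))"
  proof (rule P.integrable_const_bound[of _ K])
    show "AE p in path_time. norm (Y (fst p) * (indicator {s..t} (snd p) * gen (snd p) f (fst p (max 0 (snd p))))) \<le> K"
    proof (rule AE_I2)
      fix p
      have "\<bar>indicator {s..t} (snd p) * gen (snd p) f (fst p (max 0 (snd p)))\<bar> \<le> K"
        using K' K st by (auto split: split_indicator)
      then show "norm (Y (fst p) * (indicator {s..t} (snd p) * gen (snd p) f (fst p (max 0 (snd p))))) \<le> K"
        using mult_mono[OF Y(2)[of "fst p"]] by (fastforce simp: abs_mult)
    qed
  qed (use jm in measurable)
  have "(\<integral>c. Y c * (f (c t) - f (c s)) \<partial>\<sigma>) = (\<integral>c. Y c * (?I t c - ?I s c) \<partial>\<sigma>)"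
  proof -
    have [measurable]: "f \<in> borel_measurable borel"
      by (intro borel_measurable_continuous_onI smooth_imp_continuous_on sm)
    have [measurable]: "(\<lambda>c. c t) \<in> borel_measurable \<sigma>" "(\<lambda>c. c s) \<in> borel_measurable \<sigma>"
      using st by (auto intro!: eval_measurable)
    have 1: "integrable \<sigma> (\<lambda>c. Y c * (f (c t) - f (c s)))"
    proof (rule integrable_const_bound[of _ "1 * (B + B)"])
      have "\<bar>f (c t) - f (c s)\<bar> \<le> B + B" for c
        using B[of "c t"] B[of "c s"] by linarith
      then show "AE c in \<sigma>. norm (Y c * (f (c t) - f (c s))) \<le> 1 * (B + B)"
        unfolding norm_mult by (intro AE_I2 mult_mono) (use Y(2) in auto)
    qed measurable
    have "(\<integral>c. Y c * (f (c t) - f (c s)) \<partial>\<sigma>) - (\<integral>c. Y c * ?X t c - Y c * ?X s c \<partial>\<sigma>)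
      = (\<integral>c. Y c * (f (c t) - f (c s)) - (Y c * ?X t c - Y c * ?X s c) \<partial>\<sigma>)"
      using 1 YX by (intro Bochner_Integration.integral_diff[symmetric]) auto
    also have "\<dots> = (\<integral>c. Y c * (?I t c - ?I s c) \<partial>\<sigma>)"
      by (rule Bochner_Integration.integral_cong) (auto simp: algebra_simps)
    finally show ?thesis using eq by simp
  qed
  also have "\<dots> = (\<integral>c. (\<integral>r. Y c * (indicator {s..t} r * gen r f (c (max 0 r))) \<partial>unit_time) \<partial>\<sigma>)"
    by (rule Bochner_Integration.integral_cong) (simp_all add: inner)
  also have "\<dots> = (\<integral>p. Y (fst p) * (indicator {s..t} (snd p) * gen (snd p) f (fst p (max 0 (snd p)))) \<partial>path_time)"
    using P.integral_fst'[OF J] by simp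
  finally show ?thesis .
qed

section \<open>The Dynkin formula for bounded smooth functions\<close>

lemma lfield_cutoff:
  assumes "smooth \<kappa>" "i \<in> {1..q}"
  shows "lfield (V i r) (\<lambda>x. \<kappa> (dil \<rho> x)) x = \<rho> * lfield (V i r) \<kappa> (dil \<rho> x)"
  by (rule lfield_dil[OF assms(1) V_nth(4)[OF assms(2)]])

lemma gen_cutoff:
  assumes "smooth \<kappa>"
  shows "gen r (\<lambda>x. \<kappa> (dil \<rho> x)) x = \<rho>\<^sup>2 * gen r \<kappa> (dil \<rho> x)"
proof -
  have "lfield (V i r) (lfield (V i r) (\<lambda>x. \<kappa> (dil \<rho> x))) x
      = \<rho>\<^sup>2 * lfield (V i r) (lfield (V i r) \<kappa>) (dil \<rho> x)" if i: "i \<in> {1..q}" for i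
  proof -
    have "lfield (V i r) (\<lambda>x. \<kappa> (dil \<rho> x)) = (\<lambda>x. \<rho> * lfield (V i r) \<kappa> (dil \<rho> x))"
      using lfield_cutoff[OF assms i] by blast
    then show ?thesis
      using lfield_cutoff[OF smooth_lfield[OF assms] i, of r "V i r" \<rho> x]
      by (simp add: lfield_cmult smooth_compose_linear[OF smooth_lfield[OF assms] bounded_linear_dil] power2_eq_square)
  qed
  then show ?thesis by (simp add: gen_def sum_distrib_left)
qed

lemma test_function_dil:
  assumes "test_function \<kappa>" "\<rho> > 0"
  shows "test_function (\<lambda>x. \<kappa> (dil \<rho> x))"
proof -
  have "dil (1 / \<rho>) (dil \<rho> x) = x" for x
    using assms(2) by (simp add: dil_def vec_eq_iff power2_eq_square)
  then have "{x. \<kappa> (dil \<rho> x) \<noteq> 0} \<subseteq> dil (1 / \<rho>) ` {x. \<kappa> x \<noteq> 0}"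
    by (metis (mono_tags, lifting) image_eqI mem_Collect_eq subsetI)
  moreover have "bounded (dil (1 / \<rho>) ` {x. \<kappa> x \<noteq> 0})"
    using assms(1) by (intro bounded_linear_image bounded_linear_dil) (simp add: test_function_alt compact_closure)
  ultimately have "bounded {x. \<kappa> (dil \<rho> x) \<noteq> 0}" by (rule bounded_subset[rotated])
  then show ?thesis using assms(1)
    by (simp add: test_function_alt compact_closure smooth_compose_linear[OF _ bounded_linear_dil])
qed

text \<open>
Compact support is replaced by a domination hypothesis.  Multiply \<open>\<phi>\<close> by a cutoff dilated by
\<open>\<rho> = 1 / (n + 1)\<close>: the terms in which the cutoff is differentiated carry a factor \<open>\<rho>\<close> and are
otherwise bounded by a multiple of \<open>m + 1\<close>, so dominated convergence removes the cutoff.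
\<close>

lemma dynkin:
  assumes phi: "smooth \<phi>" "\<And>x. \<bar>\<phi> x\<bar> \<le> 1"
    and m: "integrable path_time (\<lambda>p. m (fst p (max 0 (snd p))))"
    and b1: "\<And>i r x. i \<in> {1..q} \<Longrightarrow> r \<in> {0..1} \<Longrightarrow> \<bar>lfield (V i r) \<phi> x\<bar> \<le> m x"
    and b2: "\<And>r x. r \<in> {0..1} \<Longrightarrow> \<bar>gen r \<phi> x\<bar> \<le> m x"
    and st: "0 \<le> s" "s \<le> t" "t \<le> 1"
    and Y: "Y \<in> borel_measurable (path_filtration s)" "\<And>c. \<bar>Y c\<bar> \<le> 1"
  shows "integrable path_time
      (\<lambda>p. Y (fst p) * (indicator {s..t} (snd p) * gen (snd p) \<phi> (fst p (max 0 (snd p)))))"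
    and "(\<integral>c. Y c * (\<phi> (c t) - \<phi> (c s)) \<partial>\<sigma>) =
      (\<integral>p. Y (fst p) * (indicator {s..t} (snd p) * gen (snd p) \<phi> (fst p (max 0 (snd p)))) \<partial>path_time)"
proof -
  note Ym[measurable] = filtration_measurable[OF Y(1)]
  obtain \<kappa> :: "fil \<Rightarrow> real" where k: "test_function \<kappa>" "\<kappa> 0 = 1" using exists_cutoff by blast
  have ks: "smooth \<kappa>" using k(1) by (simp add: test_function_alt)
  obtain K where K: "K \<ge> 0" "\<And>i r x. i \<in> {1..q} \<Longrightarrow> r \<in> {0..1} \<Longrightarrow> \<bar>lfield (V i r) \<kappa> x\<bar> \<le> K"
      "\<And>r x. r \<in> {0..1} \<Longrightarrow> \<bar>gen r \<kappa> x\<bar> \<le> K"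
    using test_function_bounds[OF k(1)] by blast
  obtain B where B: "\<And>x. \<bar>\<kappa> x\<bar> \<le> B" using test_function_bounded[OF k(1)] by blast
  have B0: "B \<ge> 0" using B[of 0] by linarith
  have m0: "m x \<ge> 0" for x using b2[of 0 x] by simp
  define \<rho> where "\<rho> n = 1 / real (Suc n)" for n
  have \<rho>: "\<rho> n > 0" "\<rho> n \<le> 1" for n by (simp_all add: \<rho>_def)
  have \<rho>0: "\<rho> \<longlonglongrightarrow> 0" unfolding \<rho>_def by (rule LIMSEQ_Suc[OF lim_1_over_n])
  define T where "T n x = \<phi> x * \<kappa> (dil (\<rho> n) x)" for n x
  have Tt: "test_function (T n)" for n
    unfolding T_def by (intro test_function_mult_left phi test_function_dil k \<rho>)
  have ksd: "smooth (\<lambda>x. \<kappa> (dil (\<rho> n) x))" for n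
    by (rule smooth_compose_linear[OF ks bounded_linear_dil])
  have dil0: "(\<lambda>n. \<kappa> (dil (\<rho> n) x)) \<longlonglongrightarrow> 1" for x
  proof -
    have "(\<lambda>n. dil (\<rho> n) x) \<longlonglongrightarrow> (\<chi> i. (if i = 4 then 0\<^sup>2 else 0) * x $ i)"
      unfolding dil_def
    proof (intro vec_tendstoI)
      fix i :: 4
      have "(\<lambda>n. (\<rho> n)\<^sup>2 * x $ 4) \<longlonglongrightarrow> 0\<^sup>2 * x $ 4" "(\<lambda>n. \<rho> n * x $ i) \<longlonglongrightarrow> 0 * x $ i"
        by (intro tendsto_intros \<rho>0)+
      then show "(\<lambda>n. (\<chi> i. (if i = 4 then (\<rho> n)\<^sup>2 else \<rho> n) * x $ i) $ i)
          \<longlonglongrightarrow> (\<chi> i. (if i = 4 then 0\<^sup>2 else 0) * x $ i) $ i"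
        by simp
    qed
    also have "(\<chi> i. (if i = 4 then 0\<^sup>2 else 0) * x $ i) = 0" by (simp add: vec_eq_iff)
    finally have "(\<lambda>n. \<kappa> (dil (\<rho> n) x)) \<longlonglongrightarrow> \<kappa> 0"
      by (rule continuous_on_tendsto_compose[OF smooth_imp_continuous_on[OF ks, of UNIV]]) auto
    then show ?thesis using k(2) by simp
  qed
  have genT: "gen r (T n) x = \<phi> x * ((\<rho> n)\<^sup>2 * gen r \<kappa> (dil (\<rho> n) x)) + gen r \<phi> x * \<kappa> (dil (\<rho> n) x)
      + (\<Sum>i=1..q. lfield (V i r) \<phi> x * (\<rho> n * lfield (V i r) \<kappa> (dil (\<rho> n) x)))" for n r x
    unfolding T_def gen_mult[OF phi(1) ksd] gen_cutoff[OF ks]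
    by (simp add: lfield_cutoff[OF ks])
  have bound: "\<bar>gen r (T n) x\<bar> \<le> K + (B + real q * K) * m x" if r: "r \<in> {0..1}" for r n x
  proof -
    have "\<bar>\<phi> x * ((\<rho> n)\<^sup>2 * gen r \<kappa> (dil (\<rho> n) x))\<bar> \<le> 1 * (1 * K)"
      unfolding abs_mult by (intro mult_mono phi K r) (use \<rho>[of n] in \<open>auto simp: abs_square_le_1\<close>)
    moreover have "\<bar>gen r \<phi> x * \<kappa> (dil (\<rho> n) x)\<bar> \<le> m x * B"
      unfolding abs_mult by (intro mult_mono b2 B r) (use m0 in auto)
    moreover have "\<bar>\<Sum>i=1..q. lfield (V i r) \<phi> x * (\<rho> n * lfield (V i r) \<kappa> (dil (\<rho> n) x))\<bar>
        \<le> (\<Sum>i=1..q. m x * (1 * K))"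
      by (rule order_trans[OF sum_abs], rule sum_mono, unfold abs_mult, intro mult_mono b1 K r)
        (use \<rho>[of n] m0 K in auto)
    ultimately show ?thesis unfolding genT
      by (simp add: algebra_simps)
  qed
  have conv: "(\<lambda>n. gen r (T n) x) \<longlonglongrightarrow> gen r \<phi> x" if r: "r \<in> {0..1}" for r x
  proof -
    have z: "(\<lambda>n. \<rho> n * h n) \<longlonglongrightarrow> 0" if "\<And>n. \<bar>h n\<bar> \<le> C" for h :: "nat \<Rightarrow> real" and C
    proof (rule Lim_null_comparison)
      show "\<forall>\<^sub>F n in sequentially. norm (\<rho> n * h n) \<le> \<rho> n * C"
        using that \<rho> by (intro always_eventually allI) (simp add: abs_mult mult_left_mono less_imp_le)
      show "(\<lambda>n. \<rho> n * C) \<longlonglongrightarrow> 0" using tendsto_mult[OF \<rho>0 tendsto_const[of C]] by simp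
    qed
    have z2: "(\<lambda>n. (\<rho> n)\<^sup>2 * gen r \<kappa> (dil (\<rho> n) x)) \<longlonglongrightarrow> 0"
      using tendsto_mult[OF \<rho>0 z[of "\<lambda>n. gen r \<kappa> (dil (\<rho> n) x)" K, OF K(3)[OF r]]]
      by (simp add: power2_eq_square mult.assoc)
    have "(\<lambda>n. gen r (T n) x) \<longlonglongrightarrow> \<phi> x * 0 + gen r \<phi> x * 1 + (\<Sum>i=1..q. lfield (V i r) \<phi> x * 0)"
      unfolding genT by (intro tendsto_add tendsto_mult tendsto_sum tendsto_const z2 dil0 z[of _ K] K(2) r)
    then show ?thesis by simp
  qed
  let ?g = "\<lambda>f p. Y (fst p) * (indicator {s..t} (snd p) * gen (snd p) f (fst p (max 0 (snd p))))"
  have gm: "?g f \<in> borel_measurable path_time" if "smooth f" for f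
  proof -
    note [measurable] = joint_measurable[OF continuous_gen[OF that]]
    show ?thesis by measurable
  qed
  have w: "integrable path_time (\<lambda>p. K + (B + real q * K) * m (fst p (max 0 (snd p))))"
    using m by (intro Bochner_Integration.integrable_add integrable_mult_right) auto
  have "norm (?g (T n) p) \<le> K + (B + real q * K) * m (fst p (max 0 (snd p)))" for n p
  proof (cases "snd p \<in> {s..t}")
    case True
    then have "\<bar>gen (snd p) (T n) (fst p (max 0 (snd p)))\<bar> \<le> K + (B + real q * K) * m (fst p (max 0 (snd p)))"
      using st by (intro bound) auto
    then have "\<bar>Y (fst p)\<bar> * \<bar>gen (snd p) (T n) (fst p (max 0 (snd p)))\<bar> \<le> 1 * (K + (B + real q * K) * m (fst p (max 0 (snd p))))"
      by (intro mult_mono Y) auto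
    then show ?thesis using True by (simp add: abs_mult)
  next
    case False
    then show ?thesis using K B0 m0 by simp
  qed
  then have dom: "AE p in path_time. norm (?g (T n) p) \<le> K + (B + real q * K) * m (fst p (max 0 (snd p)))" for n
    by simp
  have "(\<lambda>n. ?g (T n) p) \<longlonglongrightarrow> ?g \<phi> p" for p
  proof (cases "snd p \<in> {s..t}")
    case True
    then show ?thesis using st by (intro tendsto_mult tendsto_const conv) auto
  qed simp
  then have lim: "AE p in path_time. (\<lambda>n. ?g (T n) p) \<longlonglongrightarrow> ?g \<phi> p" by simp
  have smT: "smooth (T n)" for n using Tt by (simp add: test_function_alt)
  have R: "(\<lambda>n. \<integral>p. ?g (T n) p \<partial>path_time) \<longlonglongrightarrow> (\<integral>p. ?g \<phi> p \<partial>path_time)"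
    by (rule integral_dominated_convergence[OF gm[OF phi(1)] gm[OF smT] w lim dom])
  show "integrable path_time (?g \<phi>)"
    by (rule integrable_dominated_convergence[OF gm[OF phi(1)] gm[OF smT] w lim dom])
  have L: "(\<lambda>n. \<integral>c. Y c * (T n (c t) - T n (c s)) \<partial>\<sigma>) \<longlonglongrightarrow> (\<integral>c. Y c * (\<phi> (c t) - \<phi> (c s)) \<partial>\<sigma>)"
  proof (rule integral_dominated_convergence[where w = "\<lambda>_. 1 * (B + B)"])
    have [measurable]: "\<phi> \<in> borel_measurable borel" "T n \<in> borel_measurable borel" for n
      by (auto intro!: borel_measurable_continuous_onI smooth_imp_continuous_on phi smT)
    have [measurable]: "(\<lambda>c. c t) \<in> borel_measurable \<sigma>" "(\<lambda>c. c s) \<in> borel_measurable \<sigma>"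
      using st by (auto intro!: eval_measurable)
    show "(\<lambda>c. Y c * (\<phi> (c t) - \<phi> (c s))) \<in> borel_measurable \<sigma>" by measurable
    show "(\<lambda>c. Y c * (T n (c t) - T n (c s))) \<in> borel_measurable \<sigma>" for n by measurable
    have "(\<lambda>n. T n x) \<longlonglongrightarrow> \<phi> x" for x
      using tendsto_mult[OF tendsto_const[of "\<phi> x"] dil0[of x]] by (simp add: T_def)
    then show "AE c in \<sigma>. (\<lambda>n. Y c * (T n (c t) - T n (c s))) \<longlonglongrightarrow> Y c * (\<phi> (c t) - \<phi> (c s))"
      by (intro AE_I2 tendsto_intros)
    have TB: "\<bar>T n x\<bar> \<le> 1 * B" for n x
      unfolding T_def abs_mult by (intro mult_mono phi B) auto
    show "AE c in \<sigma>. norm (Y c * (T n (c t) - T n (c s))) \<le> 1 * (B + B)" for n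
    proof (rule AE_I2)
      fix c
      have "\<bar>T n (c t) - T n (c s)\<bar> \<le> B + B" using TB[of n "c t"] TB[of n "c s"] by linarith
      then show "norm (Y c * (T n (c t) - T n (c s))) \<le> 1 * (B + B)"
        unfolding norm_mult by (intro mult_mono) (use Y(2) in auto)
    qed
  qed simp
  show "(\<integral>c. Y c * (\<phi> (c t) - \<phi> (c s)) \<partial>\<sigma>) = (\<integral>p. ?g \<phi> p \<partial>path_time)"
    by (rule LIMSEQ_unique[OF L]) (use R martingale_increment[OF Tt st Y] in simp)
qed

end


section \<open>Trigonometric functions of increments\<close>

text \<open>
As \<open>\<theta>\<close> tends to 0, \<open>2 (1 - cos (\<theta> X)) / \<theta>\<^sup>2\<close> tends to \<open>X\<^sup>2\<close>, so Fatou's lemma turns a bound on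
characteristic functions into a second moment.  This is how unbounded functionals are reached
although only bounded functions may be inserted in the Dynkin formula.
\<close>

lemma (in prob_space) second_moment_from_cos:
  fixes X :: "'a \<Rightarrow> real"
  assumes X[measurable]: "X \<in> borel_measurable M"
    and C: "\<And>\<theta>. 0 < \<theta> \<Longrightarrow> \<theta> \<le> 1 \<Longrightarrow> (\<integral>x. 1 - cos (\<theta> * X x) \<partial>M) \<le> \<theta>\<^sup>2 * C / 2"
  shows "integrable M (\<lambda>x. (X x)\<^sup>2)" "(\<integral>x. (X x)\<^sup>2 \<partial>M) \<le> C"
proof -
  define \<theta> where "\<theta> n = 1 / real (Suc n)" for n
  have \<theta>: "\<theta> n > 0" "\<theta> n \<le> 1" for n by (simp_all add: \<theta>_def)
  have \<theta>0: "\<theta> \<longlonglongrightarrow> 0" unfolding \<theta>_def by (rule LIMSEQ_Suc[OF lim_1_over_n])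
  define f where "f n x = 2 / (\<theta> n)\<^sup>2 * (1 - cos (\<theta> n * X x))" for n x
  have [measurable]: "f n \<in> borel_measurable M" for n unfolding f_def by measurable
  have lim: "(\<lambda>n. f n x) \<longlonglongrightarrow> (X x)\<^sup>2" for x
  proof -
    have "((\<lambda>y. sin (y * (X x / 2))) has_real_derivative X x / 2) (at 0)"
      by (auto intro!: derivative_eq_intros)
    then have "((\<lambda>h. sin (h * (X x / 2)) / h) \<longlongrightarrow> X x / 2) (at 0)"
      by (simp add: DERIV_def)
    moreover have "filterlim \<theta> (at 0) sequentially"
      unfolding filterlim_at using \<theta>(1) \<theta>0 by (auto simp: less_imp_neq[symmetric])
    ultimately have "(\<lambda>n. sin (\<theta> n * (X x / 2)) / \<theta> n) \<longlonglongrightarrow> X x / 2"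
      by (rule filterlim_compose)
    then have "(\<lambda>n. (2 * (sin (\<theta> n * (X x / 2)) / \<theta> n))\<^sup>2) \<longlonglongrightarrow> (2 * (X x / 2))\<^sup>2"
      by (intro tendsto_power tendsto_mult tendsto_const)
    moreover have "(2 * (sin (\<theta> n * (X x / 2)) / \<theta> n))\<^sup>2 = f n x" for n
      using cos_double_sin[of "\<theta> n * (X x / 2)"]
      by (simp add: f_def power_divide power_mult_distrib)
    ultimately show ?thesis by simp
  qed
  have C0: "C \<ge> 0"
  proof -
    have "0 \<le> (\<integral>x. 1 - cos (1 * X x) \<partial>M)" by (rule integral_nonneg_AE) simp
    also have "\<dots> \<le> 1\<^sup>2 * C / 2" by (rule C) auto
    finally show ?thesis by simp
  qed
  have bd: "(\<integral>\<^sup>+x. ennreal (f n x) \<partial>M) \<le> ennreal C" for n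
  proof -
    have "integrable M (\<lambda>x. 1 - cos (\<theta> n * X x))"
    proof (rule integrable_const_bound[of _ 2])
      have "\<bar>1 - cos y\<bar> \<le> 2" for y :: real
        using cos_ge_minus_one[of y] cos_le_one[of y] by linarith
      then show "AE x in M. norm (1 - cos (\<theta> n * X x)) \<le> 2" by simp
    qed measurable
    then have "integrable M (f n)" unfolding f_def by (rule integrable_mult_right)
    then have "(\<integral>\<^sup>+x. ennreal (f n x) \<partial>M) = ennreal (\<integral>x. f n x \<partial>M)"
      by (rule nn_integral_eq_integral) (simp add: f_def)
    also have "(\<integral>x. f n x \<partial>M) = 2 / (\<theta> n)\<^sup>2 * (\<integral>x. 1 - cos (\<theta> n * X x) \<partial>M)"
      unfolding f_def by (rule integral_mult_right_zero)
    also have "\<dots> \<le> 2 / (\<theta> n)\<^sup>2 * ((\<theta> n)\<^sup>2 * C / 2)"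
      by (intro mult_left_mono C \<theta>) simp
    also have "\<dots> = C" using \<theta>(1)[of n] by simp
    finally show ?thesis by (simp add: ennreal_leI)
  qed
  have "(\<integral>\<^sup>+x. ennreal ((X x)\<^sup>2) \<partial>M) = (\<integral>\<^sup>+x. liminf (\<lambda>n. ennreal (f n x)) \<partial>M)"
    by (intro nn_integral_cong lim_imp_Liminf[symmetric] tendsto_ennrealI lim) simp
  also have "\<dots> \<le> liminf (\<lambda>n. \<integral>\<^sup>+x. ennreal (f n x) \<partial>M)"
    by (rule nn_integral_liminf) simp
  also have "\<dots> \<le> ennreal C"
    using Liminf_mono[OF always_eventually[of "\<lambda>n. (\<integral>\<^sup>+x. ennreal (f n x) \<partial>M) \<le> ennreal C"], of sequentially] bd
    by (simp add: Liminf_const)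
  finally have le: "(\<integral>\<^sup>+x. ennreal ((X x)\<^sup>2) \<partial>M) \<le> ennreal C" .
  then show int: "integrable M (\<lambda>x. (X x)\<^sup>2)"
    by (intro integrableI_bounded) (auto simp: le_less_trans[OF _ ennreal_less_top])
  have "ennreal (\<integral>x. (X x)\<^sup>2 \<partial>M) \<le> ennreal C"
    using le nn_integral_eq_integral[OF int] by simp
  then show "(\<integral>x. (X x)\<^sup>2 \<partial>M) \<le> C" using C0 by (simp add: ennreal_le_iff)
qed

lemma exponential_decay:
  fixes f :: "real \<Rightarrow> real"
  assumes "a \<le> b" and m: "f \<in> borel_measurable borel" "\<And>r. \<bar>f r\<bar> \<le> 1"
    and eq: "\<And>t. t \<in> {a..b} \<Longrightarrow> f t = f0 - \<nu> * (LBINT r:{a..t}. f r)"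
  shows "f b = f0 * exp (- \<nu> * (b - a))"
proof -
  have si: "set_integrable lborel {a..t} f" for t
  proof -
    have "set_integrable lborel {a..t} (\<lambda>_. 1::real)" by (rule borel_integrable_atLeastAtMost') simp
    then show ?thesis
      by (rule set_integrable_bound) (use m in \<open>auto simp: set_borel_measurable_def\<close>)
  qed
  have eq': "f t = f0 - \<nu> * integral {a..t} f" if "t \<in> {a..b}" for t
    using eq[OF that] set_borel_integral_eq_integral(2)[OF si[of t]] by simp
  have "f integrable_on {a..b}" by (rule set_borel_integral_eq_integral(1)[OF si])
  then have "continuous_on {a..b} (\<lambda>t. integral {a..t} f)" by (rule indefinite_integral_continuous_1)
  then have "continuous_on {a..b} (\<lambda>t. f0 - \<nu> * integral {a..t} f)" by (intro continuous_intros)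
  then have cf: "continuous_on {a..b} f" using eq' by (subst continuous_on_cong) auto
  have d: "(f has_real_derivative - \<nu> * f t) (at t within {a..b})" if t: "t \<in> {a..b}" for t
  proof -
    have "((\<lambda>t. f0 - \<nu> * integral {a..t} f) has_real_derivative 0 - \<nu> * f t) (at t within {a..b})"
      by (intro DERIV_diff DERIV_const DERIV_cmult integral_has_real_derivative[OF cf t])
    then have "((\<lambda>t. f0 - \<nu> * integral {a..t} f) has_real_derivative - \<nu> * f t) (at t within {a..b})"
      by simp
    then show ?thesis
      by (rule has_field_derivative_transform_within[where d = 1]) (use t eq' in auto)
  qed
  have "\<exists>c. \<forall>t\<in>{a..b}. f t * exp (\<nu> * t) = c"
  proof (rule has_field_derivative_zero_constant)
    show "((\<lambda>t. f t * exp (\<nu> * t)) has_real_derivative 0) (at t within {a..b})" if "t \<in> {a..b}" for t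
      using d[OF that] by (auto intro!: derivative_eq_intros)
  qed simp
  then have "f b * exp (\<nu> * b) = f a * exp (\<nu> * a)" using \<open>a \<le> b\<close> by auto
  moreover have "f a = f0"
    using eq'[of a] \<open>a \<le> b\<close> by simp
  ultimately show ?thesis
    by (simp add: exp_diff algebra_simps exp_minus field_simps)
qed

context diffusion
begin

text \<open>
The carre du champ of the generator, that is, the coefficient of \<open>F'' \<circ> G\<close> in \<open>gen r (F \<circ> G)\<close>.
\<close>

definition carre :: "real \<Rightarrow> (fil \<Rightarrow> real) \<Rightarrow> fil \<Rightarrow> real" where
  "carre r G x = 1/2 * (\<Sum>i=1..q. (lfield (V i r) G x)\<^sup>2)"

text \<open>
This guarantees the domination hypotheses of \<open>dynkin\<close> for \<open>cos \<circ> G\<close> and \<open>sin \<circ> G\<close> at once.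
\<close>

definition dominated :: "(fil \<Rightarrow> real) \<Rightarrow> (fil \<Rightarrow> real) \<Rightarrow> bool" where
  "dominated m G \<longleftrightarrow> smooth G \<and>
     integrable path_time (\<lambda>p. m (fst p (max 0 (snd p)))) \<and>
     (\<forall>i\<in>{1..q}. \<forall>r\<in>{0..1}. \<forall>x. \<bar>lfield (V i r) G x\<bar> \<le> m x) \<and>
     (\<forall>r\<in>{0..1}. \<forall>x. \<bar>gen r G x\<bar> + carre r G x \<le> m x)"

lemma time_average_le:
  fixes g :: "(real \<Rightarrow> fil) \<times> real \<Rightarrow> real"
  assumes st: "0 \<le> s" "s \<le> t" "t \<le> 1"
    and g: "integrable path_time (\<lambda>p. indicator {s..t} (snd p) * g p)"
    and M: "\<And>r. r \<in> {s..t} \<Longrightarrow> (\<integral>c. g (c, r) \<partial>\<sigma>) \<le> M"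
  shows "(\<integral>p. indicator {s..t} (snd p) * g p \<partial>path_time) \<le> (t - s) * M"
proof -
  have g': "integrable path_time (\<lambda>(c, r). indicator {s..t} r * g (c, r))"
    using g by (simp add: case_prod_beta')
  have c: "(\<integral>r. indicator {s..t} r * M \<partial>unit_time) = (t - s) * M"
    using integral_unit_time[of "\<lambda>_. M" s t] st by (simp add: set_lebesgue_integral_def)
  have "(\<integral>p. indicator {s..t} (snd p) * g p \<partial>path_time)
      = (\<integral>r. (\<integral>c. indicator {s..t} r * g (c, r) \<partial>\<sigma>) \<partial>unit_time)"
    using P.integral_snd[OF g'] by (simp add: case_prod_beta')
  also have "\<dots> \<le> (\<integral>r. indicator {s..t} r * M \<partial>unit_time)"
  proof (rule integral_mono)
    show "integrable unit_time (\<lambda>r. \<integral>c. indicator {s..t} r * g (c, r) \<partial>\<sigma>)"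
      using P.integrable_snd[OF g'] by simp
    show "integrable unit_time (\<lambda>r. indicator {s..t} r * M)"
      by (rule U.integrable_const_bound[of _ "\<bar>M\<bar>"]) (auto split: split_indicator)
    show "(\<integral>c. indicator {s..t} r * g (c, r) \<partial>\<sigma>) \<le> indicator {s..t} r * M" for r
      using M[of r] by (auto split: split_indicator)
  qed
  finally show ?thesis unfolding c .
qed

text \<open>
The cosine of a difference is a sum of products of a function of \<open>c t\<close> and a function of \<open>c s\<close>.  The
second factors are bounded and belong to the past, so they can serve as \<open>Y\<close> in \<open>dynkin\<close>; hence the
characteristic function of an increment is accessible without any conditioning.
\<close>

lemma trig_increment:
  assumes dom: "dominated m G"
    and st: "0 \<le> s" "s \<le> t" "t \<le> 1"
  defines "X \<equiv> \<lambda>p. fst p (max 0 (snd p))"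
  defines "D \<equiv> \<lambda>p. G (X p) - G (fst p s)"
  shows "integrable path_time (\<lambda>p. indicator {s..t} (snd p) *
      (sin (D p) * gen (snd p) G (X p) + cos (D p) * carre (snd p) G (X p)))" (is "integrable _ ?F1")
    and "(\<integral>c. 1 - cos (G (c t) - G (c s)) \<partial>\<sigma>) = (\<integral>p. indicator {s..t} (snd p) *
      (sin (D p) * gen (snd p) G (X p) + cos (D p) * carre (snd p) G (X p)) \<partial>path_time)"
    and "(\<integral>c. sin (G (c t) - G (c s)) \<partial>\<sigma>) = (\<integral>p. indicator {s..t} (snd p) *
      (cos (D p) * gen (snd p) G (X p) - sin (D p) * carre (snd p) G (X p)) \<partial>path_time)"
proof -
  have G: "smooth G"
    and m: "integrable path_time (\<lambda>p. m (fst p (max 0 (snd p))))"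
    and b1: "\<And>i r x. i \<in> {1..q} \<Longrightarrow> r \<in> {0..1} \<Longrightarrow> \<bar>lfield (V i r) G x\<bar> \<le> m x"
    and b2: "\<And>r x. r \<in> {0..1} \<Longrightarrow> \<bar>gen r G x\<bar> + carre r G x \<le> m x"
    using dom by (auto simp: dominated_def)
  have g1: "gen r (\<lambda>x. cos (G x)) x = - sin (G x) * gen r G x + - cos (G x) * carre r G x" for r x
    unfolding carre_def
    by (rule gen_compose[where F' = "\<lambda>y. - sin y"])
      (use G smooth_mult[OF smooth_const[of "-1"] smooth_sin] in \<open>auto intro!: derivative_eq_intros\<close>)
  have g2: "gen r (\<lambda>x. sin (G x)) x = cos (G x) * gen r G x + - sin (G x) * carre r G x" for r x
    unfolding carre_def
    by (rule gen_compose[where F' = cos])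
      (use G smooth_cos in \<open>auto intro!: derivative_eq_intros\<close>)
  have l1: "lfield v (\<lambda>x. cos (G x)) x = - sin (G x) * lfield v G x" for v x
    by (rule lfield_compose[OF _ G]) (auto intro!: derivative_eq_intros)
  have l2: "lfield v (\<lambda>x. sin (G x)) x = cos (G x) * lfield v G x" for v x
    by (rule lfield_compose[OF _ G]) (auto intro!: derivative_eq_intros)
  have carre0: "carre r G x \<ge> 0" for r x by (simp add: carre_def sum_nonneg)
  have trig: "\<bar>a * u + b * v\<bar> \<le> \<bar>u\<bar> + v" if "\<bar>a\<bar> \<le> 1" "\<bar>b\<bar> \<le> 1" "v \<ge> 0" for a b u v :: real
  proof -
    have "\<bar>a * u\<bar> \<le> 1 * \<bar>u\<bar>" "\<bar>b * v\<bar> \<le> 1 * v"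
      unfolding abs_mult using that by (intro mult_mono; simp)+
    then show ?thesis by linarith
  qed
  have s1: "smooth (\<lambda>x. cos (G x))" "smooth (\<lambda>x. sin (G x))"
    by (rule smooth_compose[OF smooth_cos G] smooth_compose[OF smooth_sin G])+
  have B1: "\<bar>lfield (V i r) (\<lambda>x. cos (G x)) x\<bar> \<le> m x" "\<bar>lfield (V i r) (\<lambda>x. sin (G x)) x\<bar> \<le> m x"
    if "i \<in> {1..q}" "r \<in> {0..1}" for i r x
  proof -
    have "\<bar>- sin (G x)\<bar> * \<bar>lfield (V i r) G x\<bar> \<le> 1 * m x" "\<bar>cos (G x)\<bar> * \<bar>lfield (V i r) G x\<bar> \<le> 1 * m x"
      by (intro mult_mono b1 that; simp)+
    then show "\<bar>lfield (V i r) (\<lambda>x. cos (G x)) x\<bar> \<le> m x" "\<bar>lfield (V i r) (\<lambda>x. sin (G x)) x\<bar> \<le> m x"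
      by (simp_all add: l1 l2 abs_mult)
  qed
  have B2: "\<bar>gen r (\<lambda>x. cos (G x)) x\<bar> \<le> m x" "\<bar>gen r (\<lambda>x. sin (G x)) x\<bar> \<le> m x" if "r \<in> {0..1}" for r x
    unfolding g1 g2 by (rule order_trans[OF trig b2[OF that]]; simp add: carre0)+
  have [measurable]: "G \<in> borel_measurable borel"
    by (intro borel_measurable_continuous_onI smooth_imp_continuous_on G)
  have Ym: "(\<lambda>c. cos (G (c s))) \<in> borel_measurable (path_filtration s)"
     "(\<lambda>c. sin (G (c s))) \<in> borel_measurable (path_filtration s)"
    using eval_filtration_measurable[OF st(1) order_refl] by measurable
  let ?Yc = "\<lambda>c. cos (G (c s))" and ?Ys = "\<lambda>c. sin (G (c s))"
  note dcc = dynkin[OF s1(1) _ m B1(1) B2(1) st Ym(1)]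
   and dcs = dynkin[OF s1(2) _ m B1(2) B2(2) st Ym(1)]
   and dsc = dynkin[OF s1(1) _ m B1(1) B2(1) st Ym(2)]
   and dss = dynkin[OF s1(2) _ m B1(2) B2(2) st Ym(2)]
  let ?I = "\<lambda>Y f p. Y (fst p) * (indicator {s..t} (snd p) * gen (snd p) f (fst p (max 0 (snd p))))"
  have int: "integrable path_time (?I ?Yc (\<lambda>x. cos (G x)))"
     "integrable path_time (?I ?Yc (\<lambda>x. sin (G x)))"
     "integrable path_time (?I ?Ys (\<lambda>x. cos (G x)))"
     "integrable path_time (?I ?Ys (\<lambda>x. sin (G x)))"
    by (rule dcc(1) dcs(1) dsc(1) dss(1); simp)+
  have e1: "?F1 p = - (?I ?Yc (\<lambda>x. cos (G x)) p + ?I ?Ys (\<lambda>x. sin (G x)) p)" for p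
    unfolding D_def X_def g1 g2 sin_diff cos_diff by (simp add: algebra_simps)
  have e2: "indicator {s..t} (snd p) *
      (cos (D p) * gen (snd p) G (X p) - sin (D p) * carre (snd p) G (X p))
      = ?I ?Yc (\<lambda>x. sin (G x)) p - ?I ?Ys (\<lambda>x. cos (G x)) p" for p
    unfolding D_def X_def g1 g2 sin_diff cos_diff by (simp add: algebra_simps)
  show "integrable path_time ?F1"
    unfolding e1 by (intro Bochner_Integration.integrable_minus Bochner_Integration.integrable_add int)
  have [measurable]: "(\<lambda>c. c t) \<in> borel_measurable \<sigma>" "(\<lambda>c. c s) \<in> borel_measurable \<sigma>"
    using st by (auto intro!: eval_measurable)
  have b2': "\<bar>a * (b - c)\<bar> \<le> 2" if "\<bar>a\<bar> \<le> 1" "\<bar>b\<bar> \<le> 1" "\<bar>c\<bar> \<le> 1" for a b c :: real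
  proof -
    have "\<bar>a * (b - c)\<bar> \<le> 1 * 2" unfolding abs_mult using that by (intro mult_mono) auto
    then show ?thesis by simp
  qed
  have ic: "integrable \<sigma> (\<lambda>c. ?Yc c * (cos (G (c t)) - cos (G (c s))))"
     "integrable \<sigma> (\<lambda>c. ?Yc c * (sin (G (c t)) - sin (G (c s))))"
     "integrable \<sigma> (\<lambda>c. ?Ys c * (cos (G (c t)) - cos (G (c s))))"
     "integrable \<sigma> (\<lambda>c. ?Ys c * (sin (G (c t)) - sin (G (c s))))"
    by (rule integrable_const_bound[of _ 2], intro AE_I2, unfold real_norm_def, rule b2', simp_all)+
  have "(\<integral>c. 1 - cos (G (c t) - G (c s)) \<partial>\<sigma>)
     = (\<integral>c. - (?Yc c * (cos (G (c t)) - cos (G (c s))) + ?Ys c * (sin (G (c t)) - sin (G (c s)))) \<partial>\<sigma>)"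
  proof (rule Bochner_Integration.integral_cong)
    fix c
    have "cos (G (c s)) * cos (G (c s)) + sin (G (c s)) * sin (G (c s)) = 1"
      using sin_cos_squared_add3 by simp
    then show "1 - cos (G (c t) - G (c s)) = - (?Yc c * (cos (G (c t)) - cos (G (c s))) + ?Ys c * (sin (G (c t)) - sin (G (c s))))"
      unfolding cos_diff by (simp add: algebra_simps)
  qed simp
  also have "\<dots> = - ((\<integral>p. ?I ?Yc (\<lambda>x. cos (G x)) p \<partial>path_time) + (\<integral>p. ?I ?Ys (\<lambda>x. sin (G x)) p \<partial>path_time))"
    using ic dcc(2) dss(2) by simp
  also have "\<dots> = (\<integral>p. ?F1 p \<partial>path_time)"
    unfolding e1 using int by simp
  finally show "(\<integral>c. 1 - cos (G (c t) - G (c s)) \<partial>\<sigma>) = (\<integral>p. ?F1 p \<partial>path_time)" .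
  have "(\<integral>c. sin (G (c t) - G (c s)) \<partial>\<sigma>)
     = (\<integral>c. ?Yc c * (sin (G (c t)) - sin (G (c s))) - ?Ys c * (cos (G (c t)) - cos (G (c s))) \<partial>\<sigma>)"
    by (rule Bochner_Integration.integral_cong) (simp_all add: sin_diff algebra_simps)
  also have "\<dots> = (\<integral>p. ?I ?Yc (\<lambda>x. sin (G x)) p \<partial>path_time) - (\<integral>p. ?I ?Ys (\<lambda>x. cos (G x)) p \<partial>path_time)"
    using ic dcs(2) dsc(2) by simp
  also have "\<dots> = (\<integral>p. indicator {s..t} (snd p) *
      (cos (D p) * gen (snd p) G (X p) - sin (D p) * carre (snd p) G (X p)) \<partial>path_time)"
    unfolding e2 using int by simp
  finally show "(\<integral>c. sin (G (c t) - G (c s)) \<partial>\<sigma>) = (\<integral>p. indicator {s..t} (snd p) *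
      (cos (D p) * gen (snd p) G (X p) - sin (D p) * carre (snd p) G (X p)) \<partial>path_time)" .
qed

end


section \<open>Second moments of the frozen functionals\<close>

lemma has_derivative_nth [derivative_intros]: "((\<lambda>x. x $ i) has_derivative (\<lambda>w. w $ i)) (at (x::fil))"
  by (rule bounded_linear_imp_has_derivative[OF bounded_linear_vec_nth])

lemma borel_measurable_nth [measurable (raw)]:
  "f \<in> borel_measurable M \<Longrightarrow> (\<lambda>x. (f x :: fil) $ i) \<in> borel_measurable M"
  by (rule borel_measurable_continuous_on[of "\<lambda>x. x $ i"]) (auto intro: continuous_intros)

text \<open>
With the time frozen at \<open>s\<close>, \<open>lin s 0 1\<close> and \<open>2 * energy s\<close> are the functionals whose values along
the diffusion at time \<open>s\<close> should be the integrals of the first coordinate and of its square.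
\<close>

definition lin :: "real \<Rightarrow> real \<Rightarrow> real \<Rightarrow> fil \<Rightarrow> real" where
  "lin u v w x = u * x $ 1 + v * x $ 2 + w * x $ 3"

definition energy :: "real \<Rightarrow> fil \<Rightarrow> real" where
  "energy s x = x $ 4 + 1/2 * ((s * x $ 1 + x $ 3) * x $ 1)"

lemma smooth_lin: "smooth (lin u v w)"
  unfolding lin_def by (intro smooth_intros)

lemma smooth_energy: "smooth (energy s)"
  unfolding energy_def by (intro smooth_intros)

lemma lin_measurable [measurable]: "lin u v w \<in> borel_measurable borel"
  by (intro borel_measurable_continuous_onI smooth_imp_continuous_on smooth_lin)

lemma energy_measurable [measurable]: "energy s \<in> borel_measurable borel"
  by (intro borel_measurable_continuous_onI smooth_imp_continuous_on smooth_energy)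

lemma lfield_lin: "lfield v (lin u1 u2 u3) x = u1 * v $ 1 + u2 * v $ 2 + u3 * v $ 3"
proof -
  have "((\<lambda>x. u1 * x $ 1 + u2 * x $ 2 + u3 * x $ 3) has_derivative
     (\<lambda>w::fil. u1 * w $ 1 + u2 * w $ 2 + u3 * w $ 3)) (at x)"
    by (auto intro!: derivative_eq_intros)
  then have "(lin u1 u2 u3 has_derivative (\<lambda>w. u1 * w $ 1 + u2 * w $ 2 + u3 * w $ 3)) (at x)"
    by (simp add: lin_def[abs_def])
  from lfield_eqI[OF this, of v] show ?thesis by (simp add: axis_def)
qed

lemma lfield_energy:
  "lfield v (energy s) x = v $ 4 + 1/2 * (x $ 1 * v $ 3 - x $ 3 * v $ 1)
     + 1/2 * ((s * v $ 1 + v $ 3) * x $ 1 + (s * x $ 1 + x $ 3) * v $ 1)"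
proof -
  have "((\<lambda>x. x $ 4 + 1/2 * ((s * x $ 1 + x $ 3) * x $ 1)) has_derivative
     (\<lambda>w::fil. w $ 4 + 1/2 * ((s * w $ 1 + w $ 3) * x $ 1 + (s * x $ 1 + x $ 3) * w $ 1))) (at x)"
    by (auto intro!: derivative_eq_intros simp: algebra_simps)
  then have "(energy s has_derivative
     (\<lambda>w. w $ 4 + 1/2 * ((s * w $ 1 + w $ 3) * x $ 1 + (s * x $ 1 + x $ 3) * w $ 1))) (at x)"
    by (simp add: energy_def[abs_def])
  from lfield_eqI[OF this, of v] show ?thesis by (simp add: axis_def)
qed

context diffusion
begin

definition \<alpha> :: real where "\<alpha> = (\<Sum>i=1..q. (E i $ 1)\<^sup>2)"
definition \<beta> :: real where "\<beta> = (\<Sum>i=1..q. (E i $ 2)\<^sup>2)"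

lemma alpha_nonneg: "\<alpha> \<ge> 0" and beta_nonneg: "\<beta> \<ge> 0"
  by (simp_all add: \<alpha>_def \<beta>_def sum_nonneg)

text \<open>
The constant derivative of \<open>lin u v w\<close> along \<open>V i r\<close>.
\<close>

definition slope :: "real \<Rightarrow> real \<Rightarrow> real \<Rightarrow> real \<Rightarrow> nat \<Rightarrow> real" where
  "slope u v w r i = u * E i $ 1 + v * E i $ 2 - w * r * E i $ 1"

lemma lfield_V_lin: "i \<in> {1..q} \<Longrightarrow> lfield (V i r) (lin u v w) x = slope u v w r i"
  unfolding lfield_lin slope_def V_nth by (simp add: V_nth(3) del: atLeastAtMost_iff)

lemma gen_lin: "gen r (lin u v w) x = 0"
proof -
  have "lfield (V i r) (lin u v w) = (\<lambda>x. u * V i r $ 1 + v * V i r $ 2 + w * V i r $ 3)" for i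
    using lfield_lin by blast
  then show ?thesis by (simp add: gen_def)
qed

lemma carre_lin: "carre r (lin u v w) x = 1/2 * (\<Sum>i=1..q. (slope u v w r i)\<^sup>2)"
  unfolding carre_def using lfield_V_lin by simp

lemma lin_dominated: "\<exists>m. dominated m (lin u v w)"
proof -
  define b where "b i = \<bar>u * E i $ 1\<bar> + \<bar>v * E i $ 2\<bar> + \<bar>w * E i $ 1\<bar>" for i
  have b: "\<bar>slope u v w r i\<bar> \<le> b i" if "r \<in> {0..1}" for r i
  proof -
    have "\<bar>w * r * E i $ 1\<bar> = \<bar>w * E i $ 1\<bar> * r" using that by (simp add: abs_mult)
    also have "\<dots> \<le> \<bar>w * E i $ 1\<bar> * 1" using that by (intro mult_left_mono) auto
    finally show ?thesis unfolding slope_def b_def by linarith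
  qed
  have b0: "b i \<ge> 0" for i by (simp add: b_def)
  let ?m = "(\<Sum>i=1..q. b i) + 1/2 * (\<Sum>i=1..q. (b i)\<^sup>2)"
  have "\<bar>lfield (V i r) (lin u v w) x\<bar> \<le> ?m" if "i \<in> {1..q}" "r \<in> {0..1}" for i r x
  proof -
    have "\<bar>lfield (V i r) (lin u v w) x\<bar> \<le> b i" using b[OF that(2), of i] lfield_V_lin[OF that(1)] by simp
    also have "\<dots> \<le> (\<Sum>i=1..q. b i)" using that b0 by (intro member_le_sum) auto
    finally show ?thesis using sum_nonneg[of "{1..q}" "\<lambda>i. (b i)\<^sup>2"] by simp
  qed
  moreover have "\<bar>gen r (lin u v w) x\<bar> + carre r (lin u v w) x \<le> ?m" if "r \<in> {0..1}" for r x
  proof -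
    have "(\<Sum>i=1..q. (slope u v w r i)\<^sup>2) \<le> (\<Sum>i=1..q. (b i)\<^sup>2)"
      by (intro sum_mono) (metis abs_ge_zero b[OF that] power2_abs power_mono)
    then show ?thesis using sum_nonneg[of "{1..q}" b] b0 by (simp add: gen_lin carre_lin)
  qed
  ultimately have "dominated (\<lambda>_. ?m) (lin u v w)"
    unfolding dominated_def by (intro conjI smooth_lin ballI allI) simp_all
  then show ?thesis by blast
qed

lemma expectation_le_const:
  fixes f :: "(real \<Rightarrow> fil) \<Rightarrow> real"
  assumes "\<And>c. f c \<le> M" "0 \<le> M"
  shows "(\<integral>c. f c \<partial>\<sigma>) \<le> M"
proof (cases "integrable \<sigma> f")
  case True
  then show ?thesis by (intro integral_le_const) (use assms in auto)
next
  case False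
  then show ?thesis using assms by (simp add: not_integrable_integral_eq)
qed

lemma lin_second_moment:
  assumes st: "0 \<le> s" "s \<le> t" "t \<le> 1"
    and C: "\<And>r. r \<in> {s..t} \<Longrightarrow> (\<Sum>i=1..q. (slope u v w r i)\<^sup>2) \<le> C"
  shows "integrable \<sigma> (\<lambda>c. (lin u v w (c t) - lin u v w (c s))\<^sup>2)"
    "(\<integral>c. (lin u v w (c t) - lin u v w (c s))\<^sup>2 \<partial>\<sigma>) \<le> C * (t - s)"
proof -
  have [measurable]: "(\<lambda>c. c t) \<in> borel_measurable \<sigma>" "(\<lambda>c. c s) \<in> borel_measurable \<sigma>"
    using st by (auto intro!: eval_measurable)
  have "0 \<le> (\<Sum>i=1..q. (slope u v w s i)\<^sup>2)" by (intro sum_nonneg) simp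
  then have C0: "C \<ge> 0" using C[of s] st by simp
  have key: "(\<integral>c. 1 - cos (\<theta> * (lin u v w (c t) - lin u v w (c s))) \<partial>\<sigma>) \<le> \<theta>\<^sup>2 * (C * (t - s)) / 2" for \<theta>
  proof -
    let ?G = "lin (\<theta> * u) (\<theta> * v) (\<theta> * w)"
    obtain m where "dominated m ?G" using lin_dominated by blast
    note tr = trig_increment[OF this st]
    have ls: "slope (\<theta> * u) (\<theta> * v) (\<theta> * w) r i = \<theta> * slope u v w r i" for r i
      by (simp add: slope_def algebra_simps)
    have cl: "carre r ?G x = \<theta>\<^sup>2 / 2 * (\<Sum>i=1..q. (slope u v w r i)\<^sup>2)" for r x
      by (simp add: carre_lin ls power_mult_distrib sum_distrib_left)
    have bd: "sin a * gen r ?G x + cos a * carre r ?G x \<le> \<theta>\<^sup>2 / 2 * C" if "r \<in> {s..t}" for a r x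
    proof -
      have c0: "carre r ?G x \<ge> 0" by (simp add: carre_def sum_nonneg)
      have "cos a * carre r ?G x \<le> 1 * carre r ?G x" by (intro mult_right_mono c0) simp
      also have "\<dots> \<le> \<theta>\<^sup>2 / 2 * C" unfolding cl using C[OF that] by (simp add: mult_left_mono)
      finally show ?thesis by (simp add: gen_lin)
    qed
    have "(\<integral>c. 1 - cos (\<theta> * (lin u v w (c t) - lin u v w (c s))) \<partial>\<sigma>)
        = (\<integral>c. 1 - cos (?G (c t) - ?G (c s)) \<partial>\<sigma>)"
      by (simp add: lin_def algebra_simps)
    also have "\<dots> \<le> (t - s) * (\<theta>\<^sup>2 / 2 * C)"
      unfolding tr(2)
    proof (rule time_average_le[OF st tr(1)])
      fix r assume "r \<in> {s..t}"
      then show "(\<integral>c. sin (?G (fst (c, r) (max 0 (snd (c, r)))) - ?G (fst (c, r) s)) * gen (snd (c, r)) ?G (fst (c, r) (max 0 (snd (c, r))))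
         + cos (?G (fst (c, r) (max 0 (snd (c, r)))) - ?G (fst (c, r) s)) * carre (snd (c, r)) ?G (fst (c, r) (max 0 (snd (c, r)))) \<partial>\<sigma>)
        \<le> \<theta>\<^sup>2 / 2 * C"
        unfolding fst_conv snd_conv using C0 by (intro expectation_le_const bd) auto
    qed
    finally show ?thesis by (simp add: algebra_simps)
  qed
  show "integrable \<sigma> (\<lambda>c. (lin u v w (c t) - lin u v w (c s))\<^sup>2)"
    "(\<integral>c. (lin u v w (c t) - lin u v w (c s))\<^sup>2 \<partial>\<sigma>) \<le> C * (t - s)"
    by (rule second_moment_from_cos[OF _ key]; measurable)+
qed

lemma coord1_second_moment:
  assumes "0 \<le> s" "s \<le> t" "t \<le> 1"
  shows "integrable \<sigma> (\<lambda>c. (c t $ 1 - c s $ 1)\<^sup>2)" "(\<integral>c. (c t $ 1 - c s $ 1)\<^sup>2 \<partial>\<sigma>) \<le> \<alpha> * (t - s)"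
  using lin_second_moment[OF assms, of 1 0 0 \<alpha>] by (simp_all add: lin_def slope_def \<alpha>_def)

lemma coord2_second_moment:
  assumes "0 \<le> s" "s \<le> t" "t \<le> 1"
  shows "integrable \<sigma> (\<lambda>c. (c t $ 2 - c s $ 2)\<^sup>2)" "(\<integral>c. (c t $ 2 - c s $ 2)\<^sup>2 \<partial>\<sigma>) \<le> \<beta> * (t - s)"
  using lin_second_moment[OF assms, of 0 1 0 \<beta>] by (simp_all add: lin_def slope_def \<beta>_def)

text \<open>
For \<open>lin s 0 1\<close> the slopes at time \<open>r\<close> are \<open>(s - r)\<close> times the first coordinates of the \<open>E i\<close>.
\<close>

lemma lin_frozen_second_moment:
  assumes st: "0 \<le> s" "s \<le> t" "t \<le> 1"
  shows "integrable \<sigma> (\<lambda>c. (lin s 0 1 (c t) - lin s 0 1 (c s))\<^sup>2)"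
    "(\<integral>c. (lin s 0 1 (c t) - lin s 0 1 (c s))\<^sup>2 \<partial>\<sigma>) \<le> \<alpha> * (t - s) ^ 3"
proof -
  have C: "(\<Sum>i=1..q. (slope s 0 1 r i)\<^sup>2) \<le> \<alpha> * (t - s)\<^sup>2" if r: "r \<in> {s..t}" for r
  proof -
    have "(slope s 0 1 r i)\<^sup>2 = (r - s)\<^sup>2 * (E i $ 1)\<^sup>2" for i
      by (simp add: slope_def power2_eq_square algebra_simps)
    then have "(\<Sum>i=1..q. (slope s 0 1 r i)\<^sup>2) = (r - s)\<^sup>2 * \<alpha>" by (simp add: \<alpha>_def sum_distrib_left)
    also have "\<dots> \<le> (t - s)\<^sup>2 * \<alpha>" using r by (intro mult_right_mono power_mono alpha_nonneg) auto
    finally show ?thesis by (simp add: mult.commute)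
  qed
  show "integrable \<sigma> (\<lambda>c. (lin s 0 1 (c t) - lin s 0 1 (c s))\<^sup>2)"
    "(\<integral>c. (lin s 0 1 (c t) - lin s 0 1 (c s))\<^sup>2 \<partial>\<sigma>) \<le> \<alpha> * (t - s) ^ 3"
    using lin_second_moment[OF st C] by (simp_all add: power2_eq_square power3_eq_cube mult.assoc)
qed

lemma coord1_square_bound:
  assumes "0 \<le> t" "t \<le> 1"
  shows "integrable \<sigma> (\<lambda>c. (c t $ 1)\<^sup>2)" "(\<integral>c. (c t $ 1)\<^sup>2 \<partial>\<sigma>) \<le> \<alpha>"
proof -
  have [measurable]: "(\<lambda>c. c t) \<in> borel_measurable \<sigma>" "(\<lambda>c. c 0) \<in> borel_measurable \<sigma>"
    using assms by (auto intro!: eval_measurable)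
  have ae: "AE c in \<sigma>. (c t $ 1 - c 0 $ 1)\<^sup>2 = (c t $ 1)\<^sup>2"
    using start by eventually_elim simp
  show "integrable \<sigma> (\<lambda>c. (c t $ 1)\<^sup>2)"
    by (rule integrable_cong_AE_imp[OF coord1_second_moment(1)[OF order_refl assms]])
      (use ae in \<open>auto intro: measurable_compose\<close>)
  have "(\<integral>c. (c t $ 1)\<^sup>2 \<partial>\<sigma>) = (\<integral>c. (c t $ 1 - c 0 $ 1)\<^sup>2 \<partial>\<sigma>)"
    by (rule integral_cong_AE[symmetric]) (use ae in auto)
  also have "\<dots> \<le> \<alpha> * t" using coord1_second_moment(2)[OF order_refl assms] by simp
  also have "\<dots> \<le> \<alpha> * 1" using assms by (intro mult_left_mono alpha_nonneg)
  finally show "(\<integral>c. (c t $ 1)\<^sup>2 \<partial>\<sigma>) \<le> \<alpha>" by simp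
qed

lemma integrable_coord1_square:
  "integrable path_time (\<lambda>p. (fst p (max 0 (snd p)) $ 1)\<^sup>2)"
proof -
  have m[measurable]: "(\<lambda>p. fst p (max 0 (snd p)) $ 1) \<in> borel_measurable path_time"
    using joint_measurable_path by measurable
  have "(\<integral>\<^sup>+p. ennreal ((fst p (max 0 (snd p)) $ 1)\<^sup>2) \<partial>path_time)
     = (\<integral>\<^sup>+r. \<integral>\<^sup>+c. ennreal ((c (max 0 r) $ 1)\<^sup>2) \<partial>\<sigma> \<partial>unit_time)"
    using P.nn_integral_snd[of "\<lambda>p. ennreal ((fst p (max 0 (snd p)) $ 1)\<^sup>2)"] by simp
  also have "\<dots> \<le> (\<integral>\<^sup>+r. ennreal \<alpha> \<partial>unit_time)"
  proof (rule nn_integral_mono_AE)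
    have "AE r in unit_time. r \<in> {0..1}"
      unfolding unit_time_def by (subst AE_density) (auto simp: indicator_def)
    then show "AE r in unit_time. (\<integral>\<^sup>+c. ennreal ((c (max 0 r) $ 1)\<^sup>2) \<partial>\<sigma>) \<le> ennreal \<alpha>"
    proof eventually_elim
      case (elim r)
      then have "(\<integral>\<^sup>+c. ennreal ((c r $ 1)\<^sup>2) \<partial>\<sigma>) = ennreal (\<integral>c. (c r $ 1)\<^sup>2 \<partial>\<sigma>)"
        by (intro nn_integral_eq_integral coord1_square_bound) auto
      then show ?case using elim coord1_square_bound(2)[of r] by (simp add: ennreal_leI)
    qed
  qed
  also have "\<dots> < \<infinity>" using U.emeasure_space_1 by (simp add: ennreal_mult_less_top)
  finally show ?thesis by (intro integrableI_bounded) auto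
qed

lemma lfield_V_energy: "i \<in> {1..q} \<Longrightarrow> lfield (V i r) (energy s) x = (E i $ 1 * (s - r)) * x $ 1"
  unfolding lfield_energy V_nth by (simp add: V_nth(3,4) field_simps del: atLeastAtMost_iff)

lemma gen_energy: "gen r (energy s) x = \<alpha> * (s - r) / 2"
proof -
  have "lfield (V i r) (lfield (V i r) (energy s)) x = (s - r) * (E i $ 1)\<^sup>2" if i: "i \<in> {1..q}" for i
  proof -
    have eq: "lfield (V i r) (energy s) = lin (E i $ 1 * (s - r)) 0 0"
      using lfield_V_energy[OF i] by (auto simp: lin_def)
    show ?thesis unfolding eq lfield_lin by (simp add: V_nth power2_eq_square)
  qed
  then show ?thesis by (simp add: gen_def \<alpha>_def sum_distrib_left[symmetric] mult.commute)
qed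

lemma gen_cmult: "smooth f \<Longrightarrow> gen r (\<lambda>x. k * f x) x = k * gen r f x"
proof -
  assume f: "smooth f"
  have "lfield v (\<lambda>x. k * f x) = (\<lambda>x. k * lfield v f x)" for v
    using lfield_cmult[OF f] by blast
  then show ?thesis by (simp add: gen_def lfield_cmult[OF smooth_lfield[OF f]] sum_distrib_left)
qed

text \<open>
The derivatives of \<open>energy s\<close> along \<open>V i r\<close> are of size \<open>(t - s) \<bar>x\<^sub>1\<bar>\<close>, but there is also a drift
\<open>\<alpha> (s - r) / 2\<close>, and bounding its contribution to \<open>E (1 - cos (\<theta> X))\<close> by absolute values only gives
\<open>\<theta> (t - s)\<^sup>2\<close>, which is useless for a second moment.  The drift is however multiplied by \<open>sin (\<theta> X)\<close>, and
\<open>sin\<^sup>2 \<le> 2 (1 - cos)\<close> allows its contribution to be absorbed by the quantity being estimated.  The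
restriction to short intervals is what makes the absorbed part at most one half.
\<close>

lemma energy_second_moment:
  assumes st: "0 \<le> s" "s \<le> t" "t \<le> 1" "t - s \<le> 1/2"
  shows "integrable \<sigma> (\<lambda>c. (energy s (c t) - energy s (c s))\<^sup>2)"
    "(\<integral>c. (energy s (c t) - energy s (c s))\<^sup>2 \<partial>\<sigma>) \<le> 3 * \<alpha>\<^sup>2 * (t - s) ^ 3"
proof -
  have key: "(\<integral>c. 1 - cos (\<theta> * (energy s (c t) - energy s (c s))) \<partial>\<sigma>) \<le> \<theta>\<^sup>2 * (3 * \<alpha>\<^sup>2 * (t - s) ^ 3) / 2"
    if th: "0 < \<theta>" "\<theta> \<le> 1" for \<theta>
  proof -
    define \<delta> where "\<delta> = t - s"
    have \<delta>: "0 \<le> \<delta>" "\<delta> \<le> 1/2" using st by (auto simp: \<delta>_def)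
    let ?G = "\<lambda>x. \<theta> * energy s x"
    have sG: "smooth ?G" by (intro smooth_mult smooth_const smooth_energy)
    have lG: "lfield (V i r) ?G x = \<theta> * ((E i $ 1 * (s - r)) * x $ 1)" if "i \<in> {1..q}" for i r x
      using lfield_V_energy[OF that] by (simp add: lfield_cmult smooth_energy)
    have gG: "gen r ?G x = \<theta> * (\<alpha> * (s - r) / 2)" for r x
      by (simp add: gen_cmult smooth_energy gen_energy)
    have cG: "carre r ?G x = 1/2 * \<theta>\<^sup>2 * (s - r)\<^sup>2 * \<alpha> * (x $ 1)\<^sup>2" for r x
    proof -
      have "(\<Sum>i=1..q. (lfield (V i r) ?G x)\<^sup>2) = (\<Sum>i=1..q. \<theta>\<^sup>2 * (s - r)\<^sup>2 * (x $ 1)\<^sup>2 * (E i $ 1)\<^sup>2)"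
        by (intro sum.cong refl) (simp add: lG power_mult_distrib del: atLeastAtMost_iff)
      then show ?thesis by (simp add: carre_def \<alpha>_def sum_distrib_left[symmetric])
    qed
    define A where "A = (\<Sum>i=1..q. \<bar>E i $ 1\<bar>)"
    have A0: "A \<ge> 0" by (simp add: A_def sum_nonneg)
    define m where "m x = (A + \<alpha>) * (1 + (x $ 1)\<^sup>2)" for x :: fil
    have m: "integrable path_time (\<lambda>p. m (fst p (max 0 (snd p))))"
      unfolding m_def by (intro integrable_mult_right Bochner_Integration.integrable_add integrable_coord1_square) simp
    have sr: "\<bar>s - r\<bar> \<le> 1" "(s - r)\<^sup>2 \<le> 1" if "r \<in> {0..1}" for r
      using that st by (auto simp: abs_square_le_1)
    have b1: "\<bar>lfield (V i r) ?G x\<bar> \<le> m x" if i: "i \<in> {1..q}" and r: "r \<in> {0..1}" for i r x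
    proof -
      have "\<bar>lfield (V i r) ?G x\<bar> = \<theta> * ((\<bar>E i $ 1\<bar> * \<bar>s - r\<bar>) * \<bar>x $ 1\<bar>)"
        unfolding lG[OF i] using th by (simp add: abs_mult)
      also have "\<dots> \<le> 1 * ((A * 1) * (1 + (x $ 1)\<^sup>2))"
      proof (intro mult_mono)
        show "\<bar>E i $ 1\<bar> \<le> A" unfolding A_def using i by (intro member_le_sum) auto
        have "0 \<le> (\<bar>x $ 1\<bar> - 1)\<^sup>2" by simp
        then have "2 * \<bar>x $ 1\<bar> \<le> 1 + (x $ 1)\<^sup>2" by (simp add: power2_eq_square algebra_simps)
        then show "\<bar>x $ 1\<bar> \<le> 1 + (x $ 1)\<^sup>2" by linarith
      qed (use th sr[OF r] A0 in auto)
      also have "\<dots> \<le> m x" unfolding m_def using alpha_nonneg by (auto intro!: mult_right_mono)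
      finally show ?thesis .
    qed
    have b2: "\<bar>gen r ?G x\<bar> + carre r ?G x \<le> m x" if r: "r \<in> {0..1}" for r x
    proof -
      have "\<bar>gen r ?G x\<bar> = \<theta> * (\<alpha> * \<bar>s - r\<bar> / 2)" unfolding gG using th alpha_nonneg by (simp add: abs_mult)
      also have "\<dots> \<le> 1 * (\<alpha> * 1 / 2)"
        by (intro mult_mono divide_right_mono) (use th sr[OF r] alpha_nonneg in auto)
      finally have 1: "\<bar>gen r ?G x\<bar> \<le> \<alpha>" using alpha_nonneg by simp
      have "carre r ?G x \<le> 1 * 1 * 1 * \<alpha> * (x $ 1)\<^sup>2"
        unfolding cG by (intro mult_mono) (use th sr[OF r] alpha_nonneg in \<open>auto simp: abs_square_le_1\<close>)
      then have "\<bar>gen r ?G x\<bar> + carre r ?G x \<le> \<alpha> * (1 + (x $ 1)\<^sup>2)" using 1 by (simp add: algebra_simps)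
      also have "\<dots> \<le> m x" unfolding m_def using A0 by (intro mult_right_mono) auto
      finally show ?thesis .
    qed
    have dom: "dominated m ?G"
      unfolding dominated_def by (intro conjI sG m ballI allI b1 b2)
    define \<psi> where "\<psi> \<tau> = (\<integral>c. 1 - cos (?G (c \<tau>) - ?G (c s)) \<partial>\<sigma>)" for \<tau>
    have cosb: "0 \<le> 1 - cos y" "1 - cos y \<le> 2" for y :: real
      using cos_ge_minus_one[of y] cos_le_one[of y] by linarith+
    have psib: "\<psi> \<tau> \<le> 2" for \<tau> unfolding \<psi>_def by (intro expectation_le_const cosb) simp
    \<comment> \<open>The supremum absorbs the drift: each value is at most half of it plus the desired bound.\<close>
    define M where "M = Sup (\<psi> ` {s..t})"
    have bdd: "bdd_above (\<psi> ` {s..t})" using psib by (auto intro!: bdd_aboveI)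
    have psiM: "\<psi> r \<le> M" if "r \<in> {s..t}" for r unfolding M_def by (intro cSUP_upper that bdd)
    have rec: "\<psi> \<tau> \<le> 1/2 * M + 5/8 * \<theta>\<^sup>2 * \<alpha>\<^sup>2 * \<delta> ^ 3" if \<tau>: "\<tau> \<in> {s..t}" for \<tau>
    proof -
      have s\<tau>: "s \<le> \<tau>" "\<tau> \<le> 1" "\<tau> - s \<le> \<delta>" using \<tau> st by (auto simp: \<delta>_def)
      note tr = trig_increment[OF dom st(1) s\<tau>(1,2)]
      let ?X = "\<lambda>p::(real \<Rightarrow> fil) \<times> real. fst p (max 0 (snd p))"
      let ?D = "\<lambda>p. ?G (?X p) - ?G (fst p s)"
      let ?g = "\<lambda>p. (1 - cos (?D p)) + (\<theta>\<^sup>2 * \<alpha>\<^sup>2 * \<delta>\<^sup>2 / 8 + 1/2 * \<theta>\<^sup>2 * \<alpha> * \<delta>\<^sup>2 * (?X p $ 1)\<^sup>2)"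
      have Dm: "?D \<in> borel_measurable path_time"
      proof -
        have [measurable]: "(\<lambda>p. fst p s) \<in> borel_measurable path_time"
          by (rule measurable_compose[OF measurable_fst eval_measurable[OF st(1)]])
        note [measurable] = joint_measurable_path
        show ?thesis by measurable
      qed
      have i1: "integrable path_time (\<lambda>p. 1 - cos (?D p))"
        by (rule P.integrable_const_bound[of _ 2]) (use Dm cosb in auto)
      have ig: "integrable path_time ?g"
        by (intro Bochner_Integration.integrable_add i1 integrable_mult_right integrable_coord1_square) simp
      have ig': "integrable path_time (\<lambda>p. indicator {s..\<tau>} (snd p) * ?g p)"
        by (rule integrable_bounded_mult[OF ig]) (auto split: split_indicator)
      have "\<psi> \<tau> \<le> (\<integral>p. indicator {s..\<tau>} (snd p) * ?g p \<partial>path_time)"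
        unfolding \<psi>_def tr(2)
      proof (rule integral_mono[OF tr(1) ig'])
        fix p
        show "indicator {s..\<tau>} (snd p) * (sin (?D p) * gen (snd p) ?G (?X p) + cos (?D p) * carre (snd p) ?G (?X p))
          \<le> indicator {s..\<tau>} (snd p) * ?g p"
        proof (cases "snd p \<in> {s..\<tau>}")
          case True
          then have r: "\<bar>s - snd p\<bar> \<le> \<delta>" using s\<tau> by auto
          then have r2: "(s - snd p)\<^sup>2 \<le> \<delta>\<^sup>2" by (metis abs_le_square_iff abs_of_nonneg \<delta>(1))
          have sin2: "(sin (?D p))\<^sup>2 \<le> 2 * (1 - cos (?D p))"
          proof -
            have "(sin (?D p))\<^sup>2 = (1 - cos (?D p)) * (1 + cos (?D p))"
              using sin_cos_squared_add[of "?D p"] by (simp add: power2_eq_square algebra_simps)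
            also have "\<dots> \<le> (1 - cos (?D p)) * 2" by (intro mult_left_mono) auto
            finally show ?thesis by simp
          qed
          let ?u = "gen (snd p) ?G (?X p)"
          have "0 \<le> (sin (?D p) - ?u)\<^sup>2" by simp
          then have 3: "sin (?D p) * ?u \<le> (sin (?D p))\<^sup>2 / 2 + ?u\<^sup>2 / 2"
            by (simp add: power2_eq_square algebra_simps)
          have "?u\<^sup>2 / 2 \<le> \<theta>\<^sup>2 * \<alpha>\<^sup>2 * \<delta>\<^sup>2 / 8"
            unfolding gG using mult_left_mono[OF r2, of "\<theta>\<^sup>2 * \<alpha>\<^sup>2"] by (simp add: power_mult_distrib power_divide)
          note 2 = this
          have 1: "sin (?D p) * ?u \<le> (1 - cos (?D p)) + \<theta>\<^sup>2 * \<alpha>\<^sup>2 * \<delta>\<^sup>2 / 8"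
          proof -
            have aux: "x \<le> d + e" if "b \<le> e" "a \<le> 2 * d" "x \<le> a / 2 + b" for x a b d e :: real
              using that by linarith
            show ?thesis by (rule aux[OF 2 sin2 3])
          qed
          have c0: "carre (snd p) ?G (?X p) \<ge> 0" by (simp add: carre_def sum_nonneg)
          have "cos (?D p) * carre (snd p) ?G (?X p) \<le> 1 * carre (snd p) ?G (?X p)"
            by (intro mult_right_mono c0) simp
          also have "\<dots> \<le> 1 * (1/2 * \<theta>\<^sup>2 * \<delta>\<^sup>2 * \<alpha> * (?X p $ 1)\<^sup>2)"
            unfolding cG by (intro mult_mono order_refl r2) (use alpha_nonneg in auto)
          finally have "cos (?D p) * carre (snd p) ?G (?X p) \<le> 1/2 * \<theta>\<^sup>2 * \<alpha> * \<delta>\<^sup>2 * (?X p $ 1)\<^sup>2"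
            by (simp add: mult_ac)
          then show ?thesis using 1 True by simp
        qed simp
      qed
      also have "\<dots> \<le> (\<tau> - s) * (M + 5/8 * \<theta>\<^sup>2 * \<alpha>\<^sup>2 * \<delta>\<^sup>2)"
      proof (rule time_average_le[OF st(1) s\<tau>(1,2) ig'])
        fix r assume r: "r \<in> {s..\<tau>}"
        then have r': "r \<in> {s..t}" "0 \<le> r" "r \<le> 1" using \<tau> st by auto
        have [measurable]: "(\<lambda>c. c r) \<in> borel_measurable \<sigma>" "(\<lambda>c. c s) \<in> borel_measurable \<sigma>"
          using r' st by (auto intro!: eval_measurable)
        have j1: "integrable \<sigma> (\<lambda>c. 1 - cos (?G (c r) - ?G (c s)))"
          by (rule integrable_const_bound[of _ 2]) (use cosb in auto)
        have "(\<integral>c. ?g (c, r) \<partial>\<sigma>) = \<psi> r + (\<theta>\<^sup>2 * \<alpha>\<^sup>2 * \<delta>\<^sup>2 / 8 + 1/2 * \<theta>\<^sup>2 * \<alpha> * \<delta>\<^sup>2 * (\<integral>c. (c r $ 1)\<^sup>2 \<partial>\<sigma>))"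
          unfolding \<psi>_def using r' j1 coord1_square_bound(1)[OF r'(2,3)] by (simp add: prob_space)
        also have "\<dots> \<le> M + (\<theta>\<^sup>2 * \<alpha>\<^sup>2 * \<delta>\<^sup>2 / 8 + 1/2 * \<theta>\<^sup>2 * \<alpha> * \<delta>\<^sup>2 * \<alpha>)"
          by (intro add_mono mult_left_mono psiM r' coord1_square_bound order_refl) (use alpha_nonneg in auto)
        also have "\<dots> = M + 5/8 * \<theta>\<^sup>2 * \<alpha>\<^sup>2 * \<delta>\<^sup>2" by (simp add: power2_eq_square)
        finally show "(\<integral>c. ?g (c, r) \<partial>\<sigma>) \<le> M + 5/8 * \<theta>\<^sup>2 * \<alpha>\<^sup>2 * \<delta>\<^sup>2" .
      qed
      also have "\<dots> \<le> \<delta> * (M + 5/8 * \<theta>\<^sup>2 * \<alpha>\<^sup>2 * \<delta>\<^sup>2)"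
      proof (intro mult_right_mono s\<tau>)
        have "0 \<le> \<psi> s" by (simp add: \<psi>_def)
        then show "0 \<le> M + 5/8 * \<theta>\<^sup>2 * \<alpha>\<^sup>2 * \<delta>\<^sup>2" using psiM[of s] st by simp
      qed
      also have "\<dots> = \<delta> * M + 5/8 * \<theta>\<^sup>2 * \<alpha>\<^sup>2 * \<delta> ^ 3" by (simp add: power2_eq_square power3_eq_cube algebra_simps)
      also have "\<dots> \<le> 1/2 * M + 5/8 * \<theta>\<^sup>2 * \<alpha>\<^sup>2 * \<delta> ^ 3"
      proof -
        have "0 \<le> \<psi> s" by (simp add: \<psi>_def)
        then have "0 \<le> M" using psiM[of s] st by simp
        then show ?thesis using mult_right_mono[OF \<delta>(2), of M] by simp
      qed
      finally show ?thesis .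
    qed
    have "M \<le> 1/2 * M + 5/8 * \<theta>\<^sup>2 * \<alpha>\<^sup>2 * \<delta> ^ 3"
      unfolding M_def by (rule cSUP_least) (use st rec M_def in auto)
    then have "M \<le> 5/4 * \<theta>\<^sup>2 * \<alpha>\<^sup>2 * \<delta> ^ 3" by simp
    moreover have "\<psi> t \<le> M" by (rule psiM) (use st in simp)
    moreover have "0 \<le> \<theta>\<^sup>2 * \<alpha>\<^sup>2 * \<delta> ^ 3" using \<delta> by simp
    ultimately have "\<psi> t \<le> \<theta>\<^sup>2 * (3 * \<alpha>\<^sup>2 * \<delta> ^ 3) / 2" by simp
    then show ?thesis by (simp add: \<psi>_def \<delta>_def right_diff_distrib)
  qed
  have [measurable]: "(\<lambda>c. c t) \<in> borel_measurable \<sigma>" "(\<lambda>c. c s) \<in> borel_measurable \<sigma>"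
    using st by (auto intro!: eval_measurable)
  show "integrable \<sigma> (\<lambda>c. (energy s (c t) - energy s (c s))\<^sup>2)"
    "(\<integral>c. (energy s (c t) - energy s (c s))\<^sup>2 \<partial>\<sigma>) \<le> 3 * \<alpha>\<^sup>2 * (t - s) ^ 3"
    by (rule second_moment_from_cos[OF _ key]; measurable)+
qed

end


section \<open>The Cauchy--Schwarz constraint\<close>

text \<open>
Young's inequality with weight \<open>\<kappa>\<close>, in place of the Cauchy--Schwarz inequality for integrals.
\<close>

lemma (in prob_space) abs_moment_from_square:
  fixes X :: "'a \<Rightarrow> real"
  assumes X: "X \<in> borel_measurable M" "integrable M (\<lambda>x. (X x)\<^sup>2)"
    and \<kappa>: "0 < \<kappa>" "(\<integral>x. (X x)\<^sup>2 \<partial>M) \<le> C * \<kappa>\<^sup>2"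
  shows "integrable M (\<lambda>x. \<bar>X x\<bar>)" "(\<integral>x. \<bar>X x\<bar> \<partial>M) \<le> (C + 1) / 2 * \<kappa>"
proof -
  have le: "\<bar>X x\<bar> \<le> 1 / (2 * \<kappa>) * (X x)\<^sup>2 + \<kappa> / 2" for x
  proof -
    have "0 \<le> (\<bar>X x\<bar> - \<kappa>)\<^sup>2" by simp
    then have "2 * \<kappa> * \<bar>X x\<bar> \<le> (X x)\<^sup>2 + \<kappa>\<^sup>2" by (simp add: power2_eq_square algebra_simps)
    then have "\<bar>X x\<bar> \<le> ((X x)\<^sup>2 + \<kappa>\<^sup>2) / (2 * \<kappa>)" using \<kappa>(1) by (simp add: pos_le_divide_eq mult.commute)
    also have "\<dots> = 1 / (2 * \<kappa>) * (X x)\<^sup>2 + \<kappa> / 2" using \<kappa>(1) by (simp add: add_divide_distrib power2_eq_square)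
    finally show ?thesis .
  qed
  have i: "integrable M (\<lambda>x. 1 / (2 * \<kappa>) * (X x)\<^sup>2 + \<kappa> / 2)"
    using X(2) by (intro Bochner_Integration.integrable_add integrable_mult_right) auto
  show iX: "integrable M (\<lambda>x. \<bar>X x\<bar>)"
  proof (rule Bochner_Integration.integrable_bound[OF i])
    show "(\<lambda>x. \<bar>X x\<bar>) \<in> borel_measurable M" using X(1) by measurable
    show "AE x in M. norm \<bar>X x\<bar> \<le> norm (1 / (2 * \<kappa>) * (X x)\<^sup>2 + \<kappa> / 2)"
      using le by (intro AE_I2) (metis abs_idempotent abs_of_nonneg abs_ge_zero order_trans real_norm_def)
  qed
  have "(\<integral>x. \<bar>X x\<bar> \<partial>M) \<le> (\<integral>x. 1 / (2 * \<kappa>) * (X x)\<^sup>2 + \<kappa> / 2 \<partial>M)"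
    by (rule integral_mono[OF iX i le])
  also have "\<dots> = 1 / (2 * \<kappa>) * (\<integral>x. (X x)\<^sup>2 \<partial>M) + \<kappa> / 2"
    using X(2) by (simp add: prob_space)
  also have "\<dots> \<le> 1 / (2 * \<kappa>) * (C * \<kappa>\<^sup>2) + \<kappa> / 2"
    using \<kappa> by (intro add_mono mult_left_mono) auto
  also have "\<dots> = (C + 1) / 2 * \<kappa>" using \<kappa>(1) by (simp add: power2_eq_square field_simps)
  finally show "(\<integral>x. \<bar>X x\<bar> \<partial>M) \<le> (C + 1) / 2 * \<kappa>" .
qed

text \<open>
Moving the frozen time from \<open>k \<delta>\<close> to \<open>(k + 1) \<delta>\<close> changes \<open>lin\<close> by \<open>\<delta> x\<^sub>1\<close> and \<open>2 * energy\<close> by \<open>\<delta> x\<^sub>1\<^sup>2\<close>.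
Both telescoping identities hold for arbitrary sequences in the group; they serve random samples of
a path as well as the deterministic sequences built later.
\<close>

lemma lin_telescope:
  assumes "x 0 = 0"
  shows "lin (real n * \<delta>) 0 1 (x n) =
    (\<Sum>k<n. lin (real k * \<delta>) 0 1 (x (Suc k)) - lin (real k * \<delta>) 0 1 (x k)) + \<delta> * (\<Sum>k<n. x (Suc k) $ 1)"
proof (induction n)
  case (Suc n)
  have "lin (real (Suc n) * \<delta>) 0 1 (x (Suc n)) = lin (real n * \<delta>) 0 1 (x (Suc n)) + \<delta> * x (Suc n) $ 1"
    by (simp add: lin_def algebra_simps)
  then show ?case using Suc by (simp add: algebra_simps)
qed (simp add: assms lin_def)

lemma energy_telescope:
  assumes "x 0 = 0"
  shows "2 * energy (real n * \<delta>) (x n) =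
    2 * (\<Sum>k<n. energy (real k * \<delta>) (x (Suc k)) - energy (real k * \<delta>) (x k)) + \<delta> * (\<Sum>k<n. (x (Suc k) $ 1)\<^sup>2)"
proof (induction n)
  case (Suc n)
  have "2 * energy (real (Suc n) * \<delta>) (x (Suc n)) = 2 * energy (real n * \<delta>) (x (Suc n)) + \<delta> * (x (Suc n) $ 1)\<^sup>2"
    by (simp add: energy_def algebra_simps power2_eq_square)
  then show ?case using Suc by (simp add: algebra_simps)
qed (simp add: assms energy_def)

context diffusion
begin

lemma lin_abs_moment:
  assumes st: "0 \<le> s" "s < t" "t \<le> 1"
  shows "integrable \<sigma> (\<lambda>c. \<bar>lin s 0 1 (c t) - lin s 0 1 (c s)\<bar>)"
    "(\<integral>c. \<bar>lin s 0 1 (c t) - lin s 0 1 (c s)\<bar> \<partial>\<sigma>) \<le> (\<alpha> + 1) / 2 * ((t - s) * sqrt (t - s))"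
proof -
  have [measurable]: "(\<lambda>c. c t) \<in> borel_measurable \<sigma>" "(\<lambda>c. c s) \<in> borel_measurable \<sigma>"
    using st by (auto intro!: eval_measurable)
  have "((t - s) * sqrt (t - s))\<^sup>2 = (t - s) ^ 3"
    using st by (simp add: power_mult_distrib power2_eq_square power3_eq_cube)
  then have "(\<integral>c. (lin s 0 1 (c t) - lin s 0 1 (c s))\<^sup>2 \<partial>\<sigma>) \<le> \<alpha> * ((t - s) * sqrt (t - s))\<^sup>2"
    using lin_frozen_second_moment(2)[of s t] st by simp
  then show "integrable \<sigma> (\<lambda>c. \<bar>lin s 0 1 (c t) - lin s 0 1 (c s)\<bar>)"
    "(\<integral>c. \<bar>lin s 0 1 (c t) - lin s 0 1 (c s)\<bar> \<partial>\<sigma>) \<le> (\<alpha> + 1) / 2 * ((t - s) * sqrt (t - s))"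
    using st lin_frozen_second_moment(1)[of s t]
    by (intro abs_moment_from_square[where C = \<alpha>]; simp)+
qed

lemma energy_abs_moment:
  assumes st: "0 \<le> s" "s < t" "t \<le> 1" "t - s \<le> 1/2"
  shows "integrable \<sigma> (\<lambda>c. \<bar>energy s (c t) - energy s (c s)\<bar>)"
    "(\<integral>c. \<bar>energy s (c t) - energy s (c s)\<bar> \<partial>\<sigma>) \<le> (3 * \<alpha>\<^sup>2 + 1) / 2 * ((t - s) * sqrt (t - s))"
proof -
  have [measurable]: "(\<lambda>c. c t) \<in> borel_measurable \<sigma>" "(\<lambda>c. c s) \<in> borel_measurable \<sigma>"
    using st by (auto intro!: eval_measurable)
  have "((t - s) * sqrt (t - s))\<^sup>2 = (t - s) ^ 3"
    using st by (simp add: power_mult_distrib power2_eq_square power3_eq_cube)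
  then have "(\<integral>c. (energy s (c t) - energy s (c s))\<^sup>2 \<partial>\<sigma>) \<le> (3 * \<alpha>\<^sup>2) * ((t - s) * sqrt (t - s))\<^sup>2"
    using energy_second_moment(2)[of s t] st by simp
  then show "integrable \<sigma> (\<lambda>c. \<bar>energy s (c t) - energy s (c s)\<bar>)"
    "(\<integral>c. \<bar>energy s (c t) - energy s (c s)\<bar> \<partial>\<sigma>) \<le> (3 * \<alpha>\<^sup>2 + 1) / 2 * ((t - s) * sqrt (t - s))"
    using st energy_second_moment(1)[of s t]
    by (intro abs_moment_from_square[where C = "3 * \<alpha>\<^sup>2"]; simp)+
qed

text \<open>
Up to errors \<open>R\<close> and \<open>Z\<close>, the two functionals are a Riemann sum of a function and one of its square, so
\<open>lin\<^sup>2 - 2 energy \<le> 2 \<bar>lin\<bar> \<bar>R\<bar> + 2 \<bar>Z\<bar>\<close>.  Restricting to \<open>\<bar>lin\<bar> \<le> K\<close> makes the expectation of the right-hand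
side of order \<open>n\<^sup>-\<^sup>1\<^sup>/\<^sup>2\<close> for each \<open>K\<close>.
\<close>

lemma AE_lin_square_le_energy: "AE c in \<sigma>. (lin 1 0 1 (c 1))\<^sup>2 \<le> 2 * energy 1 (c 1)"
proof -
  have [measurable]: "(\<lambda>c. c 1) \<in> borel_measurable \<sigma>" by (rule eval_measurable) simp
  let ?u = "\<lambda>c::real \<Rightarrow> fil. lin 1 0 1 (c 1)"
  let ?h = "\<lambda>c::real \<Rightarrow> fil. 2 * energy 1 (c 1)"
  have K: "AE c in \<sigma>. \<bar>?u c\<bar> \<le> real K \<longrightarrow> (?u c)\<^sup>2 \<le> ?h c" for K :: nat
  proof -
    define W where "W c = (if \<bar>?u c\<bar> \<le> real K then max 0 ((?u c)\<^sup>2 - ?h c) else 0)" for c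
    have Wm[measurable]: "W \<in> borel_measurable \<sigma>" unfolding W_def by measurable
    have W0: "W c \<ge> 0" for c by (simp add: W_def)
    define C where "C = 2 * real K * ((\<alpha> + 1) / 2) + 2 * ((3 * \<alpha>\<^sup>2 + 1) / 2)"
    have bd: "integrable \<sigma> W \<and> (\<integral>c. W c \<partial>\<sigma>) \<le> C * sqrt (1 / real n)" if n: "n \<ge> 2" for n :: nat
    proof -
      define \<delta> where "\<delta> = 1 / real n"
      have \<delta>: "0 < \<delta>" "\<delta> \<le> 1/2" "real n * \<delta> = 1" using n by (auto simp: \<delta>_def field_simps)
      define r where "r k c = \<bar>lin (real k * \<delta>) 0 1 (c (real (Suc k) * \<delta>)) - lin (real k * \<delta>) 0 1 (c (real k * \<delta>))\<bar>"
        for k and c :: "real \<Rightarrow> fil"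
      define z where "z k c = \<bar>energy (real k * \<delta>) (c (real (Suc k) * \<delta>)) - energy (real k * \<delta>) (c (real k * \<delta>))\<bar>"
        for k and c :: "real \<Rightarrow> fil"
      have kk: "0 \<le> real k * \<delta>" "real k * \<delta> < real (Suc k) * \<delta>" "real (Suc k) * \<delta> \<le> 1"
        "real (Suc k) * \<delta> - real k * \<delta> = \<delta>" if "k < n" for k
      proof -
        have "real (Suc k) * \<delta> \<le> real n * \<delta>" using that \<delta> by (intro mult_right_mono) auto
        then show "real (Suc k) * \<delta> \<le> 1" using \<delta> by simp
      qed (use \<delta> in \<open>auto simp: algebra_simps\<close>)
      have r: "integrable \<sigma> (r k)" "(\<integral>c. r k c \<partial>\<sigma>) \<le> (\<alpha> + 1) / 2 * (\<delta> * sqrt \<delta>)" if "k < n" for k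
        using lin_abs_moment[OF kk(1-3)[OF that]] unfolding r_def kk(4)[OF that] by auto
      have z: "integrable \<sigma> (z k)" "(\<integral>c. z k c \<partial>\<sigma>) \<le> (3 * \<alpha>\<^sup>2 + 1) / 2 * (\<delta> * sqrt \<delta>)" if "k < n" for k
        using energy_abs_moment[OF kk(1-3)[OF that]] \<delta> unfolding z_def kk(4)[OF that] by auto
      let ?S = "\<lambda>c. 2 * real K * (\<Sum>k<n. r k c) + 2 * (\<Sum>k<n. z k c)"
      have iS: "integrable \<sigma> ?S"
        using r z by (intro Bochner_Integration.integrable_add integrable_mult_right Bochner_Integration.integrable_sum) auto
      have le: "AE c in \<sigma>. W c \<le> ?S c"
        using start
      proof eventually_elim
        case (elim c)
        define x where "x k = c (real k * \<delta>)" for k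
        have x0: "x 0 = 0" using elim by (simp add: x_def)
        define R where "R = (\<Sum>k<n. lin (real k * \<delta>) 0 1 (x (Suc k)) - lin (real k * \<delta>) 0 1 (x k))"
        define Z where "Z = (\<Sum>k<n. energy (real k * \<delta>) (x (Suc k)) - energy (real k * \<delta>) (x k))"
        define B where "B = \<delta> * (\<Sum>k<n. x (Suc k) $ 1)"
        have xn: "x n = c 1" by (simp add: x_def \<delta>)
        have u: "?u c = R + B" using lin_telescope[of x, OF x0, of n \<delta>] by (simp only: xn \<delta> R_def B_def)
        have h: "?h c = 2 * Z + \<delta> * (\<Sum>k<n. (x (Suc k) $ 1)\<^sup>2)"
          using energy_telescope[of x, OF x0, of n \<delta>] by (simp only: xn \<delta> Z_def)
        have RR: "\<bar>R\<bar> \<le> (\<Sum>k<n. r k c)" unfolding R_def r_def x_def by (rule sum_abs)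
        have ZZ: "\<bar>Z\<bar> \<le> (\<Sum>k<n. z k c)" unfolding Z_def z_def x_def by (rule sum_abs)
        have "B\<^sup>2 \<le> \<delta>\<^sup>2 * (real n * (\<Sum>k<n. (x (Suc k) $ 1)\<^sup>2))"
          unfolding B_def power_mult_distrib
          using sum_squared_le_sum_of_squares[of "\<lambda>k. x (Suc k) $ 1" "{..<n}"]
          by (intro mult_left_mono) (auto simp: mult.commute)
        also have "\<dots> = (real n * \<delta>) * (\<delta> * (\<Sum>k<n. (x (Suc k) $ 1)\<^sup>2))"
          by (simp only: power2_eq_square mult_ac)
        also have "\<dots> = \<delta> * (\<Sum>k<n. (x (Suc k) $ 1)\<^sup>2)" by (simp only: \<delta>(3) mult_1)
        finally have B2: "B\<^sup>2 \<le> ?h c - 2 * Z" using h by simp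
        show "W c \<le> ?S c"
        proof (cases "\<bar>?u c\<bar> \<le> real K")
          case True
          have "(?u c)\<^sup>2 - B\<^sup>2 = 2 * ?u c * R - R\<^sup>2" using u by (simp add: power2_eq_square algebra_simps)
          also have "\<dots> \<le> 2 * (\<bar>?u c\<bar> * \<bar>R\<bar>)"
            using abs_ge_self[of "?u c * R"] zero_le_power2[of R] unfolding abs_mult by linarith
          also have "\<dots> \<le> 2 * (real K * (\<Sum>k<n. r k c))" using True RR by (intro mult_left_mono mult_mono) auto
          finally have "(?u c)\<^sup>2 - ?h c \<le> 2 * real K * (\<Sum>k<n. r k c) - 2 * Z" using B2 by simp
          also have "\<dots> \<le> ?S c" using ZZ by linarith
          finally have 1: "(?u c)\<^sup>2 - ?h c \<le> ?S c" .
          have "0 \<le> (\<Sum>k<n. r k c)" "0 \<le> (\<Sum>k<n. z k c)" using RR ZZ by linarith+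
          then show ?thesis using True 1 by (simp add: W_def)
        next
          case False
          have "0 \<le> (\<Sum>k<n. r k c)" "0 \<le> (\<Sum>k<n. z k c)" using RR ZZ by linarith+
          then show ?thesis using False by (simp add: W_def)
        qed
      qed
      have iW: "integrable \<sigma> W"
        by (rule Bochner_Integration.integrable_bound[OF iS Wm]) (use le W0 in \<open>auto elim!: eventually_mono\<close>)
      have "(\<integral>c. W c \<partial>\<sigma>) \<le> (\<integral>c. ?S c \<partial>\<sigma>)" by (rule integral_mono_AE[OF iW iS le])
      also have "\<dots> = 2 * real K * (\<Sum>k<n. \<integral>c. r k c \<partial>\<sigma>) + 2 * (\<Sum>k<n. \<integral>c. z k c \<partial>\<sigma>)"
      proof -
        have "integrable \<sigma> (\<lambda>c. \<Sum>k<n. r k c)" "integrable \<sigma> (\<lambda>c. \<Sum>k<n. z k c)"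
          using r(1) z(1) by (auto intro!: Bochner_Integration.integrable_sum)
        moreover have "(\<integral>c. (\<Sum>k<n. r k c) \<partial>\<sigma>) = (\<Sum>k<n. \<integral>c. r k c \<partial>\<sigma>)"
          "(\<integral>c. (\<Sum>k<n. z k c) \<partial>\<sigma>) = (\<Sum>k<n. \<integral>c. z k c \<partial>\<sigma>)"
          using r(1) z(1) by (auto intro!: Bochner_Integration.integral_sum)
        ultimately show ?thesis
          by (subst Bochner_Integration.integral_add) simp_all
      qed
      also have "\<dots> \<le> 2 * real K * (\<Sum>k<n. (\<alpha> + 1) / 2 * (\<delta> * sqrt \<delta>)) + 2 * (\<Sum>k<n. (3 * \<alpha>\<^sup>2 + 1) / 2 * (\<delta> * sqrt \<delta>))"
        using r(2) z(2) by (intro add_mono mult_left_mono sum_mono) auto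
      also have "\<dots> = (real n * \<delta>) * (C * sqrt \<delta>)" by (simp add: C_def algebra_simps)
      finally show ?thesis using iW by (simp add: \<delta>(3)) (simp add: \<delta>_def)
    qed
    have "(\<integral>c. W c \<partial>\<sigma>) \<le> 0"
    proof (rule LIMSEQ_le_const)
      have "(\<lambda>n. C * sqrt (1 / real n)) \<longlonglongrightarrow> C * sqrt 0" by (intro tendsto_intros lim_1_over_n)
      then show "(\<lambda>n. C * sqrt (1 / real n)) \<longlonglongrightarrow> 0" by simp
      show "\<exists>N. \<forall>n\<ge>N. (\<integral>c. W c \<partial>\<sigma>) \<le> C * sqrt (1 / real n)" using bd by blast
    qed
    then have "(\<integral>c. W c \<partial>\<sigma>) = 0" using W0 by (simp add: antisym Bochner_Integration.integral_nonneg)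
    then have "AE c in \<sigma>. W c = 0"
      using integral_nonneg_eq_0_iff_AE[of \<sigma> W] bd[of 2] W0 by simp
    then show ?thesis by eventually_elim (auto simp: W_def max_def split: if_splits)
  qed
  then have "AE c in \<sigma>. \<forall>K::nat. \<bar>?u c\<bar> \<le> real K \<longrightarrow> (?u c)\<^sup>2 \<le> ?h c"
    by (subst AE_all_countable) (rule allI)
  then show ?thesis
    by eventually_elim (meson real_arch_simple)
qed

end


section \<open>Gaussian increments\<close>

lemma std_normal_lower_tail_pos: "measure std_normal_distribution {..-1} > 0"
proof -
  interpret N: real_distribution std_normal_distribution by (rule real_dist_normal_dist)
  have "emeasure std_normal_distribution {..-1} \<noteq> 0"
  proof
    assume "emeasure std_normal_distribution {..-1} = 0"
    then have "(\<integral>\<^sup>+x. ennreal (std_normal_density x) * indicator {..-1} x \<partial>lborel) = 0"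
      by (simp add: emeasure_density)
    then have "AE x in lborel. ennreal (std_normal_density x) * indicator {..-1} x = 0"
      by (subst (asm) nn_integral_0_iff_AE) auto
    then have "AE x in lborel. x \<notin> {..(-1::real)}"
    proof eventually_elim
      case (elim x)
      have "std_normal_density x > 0" by (rule normal_density_pos) simp
      with elim show ?case by (auto split: split_indicator_asm)
    qed
    then have "emeasure lborel {..(-1::real)} = 0"
      by (subst (asm) AE_iff_measurable[OF _ refl]) (auto simp: atMost_def)
    moreover have "emeasure lborel {-2..(-1::real)} \<le> emeasure lborel {..(-1::real)}"
      by (rule emeasure_mono) auto
    ultimately show False by simp
  qed
  then show ?thesis using N.emeasure_eq_measure[of "{..-1}"] by (simp add: zero_less_measure_iff)
qed

context diffusion
begin

text \<open>
When the slopes do not depend on time, the identities for the expected cosine and sine are closed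
linear integral equations, solved by \<open>exponential_decay\<close>.
\<close>

lemma lin_char:
  fixes u v :: real
  assumes st: "0 \<le> s" "s \<le> t" "t \<le> 1"
  defines "\<nu> \<equiv> 1/2 * (\<Sum>i=1..q. (u * E i $ 1 + v * E i $ 2)\<^sup>2)"
  shows "(\<integral>c. cos (lin u v 0 (c t) - lin u v 0 (c s)) \<partial>\<sigma>) = exp (- \<nu> * (t - s))"
    and "(\<integral>c. sin (lin u v 0 (c t) - lin u v 0 (c s)) \<partial>\<sigma>) = 0"
proof -
  let ?G = "lin u v 0"
  obtain m where dom: "dominated m ?G" using lin_dominated by blast
  let ?D = "\<lambda>p::(real \<Rightarrow> fil) \<times> real. ?G (fst p (max 0 (snd p))) - ?G (fst p s)"
  have Dm[measurable]: "?D \<in> borel_measurable path_time"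
  proof -
    have [measurable]: "(\<lambda>p. fst p s) \<in> borel_measurable path_time"
      by (rule measurable_compose[OF measurable_fst eval_measurable[OF st(1)]])
    note [measurable] = joint_measurable_path
    show ?thesis by measurable
  qed
  define f where "f h r = (\<integral>c. h (?D (c, r)) \<partial>\<sigma>)" for h :: "real \<Rightarrow> real" and r
  have c: "carre r ?G x = \<nu>" for r x by (simp add: carre_lin slope_def \<nu>_def)
  have iter: "(\<integral>p. indicator {s..\<tau>} (snd p) * h (?D p) \<partial>path_time) = (LBINT r:{s..\<tau>}. f h r)"
    and fm: "f h \<in> borel_measurable borel" and fb: "\<bar>f h r\<bar> \<le> 1"
    if h: "h \<in> borel_measurable borel" "\<And>y. \<bar>h y\<bar> \<le> 1" and \<tau>: "\<tau> \<le> 1" for h \<tau> r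
  proof -
    note [measurable] = h(1)
    have ih: "integrable path_time (\<lambda>(c, r). h (?D (c, r)))"
      by (rule P.integrable_const_bound[of _ 1]) (use h(2) in auto)
    have ii: "integrable path_time (\<lambda>(c, r). indicator {s..\<tau>} r * h (?D (c, r)))"
      using integrable_bounded_mult[OF ih, of "\<lambda>p. indicator {s..\<tau>} (snd p)"]
      by (simp add: case_prod_beta' split: split_indicator)
    show fm: "f h \<in> borel_measurable borel"
      using borel_measurable_integrable[OF P.integrable_snd[OF ih]] by (simp add: f_def[abs_def])
    have "f h r \<le> 1" "f (\<lambda>y. - h y) r \<le> 1"
      unfolding f_def using h(2) by (intro expectation_le_const; simp add: abs_le_iff minus_le_iff)+
    then show "\<bar>f h r\<bar> \<le> 1" unfolding f_def by (simp add: abs_le_iff)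
    have "(\<integral>p. indicator {s..\<tau>} (snd p) * h (?D p) \<partial>path_time)
      = (\<integral>r. (\<integral>c. indicator {s..\<tau>} r * h (?D (c, r)) \<partial>\<sigma>) \<partial>unit_time)"
      using P.integral_snd[OF ii] by (simp add: case_prod_beta')
    also have "\<dots> = (LBINT r:{s..\<tau>}. f h r)"
      using integral_unit_time[OF fm st(1) \<tau>] by (simp add: f_def)
    finally show "(\<integral>p. indicator {s..\<tau>} (snd p) * h (?D p) \<partial>path_time) = (LBINT r:{s..\<tau>}. f h r)" .
  qed
  have hc: "(cos :: real \<Rightarrow> real) \<in> borel_measurable borel" "\<And>y::real. \<bar>cos y\<bar> \<le> 1"
   and hs: "(sin :: real \<Rightarrow> real) \<in> borel_measurable borel" "\<And>y::real. \<bar>sin y\<bar> \<le> 1"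
    using smooth_imp_continuous_on[OF smooth_cos] smooth_imp_continuous_on[OF smooth_sin]
    by (auto intro!: borel_measurable_continuous_onI)
  have ct: "f cos \<tau> = 1 - \<nu> * (LBINT r:{s..\<tau>}. f cos r)"
   and st': "f sin \<tau> = 0 - \<nu> * (LBINT r:{s..\<tau>}. f sin r)" if \<tau>: "\<tau> \<in> {s..t}" for \<tau>
  proof -
    have s\<tau>: "s \<le> \<tau>" "\<tau> \<le> 1" "0 \<le> \<tau>" using \<tau> st by auto
    have [measurable]: "(\<lambda>c. c \<tau>) \<in> borel_measurable \<sigma>" "(\<lambda>c. c s) \<in> borel_measurable \<sigma>"
      using s\<tau> st by (auto intro!: eval_measurable)
    note tr = trig_increment[OF dom st(1) s\<tau>(1,2), unfolded gen_lin c mult_zero_right add_0_left diff_0]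
    have ic: "integrable \<sigma> (\<lambda>c. cos (?G (c \<tau>) - ?G (c s)))"
      by (rule integrable_const_bound[of _ 1]) auto
    have "1 - f cos \<tau> = (\<integral>c. 1 - cos (?G (c \<tau>) - ?G (c s)) \<partial>\<sigma>)"
      using ic s\<tau> by (simp add: f_def prob_space)
    also have "\<dots> = \<nu> * (\<integral>p. indicator {s..\<tau>} (snd p) * cos (?D p) \<partial>path_time)"
      unfolding tr(2) by (subst integral_mult_right_zero[symmetric]) (simp add: mult_ac)
    also have "\<dots> = \<nu> * (LBINT r:{s..\<tau>}. f cos r)" using iter[OF hc s\<tau>(2)] by simp
    finally show "f cos \<tau> = 1 - \<nu> * (LBINT r:{s..\<tau>}. f cos r)" by simp
    have "f sin \<tau> = (\<integral>c. sin (?G (c \<tau>) - ?G (c s)) \<partial>\<sigma>)"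
      using s\<tau> by (simp add: f_def)
    also have "\<dots> = - \<nu> * (\<integral>p. indicator {s..\<tau>} (snd p) * sin (?D p) \<partial>path_time)"
      unfolding tr(3) by (subst integral_mult_right_zero[symmetric]) (simp add: mult_ac)
    also have "\<dots> = - \<nu> * (LBINT r:{s..\<tau>}. f sin r)" using iter[OF hs s\<tau>(2)] by simp
    finally show "f sin \<tau> = 0 - \<nu> * (LBINT r:{s..\<tau>}. f sin r)" by simp
  qed
  have "f cos t = 1 * exp (- \<nu> * (t - s))"
    by (rule exponential_decay[OF st(2) fm[OF hc order_refl] fb[OF hc order_refl] ct])
  then show "(\<integral>c. cos (lin u v 0 (c t) - lin u v 0 (c s)) \<partial>\<sigma>) = exp (- \<nu> * (t - s))"
    using st by (simp add: f_def)
  have "f sin t = 0 * exp (- \<nu> * (t - s))"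
    by (rule exponential_decay[OF st(2) fm[OF hs order_refl] fb[OF hs order_refl] st'])
  then show "(\<integral>c. sin (lin u v 0 (c t) - lin u v 0 (c s)) \<partial>\<sigma>) = 0"
    using st by (simp add: f_def)
qed

lemma lin_increment_normal:
  assumes st: "0 \<le> s" "s < t" "t \<le> 1"
    and w: "w = (\<Sum>i=1..q. (u * E i $ 1 + v * E i $ 2)\<^sup>2) * (t - s)" "w > 0"
  shows "prob {c \<in> space \<sigma>. lin u v 0 (c t) - lin u v 0 (c s) \<le> - sqrt w}
    = measure std_normal_distribution {..-1}"
proof -
  define Z where "Z c = (lin u v 0 (c t) - lin u v 0 (c s)) / sqrt w" for c
  have [measurable]: "(\<lambda>c. c t) \<in> borel_measurable \<sigma>" "(\<lambda>c. c s) \<in> borel_measurable \<sigma>"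
    using st by (auto intro!: eval_measurable)
  have Zm[measurable]: "Z \<in> borel_measurable \<sigma>" unfolding Z_def by measurable
  have "char (distr \<sigma> borel Z) \<theta> = complex_of_real (exp (- (\<theta>\<^sup>2) / 2))" for \<theta>
  proof -
    let ?k = "\<theta> / sqrt w"
    have eq: "\<theta> * Z c = lin (?k * u) (?k * v) 0 (c t) - lin (?k * u) (?k * v) 0 (c s)" for c
      by (simp add: Z_def lin_def ring_distribs diff_divide_distrib add_divide_distrib mult.assoc)
    have "(\<Sum>i=1..q. (?k * u * E i $ 1 + ?k * v * E i $ 2)\<^sup>2) = ?k\<^sup>2 * (\<Sum>i=1..q. (u * E i $ 1 + v * E i $ 2)\<^sup>2)"
      unfolding sum_distrib_left by (intro sum.cong refl) (simp add: power2_eq_square algebra_simps)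
    then have "(\<Sum>i=1..q. (?k * u * E i $ 1 + ?k * v * E i $ 2)\<^sup>2) * (t - s) = ?k\<^sup>2 * w"
      by (simp add: w(1))
    also have "\<dots> = \<theta>\<^sup>2" using w(2) by (simp add: power_divide)
    finally have k: "(\<Sum>i=1..q. (?k * u * E i $ 1 + ?k * v * E i $ 2)\<^sup>2) * (t - s) = \<theta>\<^sup>2" .
    note ch = lin_char[OF st(1) less_imp_le[OF st(2)] st(3), of "?k * u" "?k * v", folded eq]
    have i: "integrable \<sigma> (\<lambda>c. iexp (\<theta> * Z c))"
      by (rule integrable_const_bound[of _ 1]) auto
    have "char (distr \<sigma> borel Z) \<theta> = (\<integral>c. iexp (\<theta> * Z c) \<partial>\<sigma>)"
      unfolding char_def by (subst integral_distr) auto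
    moreover have "Re (\<integral>c. iexp (\<theta> * Z c) \<partial>\<sigma>) = (\<integral>c. cos (\<theta> * Z c) \<partial>\<sigma>)"
      using integral_Re[OF i] by (simp add: Re_exp)
    moreover have "Im (\<integral>c. iexp (\<theta> * Z c) \<partial>\<sigma>) = (\<integral>c. sin (\<theta> * Z c) \<partial>\<sigma>)"
      using integral_Im[OF i] by (simp add: Im_exp)
    moreover have "- (1/2 * (\<Sum>i=1..q. (?k * u * E i $ 1 + ?k * v * E i $ 2)\<^sup>2)) * (t - s) = - (\<theta>\<^sup>2) / 2"
      using k by simp
    ultimately show ?thesis using ch by (simp add: complex_eq_iff)
  qed
  then have "distr \<sigma> borel Z = std_normal_distribution"
    by (intro Levy_uniqueness real_dist_normal_dist real_distribution_distr Zm)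
      (auto simp: char_std_normal_distribution)
  then have "measure std_normal_distribution {..-1} = prob (Z -` {..-1} \<inter> space \<sigma>)"
    using measure_distr[OF Zm, of "{..-1}"] by simp
  also have "Z -` {..-1} \<inter> space \<sigma> = {c \<in> space \<sigma>. lin u v 0 (c t) - lin u v 0 (c s) \<le> - sqrt w}"
    using w(2) by (auto simp: Z_def divide_le_eq)
  finally show ?thesis by simp
qed

text \<open>
The fourth coordinate of a left increment involves the product of the past \<open>x\<^sub>1\<close> and the present
\<open>y\<^sub>3\<close>; written with the frozen functionals it is a sum of small terms.
\<close>

lemma increment_nth:
  "fil_mult (- x) y $ 1 = y $ 1 - x $ 1" "fil_mult (- x) y $ 2 = y $ 2 - x $ 2"
  "fil_mult (- x) y $ 3 = y $ 3 - x $ 3"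
  "fil_mult (- x) y $ 4 = energy s y - energy s x - (lin s 0 1 y - lin s 0 1 x) * ((x $ 1 + y $ 1) / 2)"
  by (simp_all add: fil_mult_nth energy_def lin_def field_simps)

lemma increment4_abs_moment:
  assumes st: "0 \<le> s" "s < t" "t \<le> 1" "t - s \<le> 1/2"
  shows "integrable \<sigma> (\<lambda>c. \<bar>fil_mult (- c s) (c t) $ 4\<bar>)"
    "(\<integral>c. \<bar>fil_mult (- c s) (c t) $ 4\<bar> \<partial>\<sigma>) \<le> ((3 * \<alpha>\<^sup>2 + 1) / 2 + \<alpha>) * ((t - s) * sqrt (t - s))"
proof -
  have [measurable]: "(\<lambda>c. c t) \<in> borel_measurable \<sigma>" "(\<lambda>c. c s) \<in> borel_measurable \<sigma>"
    using st by (auto intro!: eval_measurable)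
  define \<kappa> where "\<kappa> = (t - s) * sqrt (t - s)"
  have \<kappa>: "\<kappa> > 0" "\<kappa>\<^sup>2 = (t - s) ^ 3"
    using st by (simp_all add: \<kappa>_def power_mult_distrib power2_eq_square power3_eq_cube)
  define r where "r c = lin s 0 1 (c t) - lin s 0 1 (c s)" for c
  define z where "z c = energy s (c t) - energy s (c s)" for c
  have r: "integrable \<sigma> (\<lambda>c. (r c)\<^sup>2)" "(\<integral>c. (r c)\<^sup>2 \<partial>\<sigma>) \<le> \<alpha> * \<kappa>\<^sup>2"
    using lin_frozen_second_moment[of s t] st unfolding r_def \<kappa> by auto
  have z: "integrable \<sigma> (\<lambda>c. \<bar>z c\<bar>)" "(\<integral>c. \<bar>z c\<bar> \<partial>\<sigma>) \<le> (3 * \<alpha>\<^sup>2 + 1) / 2 * \<kappa>"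
    using energy_abs_moment[OF st] unfolding z_def \<kappa>_def by auto
  have m: "integrable \<sigma> (\<lambda>c. (c s $ 1)\<^sup>2)" "(\<integral>c. (c s $ 1)\<^sup>2 \<partial>\<sigma>) \<le> \<alpha>"
    "integrable \<sigma> (\<lambda>c. (c t $ 1)\<^sup>2)" "(\<integral>c. (c t $ 1)\<^sup>2 \<partial>\<sigma>) \<le> \<alpha>"
    using coord1_square_bound[of s] coord1_square_bound[of t] st by auto
  let ?B = "\<lambda>c. \<bar>z c\<bar> + (1 / (2 * \<kappa>) * (r c)\<^sup>2 + \<kappa> / 4 * ((c s $ 1)\<^sup>2 + (c t $ 1)\<^sup>2))"
  have iB: "integrable \<sigma> ?B"
    by (intro Bochner_Integration.integrable_add integrable_mult_right z r m)
  have le: "\<bar>fil_mult (- c s) (c t) $ 4\<bar> \<le> ?B c" for c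
  proof -
    let ?y = "(c s $ 1 + c t $ 1) / 2"
    have young: "2 * \<kappa> * (\<bar>a\<bar> * \<bar>b\<bar>) \<le> a\<^sup>2 + \<kappa>\<^sup>2 * b\<^sup>2" for a b :: real
    proof -
      have "0 \<le> (\<bar>a\<bar> - \<kappa> * \<bar>b\<bar>)\<^sup>2" by simp
      then show ?thesis by (simp add: power2_diff power_mult_distrib algebra_simps)
    qed
    have "2 * \<kappa> * (\<bar>r c\<bar> * \<bar>?y\<bar>) \<le> (r c)\<^sup>2 + \<kappa>\<^sup>2 * ?y\<^sup>2" by (rule young)
    then have "\<bar>r c\<bar> * \<bar>?y\<bar> \<le> ((r c)\<^sup>2 + \<kappa>\<^sup>2 * ?y\<^sup>2) / (2 * \<kappa>)"
      using \<kappa>(1) by (simp add: pos_le_divide_eq mult.commute)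
    also have "\<dots> = 1 / (2 * \<kappa>) * (r c)\<^sup>2 + \<kappa> / 2 * ?y\<^sup>2"
      using \<kappa>(1) by (simp add: add_divide_distrib power2_eq_square)
    also have "?y\<^sup>2 \<le> ((c s $ 1)\<^sup>2 + (c t $ 1)\<^sup>2) / 2"
      using zero_le_power2[of "c s $ 1 - c t $ 1"] by (simp add: power2_eq_square algebra_simps)
    finally have 1: "\<bar>r c\<bar> * \<bar>?y\<bar> \<le> 1 / (2 * \<kappa>) * (r c)\<^sup>2 + \<kappa> / 4 * ((c s $ 1)\<^sup>2 + (c t $ 1)\<^sup>2)"
      using \<kappa>(1) by (simp add: mult_left_mono)
    have "fil_mult (- c s) (c t) $ 4 = z c - r c * ?y"
      unfolding increment_nth(4)[of _ _ s] z_def r_def ..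
    then have "\<bar>fil_mult (- c s) (c t) $ 4\<bar> \<le> \<bar>z c\<bar> + \<bar>r c\<bar> * \<bar>?y\<bar>"
      using abs_triangle_ineq4[of "z c" "r c * ?y"] unfolding abs_mult by simp
    then show ?thesis using 1 by linarith
  qed
  have ym: "(\<lambda>c. \<bar>fil_mult (- c s) (c t) $ 4\<bar>) \<in> borel_measurable \<sigma>"
    unfolding increment_nth(4)[of _ _ s] by measurable
  show i4: "integrable \<sigma> (\<lambda>c. \<bar>fil_mult (- c s) (c t) $ 4\<bar>)"
    by (rule Bochner_Integration.integrable_bound[OF iB ym]) (use le in \<open>auto intro: order_trans[OF _ abs_ge_self]\<close>)
  have "(\<integral>c. \<bar>fil_mult (- c s) (c t) $ 4\<bar> \<partial>\<sigma>) \<le> (\<integral>c. ?B c \<partial>\<sigma>)"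
    by (rule integral_mono[OF i4 iB le])
  also have "\<dots> = (\<integral>c. \<bar>z c\<bar> \<partial>\<sigma>) + (1 / (2 * \<kappa>) * (\<integral>c. (r c)\<^sup>2 \<partial>\<sigma>)
      + \<kappa> / 4 * ((\<integral>c. (c s $ 1)\<^sup>2 \<partial>\<sigma>) + (\<integral>c. (c t $ 1)\<^sup>2 \<partial>\<sigma>)))"
    using z r m by simp
  also have "\<dots> \<le> (3 * \<alpha>\<^sup>2 + 1) / 2 * \<kappa> + (1 / (2 * \<kappa>) * (\<alpha> * \<kappa>\<^sup>2) + \<kappa> / 4 * (\<alpha> + \<alpha>))"
    using \<kappa>(1) by (intro add_mono mult_left_mono z r m) auto
  also have "\<dots> = ((3 * \<alpha>\<^sup>2 + 1) / 2 + \<alpha>) * \<kappa>"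
    using \<kappa>(1) by (simp add: power2_eq_square field_simps)
  finally show "(\<integral>c. \<bar>fil_mult (- c s) (c t) $ 4\<bar> \<partial>\<sigma>) \<le> ((3 * \<alpha>\<^sup>2 + 1) / 2 + \<alpha>) * ((t - s) * sqrt (t - s))"
    by (simp add: \<kappa>_def)
qed

end


section \<open>Products of support points\<close>

text \<open>
The left increments over a time step of length \<open>\<delta>\<close> starting at \<open>s\<close> that keep the first two coordinates
in the tube of radius \<open>\<epsilon>\<close> around the curve, when \<open>(f1, f2)\<close> is the current offset minus the displacement
of the curve, and that contribute a negligible error to both integrals.
\<close>

definition step_set :: "real \<Rightarrow> real \<Rightarrow> real \<Rightarrow> real \<Rightarrow> real \<Rightarrow> fil set" where
  "step_set \<epsilon> s \<delta> f1 f2 = {y. (f1 + y $ 1)\<^sup>2 + (f2 + y $ 2)\<^sup>2 < \<epsilon>\<^sup>2 \<and>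
     \<bar>s * y $ 1 + y $ 3\<bar> < \<epsilon> * \<delta> \<and> \<bar>y $ 4\<bar> < \<epsilon> * \<delta>}"

lemma open_step_set: "open (step_set \<epsilon> s \<delta> f1 f2)"
  unfolding step_set_def by (intro open_Collect_conj open_Collect_less continuous_intros)

lemma continuous_fil_mult:
  "continuous_on S f \<Longrightarrow> continuous_on S g \<Longrightarrow> continuous_on S (\<lambda>x. fil_mult (f x) (g x))"
  unfolding fil_mult_eq by (intro continuous_intros)

lemma fil_mult_cancel: "fil_mult x (fil_mult (- x) y) = y"
  by (simp add: vec_eq_iff forall_4 fil_mult_nth algebra_simps)

lemma open_meets_msupport:
  fixes M :: "'a::second_countable_topology measure"
  assumes M: "sets M = sets borel" and U: "open U" "emeasure M U > 0"
  shows "\<exists>p\<in>U. p \<in> msupport M"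
proof (rule ccontr)
  assume "\<not> (\<exists>p\<in>U. p \<in> msupport M)"
  then have *: "\<exists>V. open V \<and> p \<in> V \<and> emeasure M V = 0" if "p \<in> U" for p
    using that by (auto simp: msupport_def zero_less_iff_neq_zero)
  define F where "F = {V. open V \<and> emeasure M V = 0}"
  obtain F' where F': "F' \<subseteq> F" "countable F'" "\<Union>F' = \<Union>F"
    using Lindelof[of F] by (auto simp: F_def)
  have "(\<Union>V\<in>F'. V) \<in> null_sets M"
  proof (rule null_sets_UN'[OF F'(2)])
    fix V assume "V \<in> F'"
    then have "open V" "emeasure M V = 0" using F'(1) by (auto simp: F_def)
    then show "V \<in> null_sets M" by (simp add: null_sets_def M)
  qed
  moreover have "U \<subseteq> \<Union>F'" unfolding F'(3) F_def using * by blast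
  ultimately have "U \<in> null_sets M"
    using U(1) M by (intro null_sets_subset[of "\<Union>F'" M U]) auto
  then show False using U(2) by (simp add: null_sets_def)
qed

lemma fil_product_neighbourhood:
  fixes x :: "nat \<Rightarrow> fil"
  assumes "x 0 = 0"
  shows "open U \<Longrightarrow> x n \<in> U \<Longrightarrow> \<exists>d>0. \<forall>y. y 0 = 0 \<longrightarrow>
    (\<forall>k<n. dist (fil_mult (- y k) (y (Suc k))) (fil_mult (- x k) (x (Suc k))) < d) \<longrightarrow> y n \<in> U"
proof (induction n arbitrary: U)
  case 0
  then show ?case using assms by (intro exI[of _ 1]) auto
next
  case (Suc n)
  define p where "p = fil_mult (- x n) (x (Suc n))"
  define W where "W = (\<lambda>z. fil_mult (fst z) (snd z)) -` U"
  have "continuous_on UNIV (\<lambda>z::fil \<times> fil. fil_mult (fst z) (snd z))"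
    by (intro continuous_fil_mult continuous_intros)
  then have "open W" unfolding W_def using Suc.prems(1) by (simp add: open_vimage)
  moreover have "(x n, p) \<in> W" using Suc.prems(2) by (simp add: W_def p_def fil_mult_cancel)
  ultimately obtain A B where AB: "open A" "open B" "x n \<in> A" "p \<in> B" "A \<times> B \<subseteq> W"
    unfolding open_prod_def by (metis mem_Sigma_iff)
  obtain d1 where d1: "d1 > 0" "\<And>z. dist z p < d1 \<Longrightarrow> z \<in> B"
    using AB(2,4) unfolding open_dist by blast
  obtain d2 where d2: "d2 > 0" "\<And>y. y 0 = 0 \<Longrightarrow>
     (\<And>k. k < n \<Longrightarrow> dist (fil_mult (- y k) (y (Suc k))) (fil_mult (- x k) (x (Suc k))) < d2) \<Longrightarrow> y n \<in> A"
    using Suc.IH[OF AB(1,3)] by blast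
  show ?case
  proof (intro exI[of _ "min d1 d2"] conjI allI impI)
    fix y :: "nat \<Rightarrow> fil"
    assume y0: "y 0 = 0" and y: "\<forall>k<Suc n. dist (fil_mult (- y k) (y (Suc k))) (fil_mult (- x k) (x (Suc k))) < min d1 d2"
    have "y n \<in> A" using y by (intro d2(2) y0) auto
    moreover have "fil_mult (- y n) (y (Suc n)) \<in> B" using y by (intro d1(2)) (auto simp: p_def)
    ultimately have "(y n, fil_mult (- y n) (y (Suc n))) \<in> W" using AB(5) by blast
    then show "y (Suc n) \<in> U" by (simp add: W_def fil_mult_cancel)
  qed (use d1 d2 in auto)
qed

context diffusion
begin

lemma increment_measurable:
  assumes "0 \<le> s" "0 \<le> t"
  shows "(\<lambda>c. fil_mult (- c s) (c t)) \<in> borel_measurable \<sigma>"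
proof -
  have [measurable]: "(\<lambda>c. c t) \<in> borel_measurable \<sigma>" "(\<lambda>c. c s) \<in> borel_measurable \<sigma>"
    using assms by (auto intro!: eval_measurable)
  have "(\<lambda>z. fil_mult (- fst z) (snd z)) \<in> borel_measurable (borel \<Otimes>\<^sub>M borel)"
    unfolding borel_prod by (intro borel_measurable_continuous_onI continuous_fil_mult continuous_intros)
  moreover have "(\<lambda>c. (c s, c t)) \<in> \<sigma> \<rightarrow>\<^sub>M borel \<Otimes>\<^sub>M borel" by measurable
  ultimately show ?thesis using measurable_compose[of "\<lambda>c. (c s, c t)" \<sigma> "borel \<Otimes>\<^sub>M borel" "\<lambda>z. fil_mult (- fst z) (snd z)" borel]
    by simp
qed

text \<open>
The offset \<open>f\<close> can leave the tube by at most a multiple of \<open>\<delta>\<close>.  If \<open>f\<close> is small, a small increment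
suffices.  If not, consider the component of the increment along \<open>f\<close>: with a fixed probability it is
at most \<open>-1\<close> standard deviation, which reduces \<open>\<bar>f\<bar>\<^sup>2\<close> by a multiple of \<open>\<surd>\<delta>\<close>.  This outweighs the
contributions of the curve and of the square of the increment, which are of order \<open>\<delta>\<close>.  Only the
law of a single linear functional of the increment enters, not its planar law.  All exceptional
events have probability of order \<open>\<surd>\<delta>\<close>; the hypotheses \<open>h1\<close>, \<open>h2\<close> and \<open>h3\<close> say that \<open>\<delta>\<close> is small enough
for these comparisons.
\<close>

lemma step_positive:
  assumes st: "0 \<le> s" "s < t" "t \<le> 1" "t - s \<le> 1/2"
    and nu: "\<nu> > 0" "\<And>f1 f2. \<nu> * (f1\<^sup>2 + f2\<^sup>2) \<le> (\<Sum>i=1..q. (f1 * E i $ 1 + f2 * E i $ 2)\<^sup>2)"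
    and \<epsilon>: "\<epsilon> > 0" and L: "L \<ge> 0"
  defines "\<delta> \<equiv> t - s"
  defines "m \<equiv> sqrt \<nu> * \<epsilon> / 4"
  assumes h1: "(4 * \<epsilon> * L + 2 * L\<^sup>2) * sqrt \<delta> \<le> m"
    and h2: "m * sqrt \<delta> \<le> \<epsilon>\<^sup>2 / 4"
    and h3: "((\<alpha> + \<beta>) / m + (\<alpha> + 1) / 2 / \<epsilon> + ((3 * \<alpha>\<^sup>2 + 1) / 2 + \<alpha>) / \<epsilon>) * sqrt \<delta> < measure std_normal_distribution {..-1}"
    and e: "e1\<^sup>2 + e2\<^sup>2 < \<epsilon>\<^sup>2" and d: "\<bar>d1\<bar> \<le> L * \<delta>" "\<bar>d2\<bar> \<le> L * \<delta>"
  shows "prob {c \<in> space \<sigma>. fil_mult (- c s) (c t) \<in> step_set \<epsilon> s \<delta> (e1 - d1) (e2 - d2)} > 0"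
proof -
  have \<delta>: "\<delta> > 0" "\<delta> \<le> 1/2" using st by (auto simp: \<delta>_def)
  have sd: "sqrt \<delta> > 0" "sqrt \<delta> * sqrt \<delta> = \<delta>" using \<delta> by auto
  have m: "m > 0" using nu \<epsilon> by (simp add: m_def)
  define f1 where "f1 = e1 - d1"
  define f2 where "f2 = e2 - d2"
  define Q where "Q = (\<Sum>i=1..q. (f1 * E i $ 1 + f2 * E i $ 2)\<^sup>2)"
  define F where "F = f1\<^sup>2 + f2\<^sup>2"
  have Q: "\<nu> * F \<le> Q" unfolding Q_def F_def by (rule nu)
  have st': "0 \<le> s" "s \<le> t" "t \<le> 1" using st by auto
  have [measurable]: "(\<lambda>c. c t) \<in> borel_measurable \<sigma>" "(\<lambda>c. c s) \<in> borel_measurable \<sigma>"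
    using st by (auto intro!: eval_measurable)
  have ym[measurable]: "(\<lambda>c. fil_mult (- c s) (c t)) \<in> borel_measurable \<sigma>"
    using st by (intro increment_measurable) auto
  let ?y = "\<lambda>c. fil_mult (- c s) (c t)"
  let ?D = "\<lambda>c. (c t $ 1 - c s $ 1)\<^sup>2 + (c t $ 2 - c s $ 2)\<^sup>2"
  define B1 where "B1 = {c \<in> space \<sigma>. ?D c \<ge> m * sqrt \<delta>}"
  define B2 where "B2 = {c \<in> space \<sigma>. \<bar>lin s 0 1 (c t) - lin s 0 1 (c s)\<bar> \<ge> \<epsilon> * \<delta>}"
  define B3 where "B3 = {c \<in> space \<sigma>. \<bar>?y c $ 4\<bar> \<ge> \<epsilon> * \<delta>}"
  define G where "G = {c \<in> space \<sigma>. F \<ge> \<epsilon>\<^sup>2 / 16 \<longrightarrow> lin f1 f2 0 (c t) - lin f1 f2 0 (c s) \<le> - sqrt (Q * \<delta>)}"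
  have [measurable]: "B1 \<in> sets \<sigma>" "B2 \<in> sets \<sigma>" "B3 \<in> sets \<sigma>" "G \<in> sets \<sigma>"
    unfolding B1_def B2_def B3_def G_def by measurable
  have P1: "prob B1 \<le> (\<alpha> + \<beta>) / m * sqrt \<delta>"
  proof -
    have i: "integrable \<sigma> ?D"
      using coord1_second_moment(1)[OF st'] coord2_second_moment(1)[OF st'] by simp
    have "(\<integral>c. ?D c \<partial>\<sigma>) \<le> \<alpha> * \<delta> + \<beta> * \<delta>"
      using coord1_second_moment[OF st'] coord2_second_moment[OF st'] by (simp add: \<delta>_def)
    moreover have "prob B1 \<le> (\<integral>c. ?D c \<partial>\<sigma>) / (m * sqrt \<delta>)"
      unfolding B1_def by (rule integral_Markov_inequality_measure[where A = "{}", OF i]) (use m sd in auto)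
    ultimately have "prob B1 \<le> (\<alpha> * \<delta> + \<beta> * \<delta>) / (m * sqrt \<delta>)"
      using m sd by (meson divide_right_mono less_imp_le mult_pos_pos order_trans)
    also have "\<alpha> * \<delta> + \<beta> * \<delta> = (\<alpha> + \<beta>) * sqrt \<delta> * sqrt \<delta>"
      by (simp only: mult.assoc sd(2) distrib_right)
    also have "(\<alpha> + \<beta>) * sqrt \<delta> * sqrt \<delta> / (m * sqrt \<delta>) = (\<alpha> + \<beta>) / m * sqrt \<delta>"
      using sd(1) by (simp del: real_sqrt_mult_self)
    finally show ?thesis .
  qed
  have markov: "prob {c \<in> space \<sigma>. u c \<ge> \<epsilon> * \<delta>} \<le> C / \<epsilon> * sqrt \<delta>"
    if i: "integrable \<sigma> u" and u: "\<And>c. u c \<ge> 0" "(\<integral>c. u c \<partial>\<sigma>) \<le> C * (\<delta> * sqrt \<delta>)" for u C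
  proof -
    have "prob {c \<in> space \<sigma>. u c \<ge> \<epsilon> * \<delta>} \<le> (\<integral>c. u c \<partial>\<sigma>) / (\<epsilon> * \<delta>)"
      by (rule integral_Markov_inequality_measure[where A = "{}", OF i]) (use \<epsilon> \<delta> u in auto)
    also have "\<dots> \<le> C * (\<delta> * sqrt \<delta>) / (\<epsilon> * \<delta>)"
      using u \<epsilon> \<delta> by (intro divide_right_mono) auto
    also have "\<dots> = C / \<epsilon> * sqrt \<delta>" using \<epsilon> \<delta> by (simp add: field_simps)
    finally show ?thesis .
  qed
  have P2: "prob B2 \<le> (\<alpha> + 1) / 2 / \<epsilon> * sqrt \<delta>"
    unfolding B2_def using lin_abs_moment[OF st(1-3)] by (intro markov) (auto simp: \<delta>_def)
  have P3: "prob B3 \<le> ((3 * \<alpha>\<^sup>2 + 1) / 2 + \<alpha>) / \<epsilon> * sqrt \<delta>"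
    unfolding B3_def using increment4_abs_moment[OF st] by (intro markov) (auto simp: \<delta>_def)
  have PG: "prob G \<ge> measure std_normal_distribution {..-1}"
  proof (cases "F \<ge> \<epsilon>\<^sup>2 / 16")
    case True
    have "F > 0" by (rule less_le_trans[OF _ True]) (use \<epsilon> in simp)
    then have "Q > 0" using Q nu(1) by (meson less_le_trans mult_pos_pos)
    then have "prob {c \<in> space \<sigma>. lin f1 f2 0 (c t) - lin f1 f2 0 (c s) \<le> - sqrt (Q * \<delta>)} = measure std_normal_distribution {..-1}"
      using \<delta> by (intro lin_increment_normal st) (auto simp: Q_def \<delta>_def)
    then show ?thesis using True by (simp add: G_def)
  next
    case False
    then have "G = space \<sigma>" by (simp add: G_def)
    moreover interpret N: real_distribution std_normal_distribution by (rule real_dist_normal_dist)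
    have "measure std_normal_distribution {..-1} \<le> 1" by (rule N.prob_le_1)
    ultimately show ?thesis by (simp add: prob_space)
  qed
  have sub: "G - (B1 \<union> B2 \<union> B3) \<subseteq> {c \<in> space \<sigma>. ?y c \<in> step_set \<epsilon> s \<delta> f1 f2}"
  proof
    fix c assume c: "c \<in> G - (B1 \<union> B2 \<union> B3)"
    define y1 where "y1 = c t $ 1 - c s $ 1"
    define y2 where "y2 = c t $ 2 - c s $ 2"
    have sp: "c \<in> space \<sigma>" using c by (simp add: G_def)
    have b1: "y1\<^sup>2 + y2\<^sup>2 < m * sqrt \<delta>" using c sp by (auto simp: B1_def y1_def y2_def)
    have b2: "\<bar>s * y1 + (c t $ 3 - c s $ 3)\<bar> < \<epsilon> * \<delta>"
      using c sp by (auto simp: B2_def lin_def y1_def algebra_simps)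
    have b3: "\<bar>?y c $ 4\<bar> < \<epsilon> * \<delta>" using c sp by (auto simp: B3_def)
    have "(f1 + y1)\<^sup>2 + (f2 + y2)\<^sup>2 < \<epsilon>\<^sup>2"
    proof (cases "F \<ge> \<epsilon>\<^sup>2 / 16")
      case True
      have "m\<^sup>2 * \<delta> = \<nu> * (\<epsilon>\<^sup>2 / 16) * \<delta>" using nu(1) by (simp add: m_def power_mult_distrib power_divide)
      also have "\<dots> \<le> \<nu> * F * \<delta>" using True nu(1) \<delta> by (intro mult_right_mono mult_left_mono) auto
      also have "\<dots> \<le> Q * \<delta>" using Q \<delta> by (intro mult_right_mono) auto
      finally have "sqrt (m\<^sup>2 * \<delta>) \<le> sqrt (Q * \<delta>)" by (rule real_sqrt_le_mono)
      then have "m * sqrt \<delta> \<le> sqrt (Q * \<delta>)" using m by (simp add: real_sqrt_mult)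
      moreover have "lin f1 f2 0 (c t) - lin f1 f2 0 (c s) \<le> - sqrt (Q * \<delta>)"
        using c True by (simp add: G_def)
      ultimately have g: "f1 * y1 + f2 * y2 \<le> - (m * sqrt \<delta>)"
        by (simp add: lin_def y1_def y2_def algebra_simps)
      have ee: "\<bar>e1\<bar> \<le> \<epsilon>" "\<bar>e2\<bar> \<le> \<epsilon>"
      proof -
        have "e1\<^sup>2 \<le> \<epsilon>\<^sup>2" "e2\<^sup>2 \<le> \<epsilon>\<^sup>2"
          using e zero_le_power2[of e1] zero_le_power2[of e2] by linarith+
        then show "\<bar>e1\<bar> \<le> \<epsilon>" "\<bar>e2\<bar> \<le> \<epsilon>"
          using \<epsilon> by (auto intro: power2_le_imp_le)
      qed
      have pr: "\<bar>e1 * d1\<bar> \<le> \<epsilon> * (L * \<delta>)" "\<bar>e2 * d2\<bar> \<le> \<epsilon> * (L * \<delta>)"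
        unfolding abs_mult using ee d \<epsilon> by (intro mult_mono; simp)+
      have dd: "d1\<^sup>2 \<le> (L * \<delta>)\<^sup>2" "d2\<^sup>2 \<le> (L * \<delta>)\<^sup>2"
        using power_mono[OF d(1), of 2] power_mono[OF d(2), of 2] by simp_all
      have dd2: "(L * \<delta>)\<^sup>2 \<le> L\<^sup>2 * \<delta>"
        using \<delta> mult_left_mono[of "\<delta> * \<delta>" "\<delta> * 1" "L\<^sup>2"] by (simp add: power2_eq_square mult_ac)
      have "F = e1\<^sup>2 + e2\<^sup>2 - 2 * (e1 * d1) - 2 * (e2 * d2) + d1\<^sup>2 + d2\<^sup>2"
        by (simp add: F_def f1_def f2_def power2_eq_square algebra_simps)
      also have "\<dots> < \<epsilon>\<^sup>2 + 4 * (\<epsilon> * (L * \<delta>)) + 2 * (L\<^sup>2 * \<delta>)"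
        using e pr dd dd2 by (simp add: abs_le_iff)
      also have "\<dots> = \<epsilon>\<^sup>2 + (4 * \<epsilon> * L + 2 * L\<^sup>2) * sqrt \<delta> * sqrt \<delta>"
        unfolding mult.assoc[of _ "sqrt \<delta>" "sqrt \<delta>"] sd(2) by (simp add: algebra_simps)
      also have "\<dots> \<le> \<epsilon>\<^sup>2 + m * sqrt \<delta>"
        using h1 sd by (intro add_left_mono mult_right_mono) auto
      finally have "F < \<epsilon>\<^sup>2 + m * sqrt \<delta>" .
      moreover have "(f1 + y1)\<^sup>2 + (f2 + y2)\<^sup>2 = F + 2 * (f1 * y1 + f2 * y2) + (y1\<^sup>2 + y2\<^sup>2)"
        by (simp add: F_def power2_eq_square algebra_simps)
      moreover have "a < b" if "F < b + k" "a = F + 2 * g + Y" "g \<le> - k" "Y < k" for a b g k Y :: real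
        using that by linarith
      ultimately show ?thesis using g b1 by blast
    next
      case False
      have "(f1 + y1)\<^sup>2 + (f2 + y2)\<^sup>2 \<le> 2 * F + 2 * (y1\<^sup>2 + y2\<^sup>2)"
        using zero_le_power2[of "f1 - y1"] zero_le_power2[of "f2 - y2"]
        by (simp add: F_def power2_eq_square algebra_simps)
      moreover have "a < b" if "a \<le> 2 * F + 2 * Y" "\<not> b / 16 \<le> F" "Y < k" "k \<le> b / 4" "0 < b" for a b k Y :: real
        using that by linarith
      moreover have "0 < \<epsilon>\<^sup>2" using \<epsilon> by simp
      ultimately show ?thesis using False b1 h2 by blast
    qed
    then show "c \<in> {c \<in> space \<sigma>. ?y c \<in> step_set \<epsilon> s \<delta> f1 f2}"
      using sp b2 b3 by (simp add: step_set_def increment_nth(1-3) y1_def y2_def)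
  qed
  have "prob (B1 \<union> B2 \<union> B3) \<le> prob B1 + prob B2 + prob B3"
    using measure_Un_le[of "B1 \<union> B2" \<sigma> B3] measure_Un_le[of B1 \<sigma> B2] by simp
  also have "\<dots> \<le> ((\<alpha> + \<beta>) / m + (\<alpha> + 1) / 2 / \<epsilon> + ((3 * \<alpha>\<^sup>2 + 1) / 2 + \<alpha>) / \<epsilon>) * sqrt \<delta>"
    using P1 P2 P3 by (simp only: distrib_right)
  also have "\<dots> < prob G" using h3 PG by linarith
  finally have lt: "prob (B1 \<union> B2 \<union> B3) < prob G" .
  have "prob G - prob (B1 \<union> B2 \<union> B3) \<le> prob (G - (B1 \<union> B2 \<union> B3))"
  proof -
    have "prob G \<le> prob ((G - (B1 \<union> B2 \<union> B3)) \<union> (B1 \<union> B2 \<union> B3))"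
      by (rule finite_measure_mono) auto
    also have "\<dots> \<le> prob (G - (B1 \<union> B2 \<union> B3)) + prob (B1 \<union> B2 \<union> B3)"
      by (rule measure_Un_le) auto
    finally show ?thesis by simp
  qed
  also have "\<dots> \<le> prob {c \<in> space \<sigma>. ?y c \<in> step_set \<epsilon> s \<delta> f1 f2}"
  proof (rule finite_measure_mono[OF sub])
    show "{c \<in> space \<sigma>. ?y c \<in> step_set \<epsilon> s \<delta> f1 f2} \<in> sets \<sigma>"
      using measurable_sets[OF ym borel_open[OF open_step_set]] by (simp add: vimage_def Int_def conj_commute)
  qed
  finally show ?thesis using lt by (simp add: f1_def f2_def)
qed

text \<open>
The end point depends continuously on the finitely many left increments, and these are independent:
prescribing each of them up to \<open>d\<close> has positive probability.
\<close>

lemma product_in_support: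
  fixes x :: "nat \<Rightarrow> fil"
  assumes n: "n \<ge> 1" and x0: "x 0 = 0"
    and supp: "\<And>k. k < n \<Longrightarrow> fil_mult (- x k) (x (Suc k)) \<in>
      msupport (distr \<sigma> borel (\<lambda>c. fil_mult (- c (real k / real n)) (c (real (Suc k) / real n))))"
  shows "x n \<in> msupport (distr \<sigma> borel (\<lambda>c. c 1))"
  unfolding msupport_def
proof (intro CollectI allI impI)
  fix U assume U: "open U \<and> x n \<in> U"
  define \<tau> where "\<tau> k = real k / real n" for k
  let ?y = "\<lambda>k c. fil_mult (- c (\<tau> k)) (c (\<tau> (Suc k)))"
  have ym: "?y k \<in> borel_measurable \<sigma>" for k
    by (rule increment_measurable) (auto simp: \<tau>_def)
  obtain d where d: "d > 0" "\<And>y. y 0 = 0 \<Longrightarrow>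
    (\<And>k. k < n \<Longrightarrow> dist (fil_mult (- y k) (y (Suc k))) (fil_mult (- x k) (x (Suc k))) < d) \<Longrightarrow> y n \<in> U"
    using fil_product_neighbourhood[of x U n, OF x0] U by blast
  let ?B = "\<lambda>k. ball (fil_mult (- x k) (x (Suc k))) d"
  have pos: "prob (?y k -` ?B k \<inter> space \<sigma>) > 0" if "k < n" for k
  proof -
    have "emeasure (distr \<sigma> borel (?y k)) (?B k) > 0"
      using supp[OF that] d(1) by (auto simp: msupport_def \<tau>_def)
    then show ?thesis
      using ym by (simp add: emeasure_distr emeasure_eq_measure)
  qed
  have "indep_vars (\<lambda>_. borel) ?y {..<n}"
  proof -
    have "0 \<le> \<tau> 0 \<and> (\<forall>i<n. \<tau> i \<le> \<tau> (Suc i))" by (auto simp: \<tau>_def divide_right_mono)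
    then show ?thesis using law unfolding diffusion_law_def by blast
  qed
  then have "prob (\<Inter>k\<in>{..<n}. ?y k -` ?B k \<inter> space \<sigma>) = (\<Prod>k<n. prob (?y k -` ?B k \<inter> space \<sigma>))"
    using n by (intro indep_varsD_finite) (auto simp: lessThan_empty_iff)
  also have "\<dots> > 0" by (intro prod_pos) (use pos in auto)
  finally have P: "prob (\<Inter>k\<in>{..<n}. ?y k -` ?B k \<inter> space \<sigma>) > 0" .
  have cm: "(\<lambda>c. c 1) \<in> borel_measurable \<sigma>" by (rule eval_measurable) simp
  have "prob (\<Inter>k\<in>{..<n}. ?y k -` ?B k \<inter> space \<sigma>) \<le> prob ((\<lambda>c. c 1) -` U \<inter> space \<sigma>)"
  proof (rule finite_measure_mono_AE)
    show "AE c in \<sigma>. c \<in> (\<Inter>k\<in>{..<n}. ?y k -` ?B k \<inter> space \<sigma>) \<longrightarrow> c \<in> (\<lambda>c. c 1) -` U \<inter> space \<sigma>"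
      using start
    proof (eventually_elim, intro impI)
      fix c assume elim: "c 0 = 0" "c \<in> (\<Inter>k\<in>{..<n}. ?y k -` ?B k \<inter> space \<sigma>)"
      have "?y k c \<in> ?B k" if "k < n" for k using elim(2) that by blast
      then have "dist (?y k c) (fil_mult (- x k) (x (Suc k))) < d" if "k < n" for k
        using that by (simp add: dist_commute)
      then have "c (\<tau> n) \<in> U"
        by (intro d(2)[of "\<lambda>k. c (\<tau> k)"]) (simp_all add: \<tau>_def elim(1))
      moreover have "\<tau> n = 1" using n by (simp add: \<tau>_def)
      moreover have "c \<in> space \<sigma>"
      proof -
        have "0 < n" using n by simp
        then show ?thesis using elim(2) by blast
      qed
      ultimately show "c \<in> (\<lambda>c. c 1) -` U \<inter> space \<sigma>" by simp
    qed
    show "(\<lambda>c. c 1) -` U \<inter> space \<sigma> \<in> sets \<sigma>" using U by (intro measurable_sets[OF cm]) auto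
  qed
  then have "prob ((\<lambda>c. c 1) -` U \<inter> space \<sigma>) > 0" using P by linarith
  then show "0 < emeasure (distr \<sigma> borel (\<lambda>c. c 1)) U"
    using U cm by (simp add: emeasure_distr emeasure_eq_measure)
qed

end


section \<open>Reaching every point of the region\<close>

definition rsum :: "nat \<Rightarrow> (real \<Rightarrow> real) \<Rightarrow> real" where
  "rsum n f = (\<Sum>k<n. f (real (Suc k) / real n)) / real n"

lemma rsum_grid: "k < n \<Longrightarrow> real (Suc k) / real n \<in> {0..1}"
  by (simp add: divide_le_eq)

lemma rsum_close:
  assumes n: "n \<ge> 1" and le: "\<And>t. t \<in> {0..1} \<Longrightarrow> \<bar>f t - g t\<bar> \<le> h t"
  shows "\<bar>rsum n f - rsum n g\<bar> \<le> rsum n h"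
proof -
  have "rsum n f - rsum n g = (\<Sum>k<n. f (real (Suc k) / real n) - g (real (Suc k) / real n)) / real n"
    by (simp add: rsum_def sum_subtractf diff_divide_distrib)
  moreover have "\<bar>\<Sum>k<n. f (real (Suc k) / real n) - g (real (Suc k) / real n)\<bar> \<le> (\<Sum>k<n. h (real (Suc k) / real n))"
    using rsum_grid by (intro order_trans[OF sum_abs] sum_mono le) auto
  ultimately show ?thesis by (simp add: rsum_def divide_right_mono)
qed

text \<open>
The mean value theorem compares each term of the sum with an increment of the antiderivative \<open>F\<close>.
\<close>

lemma rsum_tendsto:
  assumes F: "\<And>t. (F has_real_derivative f t) (at t)"
    and L: "\<And>x y. x \<in> {0..1} \<Longrightarrow> y \<in> {0..1} \<Longrightarrow> \<bar>f x - f y\<bar> \<le> L * \<bar>x - y\<bar>"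
  shows "(\<lambda>n. rsum n f) \<longlonglongrightarrow> F 1 - F 0"
proof -
  have L0: "L \<ge> 0" using L[of 0 1] by simp
  have bound: "\<bar>rsum n f - (F 1 - F 0)\<bar> \<le> L / real n" if n: "n \<ge> 1" for n :: nat
  proof -
    have step: "\<bar>f (real (Suc k) / real n) / real n - (F (real (Suc k) / real n) - F (real k / real n))\<bar>
        \<le> L / real n / real n" if k: "k < n" for k
    proof -
      have lt: "real k / real n < real (Suc k) / real n" using n by (simp add: divide_strict_right_mono)
      obtain z where z: "real k / real n < z" "z < real (Suc k) / real n"
        "F (real (Suc k) / real n) - F (real k / real n) = (real (Suc k) / real n - real k / real n) * f z"
        using MVT2[OF lt, of F f] F by auto
      have d: "real (Suc k) / real n - real k / real n = 1 / real n" by (simp add: diff_divide_distrib[symmetric])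
      have "0 \<le> real k / real n" by simp
      then have "0 \<le> z" using z(1) by linarith
      moreover have "real (Suc k) / real n \<le> 1" using rsum_grid[OF k] unfolding atLeastAtMost_iff by blast
      then have "z \<le> 1" using z(2) by linarith
      ultimately have "z \<in> {0..1}" by simp
      then have "\<bar>f (real (Suc k) / real n) - f z\<bar> \<le> L * \<bar>real (Suc k) / real n - z\<bar>"
        using rsum_grid[OF k] by (intro L)
      also have "\<dots> \<le> L * (1 / real n)" using z d L0 by (intro mult_left_mono) auto
      finally have "\<bar>f (real (Suc k) / real n) - f z\<bar> \<le> L / real n" by simp
      then have "\<bar>f (real (Suc k) / real n) - f z\<bar> / real n \<le> L / real n / real n"
        by (rule divide_right_mono) simp
      then show ?thesis unfolding z(3) d by (simp add: diff_divide_distrib[symmetric])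
    qed
    have "(\<Sum>k<n. F (real (Suc k) / real n) - F (real k / real n)) = F 1 - F 0"
      using sum_lessThan_telescope[of "\<lambda>k. F (real k / real n)" n] n by simp
    then have "rsum n f - (F 1 - F 0) = (\<Sum>k<n. f (real (Suc k) / real n) / real n - (F (real (Suc k) / real n) - F (real k / real n)))"
      by (simp add: rsum_def sum_subtractf sum_divide_distrib)
    also have "\<bar>\<dots>\<bar> \<le> (\<Sum>k<n. L / real n / real n)"
      by (rule order_trans[OF sum_abs], rule sum_mono) (use step in auto)
    also have "\<dots> = L / real n" using n by simp
    finally show ?thesis .
  qed
  show ?thesis
  proof (rule LIM_zero_cancel, rule Lim_null_comparison)
    show "\<forall>\<^sub>F n in sequentially. norm (rsum n f - (F 1 - F 0)) \<le> L * (1 / real n)"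
      using bound by (auto simp: eventually_sequentially)
    have "(\<lambda>n. L * (1 / real n)) \<longlonglongrightarrow> L * 0" by (intro tendsto_intros lim_1_over_n)
    then show "(\<lambda>n. L * (1 / real n)) \<longlonglongrightarrow> 0" by simp
  qed
qed

lemma power_lipschitz:
  fixes x y :: real
  assumes "x \<in> {0..1}" "y \<in> {0..1}"
  shows "\<bar>x ^ m - y ^ m\<bar> \<le> real m * \<bar>x - y\<bar>"
  using norm_power_diff[of x y m] assms by simp

lemma closed_msupport: "closed (msupport M)"
proof -
  have "open (- msupport M)"
  proof (subst open_subopen, rule ballI)
    fix x assume "x \<in> - msupport M"
    then obtain U where "open U" "x \<in> U" "\<not> emeasure M U > 0" by (auto simp: msupport_def)
    then show "\<exists>T. open T \<and> x \<in> T \<and> T \<subseteq> - msupport M" by (intro exI[of _ U]) (auto simp: msupport_def)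
  qed
  then show ?thesis by (simp add: closed_def)
qed

text \<open>
The first two coordinates, \<open>lin 1 0 1\<close> and \<open>2 * energy 1\<close> form a global coordinate system whose
inverse is continuous.
\<close>

lemma closed_in_coordinates:
  assumes S: "closed S"
    and near: "\<And>\<epsilon>. \<epsilon> > 0 \<Longrightarrow> \<exists>z\<in>S. \<bar>z $ 1 - p $ 1\<bar> \<le> \<epsilon> \<and> \<bar>z $ 2 - p $ 2\<bar> \<le> \<epsilon> \<and>
      \<bar>lin 1 0 1 z - lin 1 0 1 p\<bar> \<le> \<epsilon> \<and> \<bar>2 * energy 1 z - 2 * energy 1 p\<bar> \<le> \<epsilon>"
  shows "p \<in> S"
proof -
  have "\<forall>n. \<exists>z\<in>S. \<bar>z $ 1 - p $ 1\<bar> \<le> 1 / real (Suc n) \<and> \<bar>z $ 2 - p $ 2\<bar> \<le> 1 / real (Suc n) \<and>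
      \<bar>lin 1 0 1 z - lin 1 0 1 p\<bar> \<le> 1 / real (Suc n) \<and> \<bar>2 * energy 1 z - 2 * energy 1 p\<bar> \<le> 1 / real (Suc n)"
    by (intro allI near) simp
  then obtain z where z: "\<And>n. z n \<in> S" "\<And>n. \<bar>z n $ 1 - p $ 1\<bar> \<le> 1 / real (Suc n)"
      "\<And>n. \<bar>z n $ 2 - p $ 2\<bar> \<le> 1 / real (Suc n)" "\<And>n. \<bar>lin 1 0 1 (z n) - lin 1 0 1 p\<bar> \<le> 1 / real (Suc n)"
      "\<And>n. \<bar>2 * energy 1 (z n) - 2 * energy 1 p\<bar> \<le> 1 / real (Suc n)"
    by metis
  have lim: "f \<longlonglongrightarrow> a" if "\<And>n. \<bar>f n - a\<bar> \<le> 1 / real (Suc n)" for f :: "nat \<Rightarrow> real" and a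
    by (rule LIM_zero_cancel, rule Lim_null_comparison[OF _ LIMSEQ_Suc[OF lim_1_over_n]])
      (use that in auto)
  have 1: "(\<lambda>n. z n $ 1) \<longlonglongrightarrow> p $ 1" and 2: "(\<lambda>n. z n $ 2) \<longlonglongrightarrow> p $ 2"
    and l: "(\<lambda>n. lin 1 0 1 (z n)) \<longlonglongrightarrow> lin 1 0 1 p"
    and a: "(\<lambda>n. 2 * energy 1 (z n)) \<longlonglongrightarrow> 2 * energy 1 p"
    by (rule lim, rule z)+
  have 3: "(\<lambda>n. z n $ 3) \<longlonglongrightarrow> p $ 3"
    using tendsto_diff[OF l 1] by (simp add: lin_def)
  have 4: "(\<lambda>n. z n $ 4) \<longlonglongrightarrow> p $ 4"
  proof -
    have "(\<lambda>n. (2 * energy 1 (z n) - lin 1 0 1 (z n) * z n $ 1) / 2) \<longlonglongrightarrow> (2 * energy 1 p - lin 1 0 1 p * p $ 1) / 2"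
      by (intro tendsto_divide tendsto_diff tendsto_mult a l 1 tendsto_const) simp
    moreover have "(2 * energy 1 x - lin 1 0 1 x * x $ 1) / 2 = x $ 4" for x
      by (simp add: energy_def lin_def)
    ultimately show ?thesis by simp
  qed
  have "z \<longlonglongrightarrow> p"
  proof (rule vec_tendstoI)
    show "(\<lambda>n. z n $ i) \<longlonglongrightarrow> p $ i" for i
      using exhaust_4[of i] 1 2 3 4 by auto
  qed
  then show ?thesis using S z(1) closed_sequentially by metis
qed

context diffusion
begin

abbreviation time_one_support :: "fil set" where
  "time_one_support \<equiv> msupport (distr \<sigma> borel (\<lambda>c. c 1))"

text \<open>
Choose the points of the sequence one by one: \<open>step_positive\<close> provides a support point of the next
increment that leads back into the tube, wherever in the tube the sequence has arrived.  The curve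
must be Lipschitz and start at the origin, but its end point and integrals are free.
\<close>

lemma reach:
  assumes L: "L \<ge> 0" "\<And>x y. x \<in> {0..1} \<Longrightarrow> y \<in> {0..1} \<Longrightarrow> \<bar>\<phi>1 x - \<phi>1 y\<bar> \<le> L * \<bar>x - y\<bar>"
      "\<And>x y. x \<in> {0..1} \<Longrightarrow> y \<in> {0..1} \<Longrightarrow> \<bar>\<phi>2 x - \<phi>2 y\<bar> \<le> L * \<bar>x - y\<bar>"
    and start0: "\<phi>1 0 = 0" "\<phi>2 0 = (0::real)"
    and M: "\<And>t. t \<in> {0..1} \<Longrightarrow> \<bar>\<phi>1 t\<bar> \<le> M"
    and \<epsilon>: "0 < \<epsilon>" "\<epsilon> \<le> 1"
  shows "\<forall>\<^sub>F n in sequentially. \<exists>z\<in>time_one_support. \<bar>z $ 1 - \<phi>1 1\<bar> \<le> \<epsilon> \<and> \<bar>z $ 2 - \<phi>2 1\<bar> \<le> \<epsilon> \<and>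
    \<bar>lin 1 0 1 z - rsum n \<phi>1\<bar> \<le> 2 * \<epsilon> \<and> \<bar>2 * energy 1 z - rsum n (\<lambda>t. (\<phi>1 t)\<^sup>2)\<bar> \<le> \<epsilon> * (4 * M + 5)"
proof -
  obtain \<nu> where nu: "\<nu> > 0" "\<And>f1 f2. \<nu> * (f1\<^sup>2 + f2\<^sup>2) \<le> (\<Sum>i=1..q. (f1 * E i $ 1 + f2 * E i $ 2)\<^sup>2)"
    using nondegenerate by blast
  define m where "m = sqrt \<nu> * \<epsilon> / 4"
  have m: "m > 0" using nu \<epsilon> by (simp add: m_def)
  define C1 where "C1 = 4 * \<epsilon> * L + 2 * L\<^sup>2"
  define C3 where "C3 = (\<alpha> + \<beta>) / m + (\<alpha> + 1) / 2 / \<epsilon> + ((3 * \<alpha>\<^sup>2 + 1) / 2 + \<alpha>) / \<epsilon>"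
  have sq: "(\<lambda>n. C * sqrt (1 / real n)) \<longlonglongrightarrow> 0" for C
  proof -
    have "(\<lambda>n. C * sqrt (1 / real n)) \<longlonglongrightarrow> C * sqrt 0" by (intro tendsto_intros lim_1_over_n)
    then show ?thesis by simp
  qed
  have "\<forall>\<^sub>F n in sequentially. C1 * sqrt (1 / real n) < m"
    "\<forall>\<^sub>F n in sequentially. m * sqrt (1 / real n) < \<epsilon>\<^sup>2 / 4"
    "\<forall>\<^sub>F n in sequentially. C3 * sqrt (1 / real n) < measure std_normal_distribution {..-1}"
    by (rule order_tendstoD(2)[OF sq], use m \<epsilon> std_normal_lower_tail_pos in simp)+
  moreover have "\<forall>\<^sub>F n in sequentially. n \<ge> (2::nat)" by (rule eventually_ge_at_top)
  ultimately show ?thesis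
  proof eventually_elim
    case (elim n)
    note h = elim(1-3) and n = elim(4)
    define \<tau> where "\<tau> k = real k / real n" for k
    define \<delta> where "\<delta> = 1 / real n"
    have \<delta>: "\<delta> > 0" "\<delta> \<le> 1/2" "real n * \<delta> = 1" using n by (auto simp: \<delta>_def field_simps)
    have \<tau>: "\<tau> k \<in> {0..1}" if "k \<le> n" for k using that n by (auto simp: \<tau>_def divide_le_eq)
    have \<tau>d: "\<tau> (Suc k) - \<tau> k = \<delta>" for k by (simp add: \<tau>_def \<delta>_def diff_divide_distrib[symmetric])
    define tube where "tube k x \<longleftrightarrow> (x $ 1 - \<phi>1 (\<tau> k))\<^sup>2 + (x $ 2 - \<phi>2 (\<tau> k))\<^sup>2 < \<epsilon>\<^sup>2" for k and x :: fil
    define \<mu> where "\<mu> k = distr \<sigma> borel (\<lambda>c. fil_mult (- c (\<tau> k)) (c (\<tau> (Suc k))))" for k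
    let ?P = "\<lambda>k x. (k = 0 \<longrightarrow> x = 0) \<and> (k \<le> n \<longrightarrow> tube k x)"
    let ?Q = "\<lambda>k x y. k < n \<longrightarrow> fil_mult (- x) y \<in> msupport (\<mu> k) \<and>
      \<bar>\<tau> k * fil_mult (- x) y $ 1 + fil_mult (- x) y $ 3\<bar> < \<epsilon> * \<delta> \<and> \<bar>fil_mult (- x) y $ 4\<bar> < \<epsilon> * \<delta>"
    have "\<exists>x. \<forall>k. ?P k (x k) \<and> ?Q k (x k) (x (Suc k))"
    proof (rule dependent_nat_choice)
      show "\<exists>x. ?P 0 x" using \<epsilon> by (intro exI[of _ 0]) (simp add: tube_def \<tau>_def start0)
      fix x k assume P: "?P k x"
      show "\<exists>y. ?P (Suc k) y \<and> ?Q k x y"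
      proof (cases "k < n")
        case False
        then show ?thesis by (intro exI[of _ 0]) auto
      next
        case True
        let ?d1 = "\<phi>1 (\<tau> (Suc k)) - \<phi>1 (\<tau> k)" and ?d2 = "\<phi>2 (\<tau> (Suc k)) - \<phi>2 (\<tau> k)"
        let ?S = "step_set \<epsilon> (\<tau> k) \<delta> (x $ 1 - \<phi>1 (\<tau> k) - ?d1) (x $ 2 - \<phi>2 (\<tau> k) - ?d2)"
        have kn: "\<tau> k \<in> {0..1}" "\<tau> (Suc k) \<in> {0..1}" using True \<tau> by auto
        have st: "0 \<le> \<tau> k" "\<tau> k < \<tau> (Suc k)" "\<tau> (Suc k) \<le> 1" "\<tau> (Suc k) - \<tau> k \<le> 1/2"
          using kn \<tau>d[of k] \<delta> by auto
        have d: "\<bar>?d1\<bar> \<le> L * (\<tau> (Suc k) - \<tau> k)" "\<bar>?d2\<bar> \<le> L * (\<tau> (Suc k) - \<tau> k)"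
          using L(2)[OF kn(2,1)] L(3)[OF kn(2,1)] st by auto
        have "prob {c \<in> space \<sigma>. fil_mult (- c (\<tau> k)) (c (\<tau> (Suc k))) \<in> ?S} > 0"
          using step_positive[OF st nu \<epsilon>(1) L(1) _ _ _ _ d, of "x $ 1 - \<phi>1 (\<tau> k)" "x $ 2 - \<phi>2 (\<tau> k)"]
            h P True unfolding \<tau>d \<delta>_def[symmetric] m_def[symmetric] C1_def[symmetric] C3_def[symmetric]
          by (simp add: tube_def)
        moreover have ym: "(\<lambda>c. fil_mult (- c (\<tau> k)) (c (\<tau> (Suc k)))) \<in> borel_measurable \<sigma>"
          by (rule increment_measurable) (auto simp: \<tau>_def)
        ultimately have pos: "emeasure (\<mu> k) ?S > 0"
          unfolding \<mu>_def
          by (subst emeasure_distr[OF ym]) (auto simp: open_step_set emeasure_eq_measure vimage_def Int_def conj_commute)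
        have "\<exists>p\<in>?S. p \<in> msupport (\<mu> k)"
          by (rule open_meets_msupport[OF _ open_step_set pos]) (simp add: \<mu>_def)
        then obtain p where p: "p \<in> ?S" "p \<in> msupport (\<mu> k)" by blast
        have c: "fil_mult (- x) (fil_mult x p) = p"
          using fil_mult_cancel[of "- x" p] by simp
        have "tube (Suc k) (fil_mult x p)"
          using p(1) by (simp add: tube_def step_set_def fil_mult_nth algebra_simps)
        then show ?thesis using p by (intro exI[of _ "fil_mult x p"]) (simp add: c step_set_def)
      qed
    qed
    then obtain x where x: "\<And>k. ?P k (x k)" "\<And>k. ?Q k (x k) (x (Suc k))" by blast
    have x0: "x 0 = 0" using x(1)[of 0] by simp
    have tube: "\<bar>x k $ 1 - \<phi>1 (\<tau> k)\<bar> \<le> \<epsilon>" "\<bar>x k $ 2 - \<phi>2 (\<tau> k)\<bar> \<le> \<epsilon>" if "k \<le> n" for k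
    proof -
      have "(x k $ 1 - \<phi>1 (\<tau> k))\<^sup>2 + (x k $ 2 - \<phi>2 (\<tau> k))\<^sup>2 < \<epsilon>\<^sup>2" using x(1)[of k] that by (simp add: tube_def)
      then have "(x k $ 1 - \<phi>1 (\<tau> k))\<^sup>2 \<le> \<epsilon>\<^sup>2" "(x k $ 2 - \<phi>2 (\<tau> k))\<^sup>2 \<le> \<epsilon>\<^sup>2"
        using zero_le_power2[of "x k $ 1 - \<phi>1 (\<tau> k)"] zero_le_power2[of "x k $ 2 - \<phi>2 (\<tau> k)"] by linarith+
      then show "\<bar>x k $ 1 - \<phi>1 (\<tau> k)\<bar> \<le> \<epsilon>" "\<bar>x k $ 2 - \<phi>2 (\<tau> k)\<bar> \<le> \<epsilon>"
        using \<epsilon> by (simp_all add: abs_le_square_iff[symmetric])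
    qed
    have supp: "x n \<in> time_one_support"
      using n x(2) by (intro product_in_support[of n x, OF _ x0]) (auto simp: \<mu>_def \<tau>_def)
    have \<tau>n: "\<tau> n = 1" using n by (simp add: \<tau>_def)
    have \<tau>\<delta>: "real k * \<delta> = \<tau> k" for k by (simp add: \<tau>_def \<delta>_def)
    have rs: "rsum n f = \<delta> * (\<Sum>k<n. f (\<tau> (Suc k)))" for f
      by (simp add: rsum_def \<delta>_def \<tau>_def)
    have xb: "\<bar>x k $ 1\<bar> \<le> M + 1" if "k \<le> n" for k
      using tube(1)[OF that] M[OF \<tau>[OF that]] \<epsilon> by linarith
    have r: "\<bar>lin (\<tau> k) 0 1 (x (Suc k)) - lin (\<tau> k) 0 1 (x k)\<bar> \<le> \<epsilon> * \<delta>" if "k < n" for k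
      using x(2)[of k] that by (simp add: increment_nth(1-3) lin_def algebra_simps)
    have z: "\<bar>energy (\<tau> k) (x (Suc k)) - energy (\<tau> k) (x k)\<bar> \<le> \<epsilon> * \<delta> * (M + 2)" if k: "k < n" for k
    proof -
      let ?r = "lin (\<tau> k) 0 1 (x (Suc k)) - lin (\<tau> k) 0 1 (x k)" and ?a = "(x k $ 1 + x (Suc k) $ 1) / 2"
      have "energy (\<tau> k) (x (Suc k)) - energy (\<tau> k) (x k) = fil_mult (- x k) (x (Suc k)) $ 4 + ?r * ?a"
        by (simp add: increment_nth(4)[of _ _ "\<tau> k"])
      moreover have "\<bar>fil_mult (- x k) (x (Suc k)) $ 4\<bar> \<le> \<epsilon> * \<delta>" using x(2)[of k] k by simp
      moreover have "\<bar>?r * ?a\<bar> \<le> \<epsilon> * \<delta> * (M + 1)"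
        unfolding abs_mult using r[OF k] xb[of k] xb[of "Suc k"] k \<epsilon> \<delta> by (intro mult_mono) auto
      ultimately show ?thesis by (simp add: algebra_simps)
    qed
    have 1: "\<bar>lin 1 0 1 (x n) - rsum n \<phi>1\<bar> \<le> 2 * \<epsilon>"
    proof -
      have "lin 1 0 1 (x n) - rsum n \<phi>1 = (\<Sum>k<n. lin (\<tau> k) 0 1 (x (Suc k)) - lin (\<tau> k) 0 1 (x k))
          + \<delta> * (\<Sum>k<n. x (Suc k) $ 1 - \<phi>1 (\<tau> (Suc k)))"
        using lin_telescope[of x, OF x0, of n \<delta>] unfolding rs \<tau>\<delta> \<tau>n
        by (simp add: sum_subtractf right_diff_distrib)
      moreover have "\<bar>\<Sum>k<n. lin (\<tau> k) 0 1 (x (Suc k)) - lin (\<tau> k) 0 1 (x k)\<bar> \<le> (\<Sum>k<n. \<epsilon> * \<delta>)"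
        by (rule order_trans[OF sum_abs], rule sum_mono) (use r in auto)
      moreover have "\<bar>\<Sum>k<n. x (Suc k) $ 1 - \<phi>1 (\<tau> (Suc k))\<bar> \<le> (\<Sum>k<n. \<epsilon>)"
        by (rule order_trans[OF sum_abs], rule sum_mono) (use tube(1) in auto)
      then have "\<bar>\<delta> * (\<Sum>k<n. x (Suc k) $ 1 - \<phi>1 (\<tau> (Suc k)))\<bar> \<le> \<delta> * (\<Sum>k<n. \<epsilon>)"
        unfolding abs_mult using \<delta> by (intro mult_mono) auto
      moreover have "(\<Sum>k<n. \<epsilon> * \<delta>) = \<epsilon>" "\<delta> * (\<Sum>k<n. \<epsilon>) = \<epsilon>"
        using n by (simp_all add: \<delta>_def)
      ultimately show ?thesis by linarith
    qed
    have 2: "\<bar>2 * energy 1 (x n) - rsum n (\<lambda>t. (\<phi>1 t)\<^sup>2)\<bar> \<le> \<epsilon> * (4 * M + 5)"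
    proof -
      have "2 * energy 1 (x n) - rsum n (\<lambda>t. (\<phi>1 t)\<^sup>2) = 2 * (\<Sum>k<n. energy (\<tau> k) (x (Suc k)) - energy (\<tau> k) (x k))
          + \<delta> * (\<Sum>k<n. (x (Suc k) $ 1)\<^sup>2 - (\<phi>1 (\<tau> (Suc k)))\<^sup>2)"
        using energy_telescope[of x, OF x0, of n \<delta>] unfolding rs \<tau>\<delta> \<tau>n
        by (simp add: sum_subtractf right_diff_distrib)
      moreover have "\<bar>\<Sum>k<n. energy (\<tau> k) (x (Suc k)) - energy (\<tau> k) (x k)\<bar> \<le> (\<Sum>k<n. \<epsilon> * \<delta> * (M + 2))"
        by (rule order_trans[OF sum_abs], rule sum_mono) (use z in auto)
      moreover have "\<bar>(x (Suc k) $ 1)\<^sup>2 - (\<phi>1 (\<tau> (Suc k)))\<^sup>2\<bar> \<le> \<epsilon> * (2 * M + 1)" if "k < n" for k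
      proof -
        have "(x (Suc k) $ 1)\<^sup>2 - (\<phi>1 (\<tau> (Suc k)))\<^sup>2 = (x (Suc k) $ 1 - \<phi>1 (\<tau> (Suc k))) * (x (Suc k) $ 1 + \<phi>1 (\<tau> (Suc k)))"
          by (simp add: power2_eq_square algebra_simps)
        moreover have "\<bar>x (Suc k) $ 1 + \<phi>1 (\<tau> (Suc k))\<bar> \<le> 2 * M + 1"
          using xb[of "Suc k"] M[OF \<tau>[of "Suc k"]] that by linarith
        ultimately show ?thesis unfolding abs_mult using tube(1)[of "Suc k"] that \<epsilon>
          by (auto simp: abs_mult intro!: mult_mono)
      qed
      then have "\<bar>\<Sum>k<n. (x (Suc k) $ 1)\<^sup>2 - (\<phi>1 (\<tau> (Suc k)))\<^sup>2\<bar> \<le> (\<Sum>k<n. \<epsilon> * (2 * M + 1))"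
        by (intro order_trans[OF sum_abs] sum_mono) auto
      then have "\<bar>\<delta> * (\<Sum>k<n. (x (Suc k) $ 1)\<^sup>2 - (\<phi>1 (\<tau> (Suc k)))\<^sup>2)\<bar> \<le> \<delta> * (\<Sum>k<n. \<epsilon> * (2 * M + 1))"
        unfolding abs_mult using \<delta> by (intro mult_mono) auto
      moreover have "(\<Sum>k<n. \<epsilon> * \<delta> * (M + 2)) = \<epsilon> * (M + 2)" "\<delta> * (\<Sum>k<n. \<epsilon> * (2 * M + 1)) = \<epsilon> * (2 * M + 1)"
        using n by (simp_all add: \<delta>_def)
      ultimately have "\<bar>2 * energy 1 (x n) - rsum n (\<lambda>t. (\<phi>1 t)\<^sup>2)\<bar> \<le> 2 * (\<epsilon> * (M + 2)) + \<epsilon> * (2 * M + 1)"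
        by linarith
      then show ?thesis by (simp add: algebra_simps)
    qed
    show ?case using supp 1 2 tube[of n] \<tau>n by (intro bexI[of _ "x n"]) auto
  qed
qed

text \<open>
A curve must run from 0 to \<open>w\<close> and have integral \<open>u\<close> and squared integral \<open>J \<ge> u\<^sup>2\<close>, approximately.  The
affine function \<open>g\<close> has both integrals exactly, since \<open>2 t - 1\<close> has mean 0 and mean square \<open>1/3\<close>.
The multiples of \<open>(1 - t)\<^sup>m\<close> and \<open>t\<^sup>m\<close> are boundary layers that correct its values at 0 and at 1;
for large \<open>m\<close> their effect on the integrals is negligible.  The parameters are chosen in the order
\<open>m\<close>, \<open>\<epsilon>\<close>, \<open>n\<close>.
\<close>

lemma target_in_support:
  assumes p: "(lin 1 0 1 p)\<^sup>2 \<le> 2 * energy 1 p"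
  shows "p \<in> time_one_support"
proof (rule closed_in_coordinates[OF closed_msupport])
  fix \<eta> :: real assume \<eta>: "\<eta> > 0"
  define u where "u = lin 1 0 1 p"
  define J where "J = 2 * energy 1 p"
  define w where "w = p $ 1"
  define l where "l = sqrt (3 * (J - u\<^sup>2))"
  have l2: "l\<^sup>2 / 3 = J - u\<^sup>2" using p by (simp add: l_def u_def J_def)
  define g where "g t = u + l * (2 * t - 1)" for t
  define C0 where "C0 = \<bar>u - l\<bar> + \<bar>w - u - l\<bar>"
  define B where "B = \<bar>u\<bar> + \<bar>l\<bar>"
  define M where "M = B + 2 * C0"
  have C0: "C0 \<ge> 0" and M0: "M \<ge> 0" by (simp_all add: C0_def M_def B_def)
  define K where "K = (1 + 2 * M) * C0"
  have K0: "K \<ge> 0" using C0 M0 by (simp add: K_def)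
  obtain m :: nat where m: "m \<ge> 1" "K * (3 / real (Suc m)) < \<eta> / 4"
  proof -
    have "(\<lambda>m. K * (3 * (1 / real (Suc m)))) \<longlonglongrightarrow> K * (3 * 0)"
      by (intro tendsto_mult tendsto_const LIMSEQ_Suc[OF lim_1_over_n])
    then have "\<forall>\<^sub>F m in sequentially. K * (3 * (1 / real (Suc m))) < \<eta> / 4"
      by (rule order_tendstoD(2)) (use \<eta> in simp)
    then have "\<forall>\<^sub>F m in sequentially. m \<ge> 1 \<and> K * (3 * (1 / real (Suc m))) < \<eta> / 4"
      by (intro eventually_conj eventually_ge_at_top)
    then show ?thesis using that by (auto simp: eventually_sequentially)
  qed
  define h where "h t = (1 - t) ^ m + t ^ m" for t :: real
  define \<phi>1 where "\<phi>1 t = g t - (u - l) * (1 - t) ^ m + (w - u - l) * t ^ m" for t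
  define \<phi>2 where "\<phi>2 t = p $ 2 * t" for t
  have h0: "0 \<le> h t" "h t \<le> 2" if "t \<in> {0..1}" for t
    using that power_le_one[of t m] power_le_one[of "1 - t" m] by (auto simp: h_def intro: add_nonneg_nonneg)
  have gb: "\<bar>g t\<bar> \<le> B" if "t \<in> {0..1}" for t
  proof -
    have "\<bar>l * (2 * t - 1)\<bar> \<le> \<bar>l\<bar> * 1" unfolding abs_mult using that by (intro mult_left_mono) auto
    then show ?thesis unfolding g_def B_def by linarith
  qed
  have close: "\<bar>\<phi>1 t - g t\<bar> \<le> C0 * h t" if t: "t \<in> {0..1}" for t
  proof -
    have "\<bar>(u - l) * (1 - t) ^ m\<bar> \<le> C0 * (1 - t) ^ m" "\<bar>(w - u - l) * t ^ m\<bar> \<le> C0 * t ^ m"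
      unfolding abs_mult using t by (auto simp: C0_def intro!: mult_mono)
    then show ?thesis unfolding \<phi>1_def h_def by (simp add: algebra_simps)
  qed
  have \<phi>b: "\<bar>\<phi>1 t\<bar> \<le> M" if t: "t \<in> {0..1}" for t
  proof -
    have "C0 * h t \<le> C0 * 2" by (intro mult_left_mono h0 t C0)
    then show ?thesis using close[OF t] gb[OF t] unfolding M_def by linarith
  qed
  have close2: "\<bar>(\<phi>1 t)\<^sup>2 - (g t)\<^sup>2\<bar> \<le> 2 * M * C0 * h t" if t: "t \<in> {0..1}" for t
  proof -
    have "(\<phi>1 t)\<^sup>2 - (g t)\<^sup>2 = (\<phi>1 t - g t) * (\<phi>1 t + g t)" by (simp add: power2_eq_square algebra_simps)
    then have "\<bar>(\<phi>1 t)\<^sup>2 - (g t)\<^sup>2\<bar> = \<bar>\<phi>1 t - g t\<bar> * \<bar>\<phi>1 t + g t\<bar>" by (simp add: abs_mult)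
    also have "\<dots> \<le> (C0 * h t) * (2 * M)"
    proof (intro mult_mono close t)
      have "\<bar>\<phi>1 t + g t\<bar> \<le> \<bar>\<phi>1 t\<bar> + \<bar>g t\<bar>" by (rule abs_triangle_ineq)
      also have "\<dots> \<le> M + B" by (intro add_mono \<phi>b gb t)
      also have "\<dots> \<le> 2 * M" using C0 by (simp add: M_def)
      finally show "\<bar>\<phi>1 t + g t\<bar> \<le> 2 * M" .
    qed (use C0 h0(1)[OF t] in auto)
    finally show ?thesis by (simp add: mult_ac)
  qed
  define L where "L = 2 * \<bar>l\<bar> + real m * C0 + \<bar>p $ 2\<bar>"
  have gL: "\<bar>g x - g y\<bar> \<le> 2 * \<bar>l\<bar> * \<bar>x - y\<bar>" for x y
  proof -
    have "g x - g y = 2 * l * (x - y)" by (simp add: g_def algebra_simps)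
    then show ?thesis by (simp add: abs_mult)
  qed
  have hL: "\<bar>(1 - x) ^ m - (1 - y) ^ m\<bar> \<le> real m * \<bar>x - y\<bar>" "\<bar>x ^ m - y ^ m\<bar> \<le> real m * \<bar>x - y\<bar>"
    if "x \<in> {0..1}" "y \<in> {0..1}" for x y :: real
    using power_lipschitz[of "1 - x" "1 - y" m] power_lipschitz[of x y m] that by (auto simp: abs_minus_commute)
  have L1: "\<bar>\<phi>1 x - \<phi>1 y\<bar> \<le> L * \<bar>x - y\<bar>" if xy: "x \<in> {0..1}" "y \<in> {0..1}" for x y
  proof -
    have e: "\<phi>1 x - \<phi>1 y = (g x - g y) - (u - l) * ((1 - x) ^ m - (1 - y) ^ m) + (w - u - l) * (x ^ m - y ^ m)"
      by (simp add: \<phi>1_def algebra_simps)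
    have "\<bar>(u - l) * ((1 - x) ^ m - (1 - y) ^ m)\<bar> \<le> \<bar>u - l\<bar> * (real m * \<bar>x - y\<bar>)"
      "\<bar>(w - u - l) * (x ^ m - y ^ m)\<bar> \<le> \<bar>w - u - l\<bar> * (real m * \<bar>x - y\<bar>)"
      unfolding abs_mult by (intro mult_left_mono hL xy; simp)+
    then have "\<bar>\<phi>1 x - \<phi>1 y\<bar> \<le> 2 * \<bar>l\<bar> * \<bar>x - y\<bar> + \<bar>u - l\<bar> * (real m * \<bar>x - y\<bar>) + \<bar>w - u - l\<bar> * (real m * \<bar>x - y\<bar>)"
      using gL[of x y] unfolding e by linarith
    also have "\<dots> = (2 * \<bar>l\<bar> + real m * C0) * \<bar>x - y\<bar>" by (simp add: C0_def algebra_simps)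
    also have "\<dots> \<le> L * \<bar>x - y\<bar>" unfolding L_def by (intro mult_right_mono) auto
    finally show ?thesis .
  qed
  have L2: "\<bar>\<phi>2 x - \<phi>2 y\<bar> \<le> L * \<bar>x - y\<bar>" for x y
  proof -
    have "\<phi>2 x - \<phi>2 y = p $ 2 * (x - y)" by (simp add: \<phi>2_def algebra_simps)
    then have "\<bar>\<phi>2 x - \<phi>2 y\<bar> = \<bar>p $ 2\<bar> * \<bar>x - y\<bar>" by (simp add: abs_mult)
    also have "\<dots> \<le> L * \<bar>x - y\<bar>" unfolding L_def using C0 by (intro mult_right_mono) auto
    finally show ?thesis .
  qed
  have L0: "L \<ge> 0" using C0 by (simp add: L_def)
  have start0: "\<phi>1 0 = 0" "\<phi>2 0 = 0" using m(1) by (simp_all add: \<phi>1_def \<phi>2_def g_def)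
  have end1: "\<phi>1 1 = w" "\<phi>2 1 = p $ 2" using m(1) by (simp_all add: \<phi>1_def \<phi>2_def g_def)
  define \<epsilon> where "\<epsilon> = min 1 (\<eta> / (4 * (4 * M + 5)))"
  have \<epsilon>: "0 < \<epsilon>" "\<epsilon> \<le> 1" using \<eta> M0 by (auto simp: \<epsilon>_def)
  have "\<epsilon> * (4 * M + 5) \<le> \<eta> / (4 * (4 * M + 5)) * (4 * M + 5)"
    unfolding \<epsilon>_def using M0 by (intro mult_right_mono) auto
  also have "\<dots> = \<eta> / 4" using M0 by (simp add: field_simps)
  finally have \<epsilon>1: "\<epsilon> * (4 * M + 5) \<le> \<eta> / 4" .
  have "\<epsilon> * 5 \<le> \<epsilon> * (4 * M + 5)" using \<epsilon> M0 by (intro mult_left_mono) auto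
  then have \<epsilon>2: "\<epsilon> * 5 \<le> \<eta> / 4" using \<epsilon>1 by linarith
  have "(\<lambda>n. rsum n h) \<longlonglongrightarrow>
      (- ((1 - 1) ^ Suc m) / real (Suc m) + 1 ^ Suc m / real (Suc m)) - (- ((1 - 0) ^ Suc m) / real (Suc m) + 0 ^ Suc m / real (Suc m))"
  proof (rule rsum_tendsto[where L = "2 * real m"])
    have "((\<lambda>t. - ((1 - t) ^ Suc m) / real (Suc m)) has_real_derivative (1 - t) ^ m) (at t)" for t
      by (auto intro!: derivative_eq_intros simp del: of_nat_Suc power_Suc)
    moreover have "((\<lambda>t. t ^ Suc m / real (Suc m)) has_real_derivative t ^ m) (at t)" for t
      by (auto intro!: derivative_eq_intros simp del: of_nat_Suc power_Suc)
    ultimately show "((\<lambda>t. - ((1 - t) ^ Suc m) / real (Suc m) + t ^ Suc m / real (Suc m)) has_real_derivative h t) (at t)" for t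
      unfolding h_def by (rule DERIV_add)
    show "\<bar>h x - h y\<bar> \<le> 2 * real m * \<bar>x - y\<bar>" if "x \<in> {0..1}" "y \<in> {0..1}" for x y
      using hL[OF that] unfolding h_def by linarith
  qed
  then have "(\<lambda>n. rsum n h) \<longlonglongrightarrow> 2 / real (Suc m)" by simp
  then have ev1: "\<forall>\<^sub>F n in sequentially. rsum n h < 3 / real (Suc m)"
    by (rule order_tendstoD(2)) (simp add: divide_strict_right_mono)
  have "(\<lambda>n. rsum n g) \<longlonglongrightarrow> (u * 1 + l * (1\<^sup>2 - 1)) - (u * 0 + l * (0\<^sup>2 - 0))"
  proof (rule rsum_tendsto)
    show "((\<lambda>t. u * t + l * (t\<^sup>2 - t)) has_real_derivative g t) (at t)" for t
      unfolding g_def by (auto intro!: derivative_eq_intros)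
  qed (rule gL)
  then have "(\<lambda>n. \<bar>rsum n g - u\<bar>) \<longlonglongrightarrow> \<bar>u - u\<bar>" by (intro tendsto_intros) simp
  then have ev2: "\<forall>\<^sub>F n in sequentially. \<bar>rsum n g - u\<bar> < \<eta> / 4"
    by (rule order_tendstoD(2)) (use \<eta> in simp)
  have "(\<lambda>n. rsum n (\<lambda>t. (g t)\<^sup>2)) \<longlonglongrightarrow>
     (u\<^sup>2 * 1 + 2 * u * l * (1\<^sup>2 - 1) + l\<^sup>2 * (2 * 1 - 1) ^ 3 / 6) - (u\<^sup>2 * 0 + 2 * u * l * (0\<^sup>2 - 0) + l\<^sup>2 * (2 * 0 - 1) ^ 3 / 6)"
  proof (rule rsum_tendsto[where L = "2 * B * (2 * \<bar>l\<bar>)"])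
    show "((\<lambda>t. u\<^sup>2 * t + 2 * u * l * (t\<^sup>2 - t) + l\<^sup>2 * (2 * t - 1) ^ 3 / 6) has_real_derivative (g t)\<^sup>2) (at t)" for t
      unfolding g_def by (auto intro!: derivative_eq_intros simp: power2_eq_square field_simps)
    fix x y :: real assume xy: "x \<in> {0..1}" "y \<in> {0..1}"
    have "\<bar>(g x)\<^sup>2 - (g y)\<^sup>2\<bar> = \<bar>g x + g y\<bar> * \<bar>g x - g y\<bar>"
      by (simp add: abs_mult[symmetric] power2_eq_square algebra_simps)
    also have "\<dots> \<le> (2 * B) * (2 * \<bar>l\<bar> * \<bar>x - y\<bar>)"
      using gb[OF xy(1)] gb[OF xy(2)] by (intro mult_mono gL) auto
    finally show "\<bar>(g x)\<^sup>2 - (g y)\<^sup>2\<bar> \<le> 2 * B * (2 * \<bar>l\<bar>) * \<bar>x - y\<bar>" by (simp add: mult.assoc)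
  qed
  also have "(u\<^sup>2 * 1 + 2 * u * l * (1\<^sup>2 - 1) + l\<^sup>2 * (2 * 1 - 1) ^ 3 / 6) - (u\<^sup>2 * 0 + 2 * u * l * (0\<^sup>2 - 0) + l\<^sup>2 * (2 * 0 - 1) ^ 3 / 6) = u\<^sup>2 + l\<^sup>2 / 3"
    by simp
  also have "\<dots> = J" using l2 by linarith
  finally have "(\<lambda>n. rsum n (\<lambda>t. (g t)\<^sup>2)) \<longlonglongrightarrow> J" .
  then have "(\<lambda>n. \<bar>rsum n (\<lambda>t. (g t)\<^sup>2) - J\<bar>) \<longlonglongrightarrow> \<bar>J - J\<bar>" by (intro tendsto_intros)
  then have ev3: "\<forall>\<^sub>F n in sequentially. \<bar>rsum n (\<lambda>t. (g t)\<^sup>2) - J\<bar> < \<eta> / 4"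
    by (rule order_tendstoD(2)) (use \<eta> in simp)
  have "\<forall>\<^sub>F n in sequentially. n \<ge> 1 \<and> rsum n h < 3 / real (Suc m) \<and> \<bar>rsum n g - u\<bar> < \<eta> / 4 \<and>
     \<bar>rsum n (\<lambda>t. (g t)\<^sup>2) - J\<bar> < \<eta> / 4 \<and>
     (\<exists>z\<in>time_one_support. \<bar>z $ 1 - \<phi>1 1\<bar> \<le> \<epsilon> \<and> \<bar>z $ 2 - \<phi>2 1\<bar> \<le> \<epsilon> \<and>
    \<bar>lin 1 0 1 z - rsum n \<phi>1\<bar> \<le> 2 * \<epsilon> \<and> \<bar>2 * energy 1 z - rsum n (\<lambda>t. (\<phi>1 t)\<^sup>2)\<bar> \<le> \<epsilon> * (4 * M + 5))"
    by (intro eventually_conj eventually_ge_at_top ev1 ev2 ev3 reach[OF L0 L1 L2 start0 \<phi>b \<epsilon>])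
  then obtain n z where n: "n \<ge> 1" "rsum n h < 3 / real (Suc m)" "\<bar>rsum n g - u\<bar> < \<eta> / 4"
      "\<bar>rsum n (\<lambda>t. (g t)\<^sup>2) - J\<bar> < \<eta> / 4"
    and z: "z \<in> time_one_support" "\<bar>z $ 1 - \<phi>1 1\<bar> \<le> \<epsilon>" "\<bar>z $ 2 - \<phi>2 1\<bar> \<le> \<epsilon>"
      "\<bar>lin 1 0 1 z - rsum n \<phi>1\<bar> \<le> 2 * \<epsilon>" "\<bar>2 * energy 1 z - rsum n (\<lambda>t. (\<phi>1 t)\<^sup>2)\<bar> \<le> \<epsilon> * (4 * M + 5)"
    unfolding eventually_sequentially by blast
  have rh: "rsum n (\<lambda>t. C * h t) = C * rsum n h" for C
    by (simp add: rsum_def sum_distrib_left)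
  have rh0: "rsum n h \<ge> 0" unfolding rsum_def using h0(1) rsum_grid by (intro divide_nonneg_nonneg sum_nonneg) auto
  have "K * rsum n h \<le> K * (3 / real (Suc m))" using n K0 by (intro mult_left_mono) auto
  then have Kh: "K * rsum n h \<le> \<eta> / 4" using m by linarith
  have "C0 * rsum n h \<le> K * rsum n h" "2 * M * C0 * rsum n h \<le> K * rsum n h"
    unfolding K_def using C0 M0 rh0 by (auto intro!: mult_right_mono simp: algebra_simps)
  moreover have "\<bar>rsum n \<phi>1 - rsum n g\<bar> \<le> C0 * rsum n h"
    unfolding rh[symmetric] by (rule rsum_close[OF n(1) close])
  moreover have "\<bar>rsum n (\<lambda>t. (\<phi>1 t)\<^sup>2) - rsum n (\<lambda>t. (g t)\<^sup>2)\<bar> \<le> 2 * M * C0 * rsum n h"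
    unfolding rh[symmetric] by (rule rsum_close[OF n(1) close2])
  moreover have tri: "\<bar>a - d\<bar> \<le> x + y + e"
    if "\<bar>a - b\<bar> \<le> x" "\<bar>b - c\<bar> \<le> y" "\<bar>c - d\<bar> < e" for a b c d x y e :: real
    using that by linarith
  ultimately have "\<bar>lin 1 0 1 z - u\<bar> \<le> 2 * \<epsilon> + K * rsum n h + \<eta> / 4"
    "\<bar>2 * energy 1 z - J\<bar> \<le> \<epsilon> * (4 * M + 5) + K * rsum n h + \<eta> / 4"
    using tri[OF z(4) order_trans n(3)] tri[OF z(5) order_trans n(4)] by blast+
  moreover have "2 * \<epsilon> + K * rsum n h + \<eta> / 4 \<le> \<eta>" "\<epsilon> * (4 * M + 5) + K * rsum n h + \<eta> / 4 \<le> \<eta>"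
    using Kh \<epsilon>1 \<epsilon>2 \<epsilon>(1) \<eta> by linarith+
  ultimately have "\<bar>lin 1 0 1 z - u\<bar> \<le> \<eta>" "\<bar>2 * energy 1 z - J\<bar> \<le> \<eta>"
    by (blast intro: order_trans)+
  moreover have "\<bar>z $ 1 - p $ 1\<bar> \<le> \<eta>" "\<bar>z $ 2 - p $ 2\<bar> \<le> \<eta>"
    using z(2,3) \<epsilon>2 \<epsilon>(1) \<eta> by (simp_all add: end1 w_def)
  ultimately show "\<exists>z\<in>time_one_support. \<bar>z $ 1 - p $ 1\<bar> \<le> \<eta> \<and> \<bar>z $ 2 - p $ 2\<bar> \<le> \<eta> \<and>
      \<bar>lin 1 0 1 z - lin 1 0 1 p\<bar> \<le> \<eta> \<and> \<bar>2 * energy 1 z - 2 * energy 1 p\<bar> \<le> \<eta>"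
    using z(1) unfolding u_def J_def by blast
qed

lemma support_subset: "time_one_support \<subseteq> {p. (lin 1 0 1 p)\<^sup>2 \<le> 2 * energy 1 p}"
proof
  fix p assume p: "p \<in> time_one_support"
  have cm: "(\<lambda>c. c 1) \<in> borel_measurable \<sigma>" by (rule eval_measurable) simp
  show "p \<in> {p. (lin 1 0 1 p)\<^sup>2 \<le> 2 * energy 1 p}"
  proof (rule ccontr)
    assume "p \<notin> {p. (lin 1 0 1 p)\<^sup>2 \<le> 2 * energy 1 p}"
    moreover define U where "U = {p. 2 * energy 1 p < (lin 1 0 1 p)\<^sup>2}"
    ultimately have "p \<in> U" by simp
    moreover have U: "open U" unfolding U_def
      by (intro open_Collect_less continuous_intros smooth_imp_continuous_on smooth_lin smooth_energy)
    ultimately have "emeasure (distr \<sigma> borel (\<lambda>c. c 1)) U > 0" using p by (simp add: msupport_def)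
    then have "prob ((\<lambda>c. c 1) -` U \<inter> space \<sigma>) > 0"
      using U cm by (simp add: emeasure_distr emeasure_eq_measure)
    moreover have "prob ((\<lambda>c. c 1) -` U \<inter> space \<sigma>) \<le> prob {}"
      by (rule finite_measure_mono_AE) (use AE_lin_square_le_energy in \<open>auto simp: U_def elim!: eventually_mono\<close>)
    ultimately show False by simp
  qed
qed

theorem time_one_support_eq: "time_one_support = {p. (lin 1 0 1 p)\<^sup>2 \<le> 2 * energy 1 p}"
  using support_subset target_in_support by blast

end

theorem lemma3p23:
  fixes E :: "nat \<Rightarrow> fil" and q :: nat and \<sigma> :: "(real \<Rightarrow> fil) measure"
  assumes "span (E ` {1..q}) = weight_space 1"
    and "diffusion_law (diff_generator q E) \<sigma>"
  shows "msupport (distr \<sigma> borel (\<lambda>c. c 1)) =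
    {s1 *\<^sub>R vA + s2 *\<^sub>R vT + s3 *\<^sub>R bas 3 + s4 *\<^sub>R bas 4 | s1 s2 s3 s4.
       2 * s4 \<ge> (s1 + s3) * s3}"
proof -
  interpret diffusion q E \<sigma> by unfold_locales (fact assms)+
  \<comment> \<open>Cancel the common term \<open>(s\<^sub>1 + s\<^sub>3) s\<^sub>1\<close> on both sides.\<close>
  have iff: "(lin 1 0 1 p)\<^sup>2 \<le> 2 * energy 1 p \<longleftrightarrow> (p $ 1 + p $ 3) * p $ 3 \<le> 2 * p $ 4" for p
    by (simp add: lin_def energy_def power2_eq_square algebra_simps)
  have basis: "p = p $ 1 *\<^sub>R vA + p $ 2 *\<^sub>R vT + p $ 3 *\<^sub>R bas 3 + p $ 4 *\<^sub>R bas 4" for p :: fil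
    by (simp add: vec_eq_iff forall_4 axis_def)
  show ?thesis
    unfolding time_one_support_eq iff
  proof (intro equalityI subsetI)
    fix p :: fil assume "p \<in> {p. (p $ 1 + p $ 3) * p $ 3 \<le> 2 * p $ 4}"
    then show "p \<in> {s1 *\<^sub>R vA + s2 *\<^sub>R vT + s3 *\<^sub>R bas 3 + s4 *\<^sub>R bas 4 | s1 s2 s3 s4. 2 * s4 \<ge> (s1 + s3) * s3}"
      using basis[of p] by blast
  qed (auto simp: axis_def)
qed

end
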